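(* Let $1\leq q<\infty$ and let $1\leq\xi<\omega_1$ be a countable ordinal. Set $T_q=T_q[\frac{1}{2},\mathcal{S}_\xi]$ and let $T_q^*$ denote its dual. Let $1<p\leq\infty$ be conjugate to $q$, that is, $\frac{1}{p}+\frac{1}{q}=1$. Then $\mathcal{WD}_{\ell_p}^{(\infty,\xi)}(T_q^* )=\mathcal{L}(T_q^* )$, whereas $\mathcal{WD}_{\ell_p}^{(\infty,\omega_1)}(T_q^* )\neq\mathcal{L}(T_q^* )$.
   Context: All Banach spaces are over a fixed scalar field ($\mathbb{R}$ or $\mathbb{C}$); $\mathcal{L}(X)$ is the space of continuous linear operators $X\to X$; $c_{00}$ is the space of finitely supported scalar sequences with canonical unit vectors $(e_n)$; $\omega_1$ is the first uncountable ordinal. For finite $E,F\subset\mathbb{N}$, $E<F$ means $\max E<\min F$, and $n\leq F$ means $n\leq\min F$. Schreier families: $\mathcal{S}_0:=\{\{n\}:n\in\mathbb{N}\}\cup\{\emptyset\}$ and $\mathcal{S}_1:=\{F\subset\mathbb{N}:\#F\leq\min F\}\cup\{\emptyset\}$. If $\xi=\zeta+1$ with $1\leq\zeta<\omega_1$, $\mathcal{S}_\xi$ consists of $\emptyset$ and all $F\subset\mathbb{N}$ for which there are $n\in\mathbb{N}$ and $F_1<\cdots<F_n$ in $\mathcal{S}_\zeta$ with $\{\min F_k\}_{k=1}^n\in\mathcal{S}_1$ and $F=\bigcup_{k=1}^nF_k$. If $\xi<\omega_1$ is a limit ordinal, fix a strictly increasing sequence $(\zeta_n)$ of non-limit ordinals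 with $\sup_n\zeta_n=\xi$ and set $\mathcal{S}_\xi:=\bigcup_{n=1}^\infty\{F\in\mathcal{S}_{\zeta_n}:n\leq F\}$. Finally $\mathcal{S}_{\omega_1}:=\{F\subset\mathbb{N}:\#F<\infty\}$. For $1\leq\xi\leq\omega_1$ put $\mathcal{A}_\xi:=\{(\alpha_k)\in c_{00}:\mathrm{supp}(\alpha_k)\in\mathcal{S}_\xi\}$. For $1\leq p\leq\infty$ and $0\leq C<\infty$, $\mathcal{WD}_{\ell_p}^{(C,\xi)}(X)$ is the set of all $T\in\mathcal{L}(X)$ such that for every $\epsilon>0$, each normalized weakly null sequence $(x_n)\subset X$ admits a subsequence $(x_{n_k})$ with $\|\sum\alpha_kTx_{n_k}\|\leq(C+\epsilon)\|(\alpha_k)\|_{\ell_p}$ for all $(\alpha_k)\in\mathcal{A}_\xi$. Set $\mathcal{WD}_{\ell_p}^{(\infty,\xi)}(X):=\bigcup_{0\leq C<\infty}\mathcal{WD}_{\ell_p}^{(C,\xi)}(X)$. Convexified Tsirelson-type spaces: for $1\leq\xi<\omega_1$, a finite sequence $(E_i)_{i=1}^j$ of (nonempty) finite subsets of $\mathbb{N}$ is $\mathcal{S}_\xi$-admissible if $E_1<\cdots<E_j$ and $\{\min E_i\}_{i=1}^j\in\mathcal{S}_\xi$. For $x=\sum\alpha_ne_n\in c_{00}$ and $E\subset\mathbb{N}$ write $Ex:=\sum_{n\in E}\alpha_ne_n$. For $1\leq q<\infty$ define norms on $c_{00}$ by $\|\cdot\|_0:=\|\cdot\|_{\ell_\infty}$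 and $\|x\|_{n+1}:=\max\{\|x\|_{\ell_\infty},\,2^{-1/q}\sup(\sum_{i=1}^j\|E_ix\|_n^q)^{1/q}\}$, the supremum over all $j\in\mathbb{N}$ and all $\mathcal{S}_\xi$-admissible $(E_i)_{i=1}^j$. Then $\|x\|_{T_q}:=\lim_{n\to\infty}\|x\|_n$ is the unique norm on $c_{00}$ satisfying $\|x\|_{T_q}=\max\{\|x\|_{\ell_\infty},\,2^{-1/q}\sup(\sum_i\|E_ix\|_{T_q}^q)^{1/q}\}$ (same supremum), and $T_q=T_q[\frac12,\mathcal{S}_\xi]$ is the completion of $c_{00}$ under $\|\cdot\|_{T_q}$. *)

theory Defs
  imports "HOL-Analysis.Analysis"
begin

section \<open>Countable ordinals\<close>

text \<open>The well-order \<open>cardSuc natLeq\<close> has order type \<open>\<omega>\<^sub>1\<close>, so its elements are the ordinals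
  below \<open>\<omega>\<^sub>1\<close>.\<close>

typedef countable_ordinal = "Field (cardSuc natLeq)"
proof -
  have "infinite (Field (cardSuc natLeq))"
    using cardSuc_finite[OF natLeq_Card_order] by (simp add: Field_natLeq)
  then show ?thesis
    by (metis ex_in_conv finite.emptyI)
qed

instantiation countable_ordinal :: linorder
begin

definition less_eq_countable_ordinal :: "countable_ordinal \<Rightarrow> countable_ordinal \<Rightarrow> bool" where
  "x \<le> y \<longleftrightarrow> (Rep_countable_ordinal x, Rep_countable_ordinal y) \<in> cardSuc natLeq"

definition less_countable_ordinal :: "countable_ordinal \<Rightarrow> countable_ordinal \<Rightarrow> bool" where
  "x < y \<longleftrightarrow> x \<le> y \<and> x \<noteq> (y::countable_ordinal)"

instance
proof -
  have wo: "Well_order (cardSuc natLeq)"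
    using cardSuc_Card_order[OF natLeq_Card_order] by (simp add: card_order_on_well_order_on)
  then have lin: "Linear_order (cardSuc natLeq)"
    by (simp add: well_order_on_def)
  then have part: "Partial_order (cardSuc natLeq)"
    by (simp add: linear_order_on_def)
  have rfl: "x \<le> x" for x :: countable_ordinal
    using part Rep_countable_ordinal[of x]
    by (auto simp: less_eq_countable_ordinal_def partial_order_on_def preorder_on_def refl_on_def)
  have trn: "x \<le> z" if "x \<le> y" "y \<le> z" for x y z :: countable_ordinal
    using part that unfolding less_eq_countable_ordinal_def partial_order_on_def preorder_on_def
    by (meson transD)
  have asym: "x = y" if "x \<le> y" "y \<le> x" for x y :: countable_ordinal
    using part that unfolding less_eq_countable_ordinal_def partial_order_on_def
    by (meson antisymD Rep_countable_ordinal_inject)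
  have tot: "x \<le> y \<or> y \<le> x" for x y :: countable_ordinal
    using lin rfl Rep_countable_ordinal[of x] Rep_countable_ordinal[of y]
    unfolding less_eq_countable_ordinal_def linear_order_on_def total_on_def
    by metis
  show "OFCLASS(countable_ordinal, linorder_class)"
    by intro_classes (use rfl trn asym tot in \<open>auto simp: less_countable_ordinal_def\<close>)
qed

end

instance countable_ordinal :: wellorder
proof
  fix P :: "countable_ordinal \<Rightarrow> bool" and a
  assume step: "\<And>x. (\<And>y. y < x \<Longrightarrow> P y) \<Longrightarrow> P x"
  have "Well_order (cardSuc natLeq)"
    using cardSuc_Card_order[OF natLeq_Card_order] by (simp add: card_order_on_well_order_on)
  then have "wf (cardSuc natLeq - Id)"
    by (simp add: well_order_on_def)
  then have "wf (inv_image (cardSuc natLeq - Id) Rep_countable_ordinal)"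
    by (rule wf_inv_image)
  then show "P a"
  proof (induction a rule: wf_induct_rule)
    case (less x)
    show ?case
      by (rule step, rule less)
        (auto simp: less_countable_ordinal_def less_eq_countable_ordinal_def
          Rep_countable_ordinal_inject in_inv_image)
  qed
qed

lemma countable_lessThan_countable_ordinal:
  includes cardinal_syntax
  shows "countable {..<x::countable_ordinal}"
proof -
  let ?r = "cardSuc natLeq" and ?R = Rep_countable_ordinal
  have "|underS ?r (?R x)| <o ?r"
    by (rule card_of_underS[OF cardSuc_Card_order[OF natLeq_Card_order] Rep_countable_ordinal])
  then have "|underS ?r (?R x)| \<le>o natLeq"
    using cardSuc_ordLeq_ordLess[OF natLeq_Card_order card_of_Card_order] by blast
  then have "|underS ?r (?R x)| \<le>o |UNIV :: nat set|"
    using card_of_nat ordIso_symmetric ordLeq_ordIso_trans by blast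
  then have "countable (underS ?r (?R x))"
    by (metis card_of_ordLeq countable_def)
  moreover have "?R ` {..<x} \<subseteq> underS ?r (?R x)"
    by (auto simp: underS_def less_countable_ordinal_def less_eq_countable_ordinal_def
        Rep_countable_ordinal_inject)
  ultimately have "countable (?R ` {..<x})"
    using countable_subset by blast
  then show ?thesis
    using countable_image_inj_on[of ?R] Rep_countable_ordinal_inject by (metis inj_onI)
qed

lemma uncountable_UNIV_countable_ordinal:
  includes cardinal_syntax
  shows "uncountable (UNIV :: countable_ordinal set)"
proof
  let ?r = "cardSuc natLeq"
  assume "countable (UNIV :: countable_ordinal set)"
  then have "countable (range Rep_countable_ordinal)"
    by (rule countable_image)
  then have "countable (Field ?r)"
    by (metis type_definition.Rep_range type_definition_countable_ordinal)
  then have "|Field ?r| \<le>o |UNIV :: nat set|"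
    by (metis card_of_ordLeq countable_def top_greatest)
  then have "|Field ?r| \<le>o natLeq"
    using card_of_nat ordLeq_ordIso_trans by blast
  moreover have "|Field ?r| =o ?r"
    by (rule card_of_Field_ordIso[OF cardSuc_Card_order[OF natLeq_Card_order]])
  ultimately have "?r \<le>o natLeq"
    using ordIso_symmetric ordIso_ordLeq_trans by blast
  moreover have "natLeq <o ?r"
    by (rule cardSuc_greater[OF natLeq_Card_order])
  ultimately show False
    using not_ordLess_ordLeq by blast
qed

definition ord_zero :: countable_ordinal where
  "ord_zero = (LEAST x. True)"

definition ord_succ :: "countable_ordinal \<Rightarrow> countable_ordinal" where
  "ord_succ x = (LEAST y. x < y)"

definition ord_one :: countable_ordinal where
  "ord_one = ord_succ ord_zero"

definition ord_limit :: "countable_ordinal \<Rightarrow> bool" where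
  "ord_limit x \<longleftrightarrow> x \<noteq> ord_zero \<and> (\<nexists>y. x = ord_succ y)"


section \<open>Schreier families\<close>

text \<open>Throughout, the set of indices is \<open>{1, 2, 3, \<dots>}\<close>: the number \<open>0\<close> is never used as an index,
  and sequences in \<open>c\<^sub>0\<^sub>0\<close> vanish there. In particular \<open>\<zeta> \<xi> 0\<close> is irrelevant below.\<close>

definition fundamental_sequences ::
    "(countable_ordinal \<Rightarrow> nat \<Rightarrow> countable_ordinal) \<Rightarrow> bool" where
  "fundamental_sequences \<zeta> \<longleftrightarrow> (\<forall>\<xi>. ord_limit \<xi> \<longrightarrow>
     strict_mono_on {1..} (\<zeta> \<xi>) \<and>
     (\<forall>n\<ge>1. \<not> ord_limit (\<zeta> \<xi> n)) \<and>
     (\<forall>n\<ge>1. \<zeta> \<xi> n \<le> \<xi>) \<and> (\<forall>\<eta>. (\<forall>n\<ge>1. \<zeta> \<xi> n \<le> \<eta>) \<longrightarrow> \<xi> \<le> \<eta>))"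

definition successive :: "nat set list \<Rightarrow> bool" where
  "successive Es \<longleftrightarrow>
     (\<forall>E\<in>set Es. E \<noteq> {} \<and> finite E) \<and> sorted_wrt (\<lambda>E F. Max E < Min F) Es"

definition schreier_one :: "nat set set" where
  "schreier_one = {F. F \<subseteq> {1..} \<and> finite F \<and> F \<noteq> {} \<and> card F \<le> Min F} \<union> {{}}"

inductive in_schreier ::
    "(countable_ordinal \<Rightarrow> nat \<Rightarrow> countable_ordinal) \<Rightarrow> countable_ordinal \<Rightarrow> nat set \<Rightarrow> bool"
  for \<zeta> where
  zero_empty: "in_schreier \<zeta> ord_zero {}"
| zero_singleton: "1 \<le> n \<Longrightarrow> in_schreier \<zeta> ord_zero {n}"
| one: "F \<in> schreier_one \<Longrightarrow> in_schreier \<zeta> ord_one F"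
| succ_empty: "ord_one \<le> \<eta> \<Longrightarrow> in_schreier \<zeta> (ord_succ \<eta>) {}"
| succ: "ord_one \<le> \<eta> \<Longrightarrow> Fs \<noteq> [] \<Longrightarrow> successive Fs \<Longrightarrow> \<forall>F\<in>set Fs. in_schreier \<zeta> \<eta> F \<Longrightarrow>
    Min ` set Fs \<in> schreier_one \<Longrightarrow> in_schreier \<zeta> (ord_succ \<eta>) (\<Union>(set Fs))"
| limit: "ord_limit \<xi> \<Longrightarrow> 1 \<le> n \<Longrightarrow> in_schreier \<zeta> (\<zeta> \<xi> n) F \<Longrightarrow> \<forall>m\<in>F. n \<le> m \<Longrightarrow>
    in_schreier \<zeta> \<xi> F"

definition schreier ::
    "(countable_ordinal \<Rightarrow> nat \<Rightarrow> countable_ordinal) \<Rightarrow> countable_ordinal \<Rightarrow> nat set set" where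
  "schreier \<zeta> \<xi> = {F. in_schreier \<zeta> \<xi> F}"

definition schreier_omega1 :: "nat set set" where
  "schreier_omega1 = {F. F \<subseteq> {1..} \<and> finite F}"


section \<open>Normed spaces over a scalar field\<close>

text \<open>The spaces below depend on parameters, so they are given by explicit carriers.
  The scalars range over a type \<open>'k\<close> of class \<open>real_normed_field\<close>: by the Gelfand-Mazur theorem these
  are exactly the real and the complex numbers, up to isometric isomorphism. A sort constraint
  \<open>{real_normed_field, euclidean_space}\<close> still admits both.\<close>

record ('k, 'v) normed_space =
  carrier :: "'v set"
  vadd :: "'v \<Rightarrow> 'v \<Rightarrow> 'v"
  vzero :: 'v
  vscale :: "'k \<Rightarrow> 'v \<Rightarrow> 'v"
  vnorm :: "'v \<Rightarrow> real"

definition vdiff :: "('k::real_normed_field, 'v) normed_space \<Rightarrow> 'v \<Rightarrow> 'v \<Rightarrow> 'v" where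
  "vdiff X x y = vadd X x (vscale X (- 1) y)"

definition scalar_space :: "('k::real_normed_field, 'k) normed_space" where
  "scalar_space = \<lparr>carrier = UNIV, vadd = (+), vzero = 0, vscale = (*), vnorm = norm\<rparr>"

definition bounded_operators ::
    "('k::real_normed_field, 'v) normed_space \<Rightarrow> ('k, 'w) normed_space \<Rightarrow> ('v \<Rightarrow> 'w) set" where
  "bounded_operators X Y = {T \<in> carrier X \<rightarrow>\<^sub>E carrier Y.
     (\<forall>x\<in>carrier X. \<forall>y\<in>carrier X. T (vadd X x y) = vadd Y (T x) (T y)) \<and>
     (\<forall>a. \<forall>x\<in>carrier X. T (vscale X a x) = vscale Y a (T x)) \<and>
     (\<exists>B. \<forall>x\<in>carrier X. vnorm Y (T x) \<le> B * vnorm X x)}"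

abbreviation operators :: "('k::real_normed_field, 'v) normed_space \<Rightarrow> ('v \<Rightarrow> 'v) set" where
  "operators X \<equiv> bounded_operators X X"

definition dual :: "('k::real_normed_field, 'v) normed_space \<Rightarrow> ('k, 'v \<Rightarrow> 'k) normed_space" where
  "dual X =
    \<lparr>carrier = bounded_operators X scalar_space,
     vadd = (\<lambda>f g. \<lambda>x\<in>carrier X. f x + g x),
     vzero = (\<lambda>x\<in>carrier X. 0),
     vscale = (\<lambda>a f. \<lambda>x\<in>carrier X. a * f x),
     vnorm = (\<lambda>f. SUP x\<in>{x\<in>carrier X. vnorm X x \<le> 1}. norm (f x))\<rparr>"

text \<open>The completion consists of the classes of Cauchy sequences modulo null sequences.\<close>

definition cauchy_sequences :: "('k::real_normed_field, 'v) normed_space \<Rightarrow> (nat \<Rightarrow> 'v) set" where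
  "cauchy_sequences X = {s. (\<forall>n. s n \<in> carrier X) \<and>
     (\<forall>e>0. \<exists>N. \<forall>m\<ge>N. \<forall>n\<ge>N. vnorm X (vdiff X (s m) (s n)) < e)}"

definition cauchy_rel ::
    "('k::real_normed_field, 'v) normed_space \<Rightarrow> ((nat \<Rightarrow> 'v) \<times> (nat \<Rightarrow> 'v)) set" where
  "cauchy_rel X = {(s, t). s \<in> cauchy_sequences X \<and> t \<in> cauchy_sequences X \<and>
     (\<lambda>n. vnorm X (vdiff X (s n) (t n))) \<longlonglongrightarrow> 0}"

definition completion ::
    "('k::real_normed_field, 'v) normed_space \<Rightarrow> ('k, (nat \<Rightarrow> 'v) set) normed_space" where
  "completion X =
    \<lparr>carrier = cauchy_sequences X // cauchy_rel X,
     vadd = (\<lambda>A B. \<Union>s\<in>A. \<Union>t\<in>B. cauchy_rel X `` {\<lambda>n. vadd X (s n) (t n)}),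
     vzero = cauchy_rel X `` {\<lambda>n. vzero X},
     vscale = (\<lambda>a A. \<Union>s\<in>A. cauchy_rel X `` {\<lambda>n. vscale X a (s n)}),
     vnorm = (\<lambda>A. lim (\<lambda>n. vnorm X ((SOME s. s \<in> A) n)))\<rparr>"

definition weakly_null :: "('k::real_normed_field, 'v) normed_space \<Rightarrow> (nat \<Rightarrow> 'v) \<Rightarrow> bool" where
  "weakly_null X x \<longleftrightarrow> (\<forall>f\<in>carrier (dual X). (\<lambda>n. f (x n)) \<longlonglongrightarrow> 0)"


section \<open>The classes \<open>WD\<close>\<close>

definition supp :: "(nat \<Rightarrow> 'k::zero) \<Rightarrow> nat set" where
  "supp \<alpha> = {n. \<alpha> n \<noteq> 0}"

definition c00 :: "(nat \<Rightarrow> 'k::zero) set" where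
  "c00 = {\<alpha>. finite (supp \<alpha>) \<and> \<alpha> 0 = 0}"

definition sup_norm :: "(nat \<Rightarrow> 'k::real_normed_field) \<Rightarrow> real" where
  "sup_norm \<alpha> = (SUP n. norm (\<alpha> n))"

definition lp_norm :: "ereal \<Rightarrow> (nat \<Rightarrow> 'k::real_normed_field) \<Rightarrow> real" where
  "lp_norm p \<alpha> = (if p = \<infinity> then sup_norm \<alpha>
     else (\<Sum>n\<in>supp \<alpha>. norm (\<alpha> n) powr real_of_ereal p) powr (1 / real_of_ereal p))"

definition linear_combination ::
    "('k::real_normed_field, 'v) normed_space \<Rightarrow> (nat \<Rightarrow> 'k) \<Rightarrow> (nat \<Rightarrow> 'v) \<Rightarrow> 'v" where
  "linear_combination X \<alpha> y =
     foldr (\<lambda>k v. vadd X (vscale X (\<alpha> k) (y k)) v) (sorted_list_of_set (supp \<alpha>)) (vzero X)"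

text \<open>In the definitions of the classes, \<open>\<S>\<close> is the Schreier family \<open>\<S>\<^sub>\<xi>\<close>, \<open>\<xi> \<le> \<omega>\<^sub>1\<close>.\<close>

definition coeffs_in :: "nat set set \<Rightarrow> (nat \<Rightarrow> 'k::zero) set" where
  "coeffs_in \<S> = {\<alpha> \<in> c00. supp \<alpha> \<in> \<S>}"

definition WD ::
    "ereal \<Rightarrow> real \<Rightarrow> nat set set \<Rightarrow> ('k::real_normed_field, 'v) normed_space \<Rightarrow> ('v \<Rightarrow> 'v) set" where
  "WD p C \<S> X = {T \<in> operators X.
     \<forall>\<epsilon>>0. \<forall>x. (\<forall>n\<ge>1. x n \<in> carrier X \<and> vnorm X (x n) = 1) \<and> weakly_null X x \<longrightarrow>
       (\<exists>r. strict_mono r \<and>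
         (\<forall>\<alpha>\<in>coeffs_in \<S>.
            vnorm X (linear_combination X \<alpha> (\<lambda>k. T (x (r k)))) \<le> (C + \<epsilon>) * lp_norm p \<alpha>))}"

definition WD_infinity ::
    "ereal \<Rightarrow> nat set set \<Rightarrow> ('k::real_normed_field, 'v) normed_space \<Rightarrow> ('v \<Rightarrow> 'v) set" where
  "WD_infinity p \<S> X = (\<Union>C\<in>{0..}. WD p C \<S> X)"


section \<open>Convexified Tsirelson spaces\<close>

definition admissible :: "nat set set \<Rightarrow> nat set list set" where
  "admissible \<S> = {Es. Es \<noteq> [] \<and> successive Es \<and> Min ` set Es \<in> \<S>}"

definition restrict_to :: "nat set \<Rightarrow> (nat \<Rightarrow> 'k::zero) \<Rightarrow> nat \<Rightarrow> 'k" where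
  "restrict_to E x = (\<lambda>n. if n \<in> E then x n else 0)"

primrec tsirelson_iter ::
    "real \<Rightarrow> nat set set \<Rightarrow> nat \<Rightarrow> (nat \<Rightarrow> 'k::real_normed_field) \<Rightarrow> real" where
  "tsirelson_iter q \<S> 0 = sup_norm"
| "tsirelson_iter q \<S> (Suc n) = (\<lambda>x. max (sup_norm x)
     (2 powr (- 1 / q) *
       (SUP Es\<in>admissible \<S>.
          (\<Sum>E\<leftarrow>Es. tsirelson_iter q \<S> n (restrict_to E x) powr q) powr (1 / q))))"

definition tsirelson_norm ::
    "real \<Rightarrow> nat set set \<Rightarrow> (nat \<Rightarrow> 'k::real_normed_field) \<Rightarrow> real" where
  "tsirelson_norm q \<S> x = lim (\<lambda>n. tsirelson_iter q \<S> n x)"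

definition tsirelson_space ::
    "real \<Rightarrow> nat set set \<Rightarrow> ('k::real_normed_field, (nat \<Rightarrow> nat \<Rightarrow> 'k) set) normed_space" where
  "tsirelson_space q \<S> = completion
    \<lparr>carrier = c00,
     vadd = (\<lambda>x y n. x n + y n),
     vzero = (\<lambda>n. 0),
     vscale = (\<lambda>a x n. a * x n),
     vnorm = tsirelson_norm q \<S>\<rparr>"

end

theory Submission
  imports Defs
begin

text \<open>
  The factor \<open>1/2\<close> in front of the admissible sums has two opposite effects. Dually, it makes
  functionals on successive blocks satisfy an upper \<open>\<ell>\<^sub>p\<close> estimate as long as the starting points of
  the blocks form a set in \<open>\<S>\<^sub>\<xi>\<close>. On the space itself it prevents every block sequence from being
  equivalent to the basis of \<open>\<ell>\<^sub>q\<close>, so that the estimate must fail for unrestricted finite supports.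

  The second effect is \<open>block_combination_small\<close>: if \<open>x\<^sub>0, x\<^sub>1, \<dots>\<close> are successive blocks of norm at
  most one, then some combination \<open>\<Sum> a\<^sub>i\<^sup>1\<^sup>/\<^sup>q x\<^sub>i\<close> with convex weights \<open>a\<close> has norm as small as desired. Take
  weights for which every set \<open>G \<in> \<S>\<^sub>\<xi>\<close> meets blocks of total weight at most \<open>1/4\<close>. Given an
  admissible family, a block in which no member starts meets at most one member and adds at most
  its own norm; the blocks in which some member starts add at most twice their norms, but they have
  weight at most \<open>1/4\<close>. Half of the sum is below \<open>3/4\<close>, and the step can be iterated on the new blocks.
  Such weights exist because \<open>\<S>\<^sub>\<xi>\<close> is built from smaller families by unions whose number of members
  is bounded by the minimum of the set: taking successive averages, each negligible for
  everything that started earlier, and averaging them once more handles \<open>\<S>\<^sub>\<xi>\<close> by induction on \<open>\<xi>\<close>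
  (\<open>small_family_diagonal\<close>, \<open>small_family_schreier\<close>).

  It follows that the unit vectors form a shrinking basis (\<open>bounded_functional_tail\<close>): a functional
  that is at least \<open>\<epsilon>\<close> on normalised blocks would be at least \<open>\<epsilon>\<close> on their small combinations.

  For the first half of the theorem, let \<open>S\<close> be an operator on the dual and \<open>(x\<^sub>n)\<close> normalised and
  weakly null. The functionals \<open>S x\<^sub>n\<close> tend to zero at every unit vector and have small tails, so a
  sliding hump selects a subsequence that is a summable perturbation of functionals on successive
  blocks (\<open>almost_block_subsequence\<close>). Hoelder's inequality and the defining inequality of the norm
  then give the upper estimate, since \<open>\<S>\<^sub>\<xi>\<close> is stable under moving its elements to the starting
  points of the blocks (\<open>almost_block_upper_estimate\<close>).

  For the second half, the coordinate functionals \<open>e\<^sub>n\<^sup>*\<close> are weakly null: along a set \<open>F \<in> \<S>\<^sub>\<xi>\<close> with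
  \<open>m\<close> elements, unimodular sums have norm at most \<open>2 m\<^sup>1\<^sup>/\<^sup>p\<close>, and \<open>\<S>\<^sub>\<xi>\<close> contains large subsets of every
  infinite set. If the identity were in the class for \<open>\<omega>\<^sub>1\<close>, some subsequence would satisfy an upper
  \<open>\<ell>\<^sub>p\<close> estimate on all finite supports; pairing it with small combinations of the corresponding
  unit vectors contradicts \<open>\<Sum> a\<^sub>i = 1\<close>.
\<close>

section \<open>Families of finite sets on which averages vanish\<close>

definition convex_weights :: "nat \<Rightarrow> nat \<Rightarrow> (nat \<Rightarrow> real) set" where
  "convex_weights K L = {a. (\<forall>i. 0 \<le> a i) \<and> (\<forall>i. i \<notin> {K..<L} \<longrightarrow> a i = 0) \<and> sum a {K..<L} = 1}"

lemma convex_weights_less: "a \<in> convex_weights K L \<Longrightarrow> K < L"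
  by (rule ccontr) (auto simp: convex_weights_def)

lemma convex_weights_nonneg: "a \<in> convex_weights K L \<Longrightarrow> 0 \<le> a i"
  by (simp add: convex_weights_def)

lemma convex_weights_sum: "a \<in> convex_weights 0 L \<Longrightarrow> sum a {..<L} = 1"
  by (simp add: convex_weights_def atLeast0LessThan)

lemma convex_weights_le_1: "a \<in> convex_weights K L \<Longrightarrow> a i \<le> 1"
  using member_le_sum[of i "{K..<L}" a] by (cases "i \<in> {K..<L}") (auto simp: convex_weights_def)

lemma convex_weights_average_le:
  assumes a: "a \<in> convex_weights K L" and g: "\<And>i. i \<in> {K..<L} \<Longrightarrow> g i \<le> c"
  shows "(\<Sum>i\<in>{K..<L}. a i * g i) \<le> c"
proof -
  have "(\<Sum>i\<in>{K..<L}. a i * g i) \<le> (\<Sum>i\<in>{K..<L}. a i * c)"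
    using a g by (intro sum_mono mult_left_mono) (auto simp: convex_weights_def)
  then show ?thesis
    using a by (simp add: sum_distrib_right[symmetric] convex_weights_def)
qed

lemma sum_successive_blocks:
  fixes f :: "nat \<Rightarrow> 'b::comm_monoid_add"
  assumes "strict_mono K" "K 0 = 0"
  shows "sum f {..<K M} = (\<Sum>j<M. sum f {K j..<K (Suc j)})"
proof (induction M)
  case 0
  show ?case using assms by simp
next
  case (Suc M)
  have "K M \<le> K (Suc M)"
    using assms(1) by (simp add: strict_mono_less_eq)
  then show ?case
    using Suc by (metis (no_types, lifting) atLeast0LessThan le0 sum.atLeastLessThan_concat sum.lessThan_Suc)
qed

lemma block_index_unique:
  assumes "strict_mono (p :: nat \<Rightarrow> nat)" "n \<in> {p i..<p (Suc i)}" "n \<in> {p j..<p (Suc j)}"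
  shows "i = j"
proof (rule ccontr)
  assume "i \<noteq> j"
  then consider "Suc i \<le> j" | "Suc j \<le> i" by linarith
  then show False
    using assms by cases (auto dest: strict_mono_less_eq[OF assms(1), THEN iffD2])
qed

text \<open>Convex combinations of successive convex combinations are convex combinations; the block form
  of the weights also turns \<open>q\<close>-th roots of the composed weights into products of roots.\<close>

lemma convex_weights_compose:
  assumes K: "strict_mono K" "K 0 = 0"
    and d: "\<And>j. d j \<in> convex_weights (K j) (K (Suc j))" and e: "e \<in> convex_weights 0 M"
  obtains a where "a \<in> convex_weights 0 (K M)"
    "\<And>j i. j < M \<Longrightarrow> i \<in> {K j..<K (Suc j)} \<Longrightarrow> a i = e j * d j i"
proof -
  define a where "a i = (\<Sum>j<M. e j * d j i)" for i
  have blk: "a i = e j * d j i" if "j < M" "i \<in> {K j..<K (Suc j)}" for i j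
  proof -
    have "e k * d k i = 0" if "k \<in> {..<M} - {j}" for k
      using block_index_unique[OF K(1) \<open>i \<in> _\<close>, of k] d[of k] that
      by (auto simp: convex_weights_def)
    then show ?thesis
      unfolding a_def using that sum.mono_neutral_right[of "{..<M}" "{j}" "\<lambda>k. e k * d k i"] by simp
  qed
  have "a i = 0" if "i \<ge> K M" for i
    unfolding a_def
  proof (rule sum.neutral, rule ballI)
    fix j assume "j \<in> {..<M}"
    then have "K (Suc j) \<le> K M"
      using strict_mono_less_eq[OF K(1)] by auto
    then show "e j * d j i = 0"
      using d[of j] that by (auto simp: convex_weights_def)
  qed
  moreover have "sum a {..<K M} = (\<Sum>j<M. e j)"
    using d by (simp add: sum_successive_blocks[OF K] blk sum_distrib_left[symmetric] convex_weights_def)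
  moreover have "0 \<le> a i" for i
    unfolding a_def using e d by (intro sum_nonneg) (auto simp: convex_weights_def)
  ultimately have "a \<in> convex_weights 0 (K M)"
    using convex_weights_sum[OF e] by (simp add: convex_weights_def atLeast0LessThan)
  then show ?thesis
    using that blk by blast
qed

lemma sum_compose:
  fixes g :: "nat \<Rightarrow> real"
  assumes "strict_mono K" "K 0 = 0"
    "\<And>j i. j < M \<Longrightarrow> i \<in> {K j..<K (Suc j)} \<Longrightarrow> a i = e j * d j i"
  shows "(\<Sum>i<K M. a i * g i) = (\<Sum>j<M. e j * (\<Sum>i\<in>{K j..<K (Suc j)}. d j i * g i))"
  by (simp add: sum_successive_blocks[OF assms(1,2)] assms(3) sum_distrib_left mult.assoc)

lemma convex_weights_sequence:
  assumes "\<And>K. \<exists>L. \<exists>a\<in>convex_weights K L. P K L a"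
  obtains K d where "strict_mono K" "K 0 = (0::nat)"
    "\<And>j. d j \<in> convex_weights (K j) (K (Suc j))" "\<And>j. P (K j) (K (Suc j)) (d j)"
proof -
  obtain L a where La: "\<And>K. a K \<in> convex_weights K (L K)" "\<And>K. P K (L K) (a K)"
    using assms by metis
  define K where "K = rec_nat 0 (\<lambda>_ k. L k)"
  have "K 0 = 0" "\<And>j. K (Suc j) = L (K j)"
    by (simp_all add: K_def)
  moreover from this have "strict_mono K"
    using convex_weights_less[OF La(1)] by (simp add: strict_mono_Suc_iff)
  ultimately show ?thesis
    using that[of K "\<lambda>j. a (K j)"] La by simp
qed

text \<open>The value says whether \<open>G\<close> meets the \<open>i\<close>-th of the successive intervals with end points \<open>p\<close>.
  Working with intervals instead of points lets a measure on block indices see the sets through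
  their minima, wherever inside a block these lie.\<close>

definition hit :: "(nat \<Rightarrow> nat) \<Rightarrow> nat set \<Rightarrow> nat \<Rightarrow> real" where
  "hit p G i = of_bool (G \<inter> {p i..<p (Suc i)} \<noteq> {})"

lemma hit_bounds: "0 \<le> hit p G i" "hit p G i \<le> 1"
  by (auto simp: hit_def)

text \<open>Every interval partition carries weights under which all members of the family have little
  mass at once. Quantifying over all partitions, not only the one into points, is what makes the
  notion stable under finite unions and under averaging of averages.\<close>

definition small_family :: "nat set set \<Rightarrow> bool" where
  "small_family \<F> \<longleftrightarrow> (\<forall>p. strict_mono p \<longrightarrow> (\<forall>\<epsilon>>0. \<exists>L. \<exists>a\<in>convex_weights 0 L.
     \<forall>G\<in>\<F>. (\<Sum>i<L. a i * hit p G i) \<le> \<epsilon>))"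

lemma small_familyD:
  assumes "small_family \<F>" "strict_mono p" "0 < \<epsilon>"
  obtains L a where "a \<in> convex_weights 0 L" "\<And>G. G \<in> \<F> \<Longrightarrow> (\<Sum>i<L. a i * hit p G i) \<le> \<epsilon>"
  using assms unfolding small_family_def by metis

lemma small_family_mono: "small_family \<G> \<Longrightarrow> \<F> \<subseteq> \<G> \<Longrightarrow> small_family \<F>"
  unfolding small_family_def by (meson subsetD)

lemma convex_weights_shift:
  fixes K L :: nat
  assumes "a \<in> convex_weights 0 L"
  defines "a' \<equiv> \<lambda>i. if K \<le> i then a (i - K) else 0"
  shows "a' \<in> convex_weights K (L + K)"
    and "(\<Sum>i\<in>{K..<L + K}. a' i * g i) = (\<Sum>i<L. a i * g (i + K))"
proof -
  have s: "sum h {K..<L + K} = (\<Sum>i<L. h (i + K))" for h :: "nat \<Rightarrow> real"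
    using sum.shift_bounds_nat_ivl[of h 0 K L] by (simp add: atLeast0LessThan)
  show "a' \<in> convex_weights K (L + K)"
    using assms by (auto simp: convex_weights_def s atLeast0LessThan)
  show "(\<Sum>i\<in>{K..<L + K}. a' i * g i) = (\<Sum>i<L. a i * g (i + K))"
    by (simp add: s a'_def)
qed

lemma small_family_tail:
  assumes "small_family \<F>" "strict_mono p" "0 < \<epsilon>"
  shows "\<exists>L. \<exists>a\<in>convex_weights K L. \<forall>G\<in>\<F>. (\<Sum>i\<in>{K..<L}. a i * hit p G i) \<le> \<epsilon>"
proof -
  have "strict_mono (\<lambda>i. p (i + K))"
    using assms(2) by (simp add: strict_mono_def)
  then obtain L a where a: "a \<in> convex_weights 0 L"
    and G: "\<And>G. G \<in> \<F> \<Longrightarrow> (\<Sum>i<L. a i * hit (\<lambda>i. p (i + K)) G i) \<le> \<epsilon>"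
    using small_familyD[OF assms(1) _ assms(3)] by blast
  have "hit (\<lambda>i. p (i + K)) G i = hit p G (i + K)" for G i
    by (simp add: hit_def)
  then show ?thesis
    using convex_weights_shift[OF a] G by (intro exI bexI[rotated]) auto
qed

lemma hit_coarse:
  assumes "strict_mono p" "i \<in> {K j..<K (Suc j)}"
  shows "hit p G i \<le> hit (\<lambda>j. p (K j)) G j"
proof -
  have "p (K j) \<le> p i" "p (Suc i) \<le> p (K (Suc j))"
    using assms by (auto simp: strict_mono_less_eq)
  then have "{p i..<p (Suc i)} \<subseteq> {p (K j)..<p (K (Suc j))}"
    by auto
  then show ?thesis
    by (auto simp: hit_def)
qed

text \<open>Weights that are good for \<open>\<F>\<close> stay good under every further averaging. Hence one first forms
  successive averages for \<open>\<F>\<close> and then averages these for \<open>\<G>\<close> over the coarser partition.\<close>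

lemma small_family_Un:
  assumes "small_family \<F>" "small_family \<G>"
  shows "small_family (\<F> \<union> \<G>)"
  unfolding small_family_def
proof (intro allI impI)
  fix p :: "nat \<Rightarrow> nat" and \<epsilon> :: real
  assume p: "strict_mono p" and \<epsilon>: "0 < \<epsilon>"
  obtain K d where K: "strict_mono K" "K 0 = (0::nat)"
    and d: "\<And>j. d j \<in> convex_weights (K j) (K (Suc j))"
    and F: "\<And>j. \<forall>G\<in>\<F>. (\<Sum>i\<in>{K j..<K (Suc j)}. d j i * hit p G i) \<le> \<epsilon>"
    by (rule convex_weights_sequence[OF small_family_tail[OF assms(1) p \<epsilon>]]) (rule that; assumption)
  have "strict_mono (\<lambda>j. p (K j))"
    using p K(1) by (simp add: strict_mono_def)
  then obtain M e where e: "e \<in> convex_weights 0 M"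
    and G: "\<And>G. G \<in> \<G> \<Longrightarrow> (\<Sum>j<M. e j * hit (\<lambda>j. p (K j)) G j) \<le> \<epsilon>"
    using small_familyD[OF assms(2) _ \<epsilon>] by blast
  obtain a where a: "a \<in> convex_weights 0 (K M)"
    and blk: "\<And>j i. j < M \<Longrightarrow> i \<in> {K j..<K (Suc j)} \<Longrightarrow> a i = e j * d j i"
    by (rule convex_weights_compose[OF K d e]) (rule that; assumption)
  have "(\<Sum>i<K M. a i * hit p A i) \<le> \<epsilon>" if "A \<in> \<F> \<union> \<G>" for A
    using that
  proof
    assume "A \<in> \<F>"
    have "(\<Sum>i<K M. a i * hit p A i) = (\<Sum>j<M. e j * (\<Sum>i\<in>{K j..<K (Suc j)}. d j i * hit p A i))"
      by (rule sum_compose[OF K blk])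
    also have "\<dots> \<le> \<epsilon>"
      using convex_weights_average_le[OF e] F \<open>A \<in> \<F>\<close> by (simp add: atLeast0LessThan)
    finally show ?thesis .
  next
    assume "A \<in> \<G>"
    have "(\<Sum>i<K M. a i * hit p A i) \<le> (\<Sum>j<M. e j * hit (\<lambda>j. p (K j)) A j)"
      using convex_weights_nonneg[OF e]
      by (subst sum_compose[OF K blk])
        (auto intro!: sum_mono mult_left_mono convex_weights_average_le[OF d] hit_coarse[OF p])
    then show ?thesis
      using G[OF \<open>A \<in> \<G>\<close>] by simp
  qed
  then show "\<exists>L. \<exists>a\<in>convex_weights 0 L. \<forall>A\<in>\<F> \<union> \<G>. (\<Sum>i<L. a i * hit p A i) \<le> \<epsilon>"
    using a by blast
qed

lemma small_family_bounded: "small_family {G. G \<subseteq> {..<m}}"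
  unfolding small_family_def
proof (intro allI impI)
  fix p :: "nat \<Rightarrow> nat" and \<epsilon> :: real
  assume p: "strict_mono p" and \<epsilon>: "0 < \<epsilon>"
  define a :: "nat \<Rightarrow> real" where "a i = of_bool (i = m)" for i
  have "a i * hit p G i = 0" if "G \<subseteq> {..<m}" for G i
    using that strict_mono_imp_increasing[OF p, of m] by (force simp: a_def hit_def)
  then have "(\<Sum>i<Suc m. a i * hit p G i) = 0" if "G \<subseteq> {..<m}" for G
    using that by (intro sum.neutral) blast
  moreover have "a \<in> convex_weights 0 (Suc m)"
    by (simp add: a_def convex_weights_def)
  ultimately show "\<exists>L. \<exists>a\<in>convex_weights 0 L. \<forall>G\<in>{G. G \<subseteq> {..<m}}. (\<Sum>i<L. a i * hit p G i) \<le> \<epsilon>"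
    using \<epsilon> by (intro exI[of _ "Suc m"] bexI[of _ a]) (auto simp del: sum.lessThan_Suc)
qed

lemma small_family_UN_finite:
  assumes "finite I" "\<And>i. i \<in> I \<Longrightarrow> small_family (\<F> i)"
  shows "small_family (\<Union>i\<in>I. \<F> i)"
  using assms
proof (induction I)
  case empty
  show ?case
    using small_family_mono[OF small_family_bounded] by auto
qed (auto intro: small_family_Un)

lemma small_family_unions:
  assumes "small_family \<F>"
  shows "small_family {\<Union>\<H> |\<H>. \<H> \<subseteq> \<F> \<and> finite \<H> \<and> card \<H> \<le> m}"
  unfolding small_family_def
proof (intro allI impI)
  fix p :: "nat \<Rightarrow> nat" and \<epsilon> :: real
  assume p: "strict_mono p" and \<epsilon>: "0 < \<epsilon>"
  then have "0 < \<epsilon> / Suc m" by simp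
  then obtain L a where a: "a \<in> convex_weights 0 L"
    and F: "\<And>G. G \<in> \<F> \<Longrightarrow> (\<Sum>i<L. a i * hit p G i) \<le> \<epsilon> / Suc m"
    using small_familyD[OF assms p] by blast
  have "(\<Sum>i<L. a i * hit p (\<Union>\<H>) i) \<le> \<epsilon>" if "\<H> \<subseteq> \<F>" "finite \<H>" "card \<H> \<le> m" for \<H>
  proof -
    have "hit p (\<Union>\<H>) i \<le> (\<Sum>H\<in>\<H>. hit p H i)" for i
    proof (cases "\<exists>H\<in>\<H>. hit p H i = 1")
      case True
      then obtain H where H: "H \<in> \<H>" "hit p H i = 1" by blast
      then have "hit p H i \<le> (\<Sum>H\<in>\<H>. hit p H i)"
        using that(2) by (intro member_le_sum) (auto simp: hit_bounds)
      then show ?thesis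
        using H(2) hit_bounds(2)[of p "\<Union>\<H>" i] by simp
    next
      case False
      then have "hit p (\<Union>\<H>) i = 0"
        by (auto simp: hit_def)
      then show ?thesis
        by (simp add: sum_nonneg hit_bounds)
    qed
    then have "(\<Sum>i<L. a i * hit p (\<Union>\<H>) i) \<le> (\<Sum>i<L. a i * (\<Sum>H\<in>\<H>. hit p H i))"
      using convex_weights_nonneg[OF a] by (intro sum_mono mult_left_mono)
    also have "\<dots> = (\<Sum>H\<in>\<H>. \<Sum>i<L. a i * hit p H i)"
      by (simp add: sum_distrib_left sum.swap[of _ \<H>])
    also have "\<dots> \<le> (\<Sum>H\<in>\<H>. \<epsilon> / Suc m)"
      using F that(1) by (intro sum_mono) auto
    also have "\<dots> \<le> \<epsilon>"
      using that(3) \<epsilon> mult_left_mono[of "card \<H>" "Suc m" \<epsilon>] by (simp add: field_simps)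
    finally show ?thesis .
  qed
  then show "\<exists>L. \<exists>a\<in>convex_weights 0 L.
      \<forall>G\<in>{\<Union>\<H> |\<H>. \<H> \<subseteq> \<F> \<and> finite \<H> \<and> card \<H> \<le> m}. (\<Sum>i<L. a i * hit p G i) \<le> \<epsilon>"
    using a by blast
qed

text \<open>Members that start early are controlled by assumption, but there is no bound on where a member
  may start. Choose successive averages such that each is negligible for all members that
  started before it. A member then has substantial mass in at most one of them, the one where it
  starts, and the mean of many of the averages makes this one irrelevant.\<close>

lemma small_family_diagonal:
  assumes "\<And>m. small_family {G \<in> \<F>. G \<inter> {..<m} \<noteq> {}}"
  shows "small_family \<F>"
  unfolding small_family_def
proof (intro allI impI)
  fix p :: "nat \<Rightarrow> nat" and \<epsilon> :: real
  assume p: "strict_mono p" and \<epsilon>: "0 < \<epsilon>"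
  define \<delta> where "\<delta> = \<epsilon> / 2"
  have "0 < \<delta>" using \<epsilon> by (simp add: \<delta>_def)
  obtain K d where K: "strict_mono K" "K 0 = (0::nat)"
    and d: "\<And>j. d j \<in> convex_weights (K j) (K (Suc j))"
    and F: "\<And>j. \<forall>G\<in>{G \<in> \<F>. G \<inter> {..<p (K j)} \<noteq> {}}. (\<Sum>i\<in>{K j..<K (Suc j)}. d j i * hit p G i) \<le> \<delta>"
    by (rule convex_weights_sequence[where P = "\<lambda>K L a. \<forall>G\<in>{G \<in> \<F>. G \<inter> {..<p K} \<noteq> {}}.
        (\<Sum>i\<in>{K..<L}. a i * hit p G i) \<le> \<delta>", OF small_family_tail[OF assms p \<open>0 < \<delta>\<close>]])
      (rule that; assumption)
  obtain r :: nat where r: "0 < r" "1 / r \<le> \<delta>"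
    using \<open>0 < \<delta>\<close> by (metis less_eq_real_def nat_approx_posE zero_less_Suc)
  define e :: "nat \<Rightarrow> real" where "e j = (if j < r then 1 / r else 0)" for j
  have e: "e \<in> convex_weights 0 r"
    using r by (simp add: convex_weights_def e_def)
  obtain a where a: "a \<in> convex_weights 0 (K r)"
    and blk: "\<And>j i. j < r \<Longrightarrow> i \<in> {K j..<K (Suc j)} \<Longrightarrow> a i = e j * d j i"
    by (rule convex_weights_compose[OF K d e]) (rule that; assumption)
  have "(\<Sum>i<K r. a i * hit p G i) \<le> \<epsilon>" if "G \<in> \<F>" for G
  proof -
    define c where "c j = (\<Sum>i\<in>{K j..<K (Suc j)}. d j i * hit p G i)" for j
    have c1: "c j \<le> 1" for j
      unfolding c_def by (rule convex_weights_average_le[OF d hit_bounds(2)])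
    \<comment> \<open>A set with positive mass in an average started before every later average.\<close>
    have uniq: "j = k" if "\<delta> < c j" "\<delta> < c k" for j k
    proof -
      have "\<not> \<delta> < c k" if "\<delta> < c j" "j < k" for j k
      proof -
        have "\<exists>i\<in>{K j..<K (Suc j)}. d j i * hit p G i \<noteq> 0"
          using that(1) \<open>0 < \<delta>\<close> unfolding c_def
          by (metis (no_types, lifting) less_asym sum.neutral)
        then obtain i n where "i < K (Suc j)" "n \<in> G" "n < p (Suc i)"
          by (auto simp: hit_def split: if_splits)
        moreover have "p (Suc i) \<le> p (K k)"
          using \<open>j < k\<close> \<open>i < K (Suc j)\<close> p K(1) by (meson Suc_leI le_trans strict_mono_less_eq)
        ultimately have "G \<inter> {..<p (K k)} \<noteq> {}"
          by auto
        then show ?thesis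
          using F[of k] \<open>G \<in> \<F>\<close> by (auto simp: c_def)
      qed
      then show ?thesis
        using that by (metis linorder_neqE_nat)
    qed
    obtain k where k: "\<And>j. \<delta> < c j \<Longrightarrow> j = k"
      using uniq by metis
    have "(\<Sum>i<K r. a i * hit p G i) = (\<Sum>j<r. e j * c j)"
      unfolding c_def by (rule sum_compose[OF K blk])
    also have "\<dots> = (\<Sum>j<r. c j) / r"
      by (simp add: e_def sum_divide_distrib)
    also have "(\<Sum>j<r. c j) \<le> (\<Sum>j<r. \<delta> + of_bool (j = k))"
      using c1 k \<open>0 < \<delta>\<close> by (intro sum_mono) (smt (verit) of_bool_eq)
    also have "(\<Sum>j<r. \<delta> + of_bool (j = k)) \<le> r * \<delta> + 1"
      using card_mono[of "{k}" "{..<r} \<inter> {k}"] by (simp add: sum.distrib)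
    finally have "(\<Sum>i<K r. a i * hit p G i) \<le> (r * \<delta> + 1) / r"
      using r by (simp add: divide_right_mono)
    also have "\<dots> = \<delta> + 1 / r"
      using r by (simp add: field_simps)
    also have "\<dots> \<le> \<epsilon>"
      using r by (simp add: \<delta>_def)
    finally show ?thesis .
  qed
  then show "\<exists>L. \<exists>a\<in>convex_weights 0 L. \<forall>G\<in>\<F>. (\<Sum>i<L. a i * hit p G i) \<le> \<epsilon>"
    using a by blast
qed

lemma small_family_singletons: "small_family {{n} |n. True}"
  by (rule small_family_diagonal, rule small_family_mono[OF small_family_bounded]) auto

lemma small_family_card_le: "small_family {G. finite G \<and> card G \<le> m}"
proof (rule small_family_mono[OF small_family_unions[OF small_family_singletons]], safe)
  fix G :: "nat set"
  assume "finite G" "card G \<le> m"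
  moreover have "G = \<Union>((\<lambda>n. {n}) ` G)" by auto
  moreover have "card ((\<lambda>n. {n}) ` G) = card G" by (simp add: card_image inj_on_def)
  ultimately show "\<exists>\<H>. G = \<Union>\<H> \<and> \<H> \<subseteq> {{n} |n. True} \<and> finite \<H> \<and> card \<H> \<le> m"
    by (intro exI[of _ "(\<lambda>n. {n}) ` G"]) auto
qed


section \<open>Schreier families\<close>

lemma less_ord_succ: "\<eta> < ord_succ \<eta>"
proof -
  have "\<exists>y. \<eta> < y"
  proof (rule ccontr)
    assume "\<nexists>y. \<eta> < y"
    then have "UNIV = insert \<eta> {..<\<eta>}"
      by (auto simp: not_less le_less)
    then show False
      using countable_lessThan_countable_ordinal uncountable_UNIV_countable_ordinal
      by (metis countable_insert)
  qed
  then show ?thesis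
    unfolding ord_succ_def by (rule LeastI_ex)
qed

lemma ord_succ_inject:
  assumes "ord_succ \<eta> = ord_succ \<eta>'"
  shows "\<eta> = \<eta>'"
proof -
  have "ord_succ \<alpha> \<le> \<beta>" if "\<alpha> < \<beta>" for \<alpha> \<beta>
    unfolding ord_succ_def using that by (rule Least_le)
  then show ?thesis
    using assms less_ord_succ by (metis leD linorder_neqE)
qed

lemma fundamental_sequence_less:
  assumes "fundamental_sequences \<zeta>" "ord_limit \<xi>" "1 \<le> n"
  shows "\<zeta> \<xi> n < \<xi>"
proof -
  have "\<zeta> \<xi> n < \<zeta> \<xi> (Suc n)" "\<zeta> \<xi> (Suc n) \<le> \<xi>"
    using assms by (auto simp: fundamental_sequences_def strict_mono_on_def)
  then show ?thesis by simp
qed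

lemma successive_distinct:
  assumes "successive Es"
  shows "distinct Es"
proof -
  have "\<not> Max E < Min E" if "E \<in> set Es" for E
  proof -
    have "Min E \<in> E" "finite E"
      using assms that by (auto simp: successive_def)
    then show ?thesis
      by (simp add: leD)
  qed
  moreover have "sorted_wrt (\<lambda>E F. Max E < Min F) Es"
    using assms by (simp add: successive_def)
  ultimately show ?thesis
    by (induction Es) auto
qed

lemma successive_cases:
  assumes "successive Es" "E \<in> set Es" "F \<in> set Es" "E \<noteq> F"
  shows "Max E < Min F \<or> Max F < Min E"
proof -
  obtain i j where "i < length Es" "Es ! i = E" "j < length Es" "Es ! j = F"
    using assms(2,3) by (metis in_set_conv_nth)
  then show ?thesis
    using assms(1,4) by (metis successive_def sorted_wrt_iff_nth_less linorder_neqE_nat)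
qed

lemma successive_disjoint:
  assumes "successive Es" "E \<in> set Es" "F \<in> set Es" "E \<noteq> F"
  shows "E \<inter> F = {}"
proof -
  have "\<not> (Max A < Min B)" if "n \<in> A" "n \<in> B" "A \<in> set Es" "B \<in> set Es" for A B and n :: nat
    using that assms(1) unfolding successive_def by (meson Max_ge Min_le leD le_less_trans less_le_trans)
  then show ?thesis
    using successive_cases[OF assms] assms(2,3) by blast
qed

lemma successive_inj_on_Min:
  assumes "successive Es"
  shows "inj_on Min (set Es)"
proof (rule inj_onI, rule ccontr)
  fix E F assume "E \<in> set Es" "F \<in> set Es" "Min E = Min F" "E \<noteq> F"
  then show False
    using successive_disjoint[OF assms] assms unfolding successive_def
    by (metis Min_in disjoint_iff)
qed

lemma successive_image:
  assumes "successive Es" "strict_mono (f :: nat \<Rightarrow> nat)"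
  shows "successive (map ((`) f) Es)"
    and "Min ` set (map ((`) f) Es) = f ` Min ` set Es"
proof -
  have ne: "finite E \<and> E \<noteq> {}" if "E \<in> set Es" for E
    using assms(1) that by (auto simp: successive_def)
  have mm: "Max (f ` E) = f (Max E)" "Min (f ` E) = f (Min E)" if "E \<in> set Es" for E
    using ne[OF that] assms(2)
    by (simp_all add: mono_Max_commute mono_Min_commute strict_mono_mono)
  have "sorted_wrt (\<lambda>E F. Max (f ` E) < Min (f ` F)) Es"
    using assms mm unfolding successive_def
    by (auto intro!: sorted_wrt_mono_rel[of Es "\<lambda>E F. Max E < Min F"] simp: strict_mono_less)
  then show "successive (map ((`) f) Es)"
    using ne by (auto simp: successive_def sorted_wrt_map)
  show "Min ` set (map ((`) f) Es) = f ` Min ` set Es"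
    using mm by (simp add: image_image cong: image_cong)
qed

lemma schreier_one_image:
  assumes "F \<in> schreier_one" "strict_mono (f :: nat \<Rightarrow> nat)"
  shows "f ` F \<in> schreier_one"
proof (cases "F = {}")
  case False
  have inc: "n \<le> f n" for n
    using strict_mono_imp_increasing[OF assms(2)] .
  have F: "F \<subseteq> {1..}" "finite F" "card F \<le> Min F"
    using assms(1) False by (auto simp: schreier_one_def)
  have "card (f ` F) = card F"
    using assms(2) by (meson card_image inj_on_subset strict_mono_imp_inj_on subset_UNIV)
  also have "\<dots> \<le> f (Min F)"
    using F(3) inc le_trans by blast
  also have "\<dots> = Min (f ` F)"
    using F False assms(2) by (simp add: mono_Min_commute strict_mono_mono)
  finally show ?thesis
    using F inc False by (auto simp: schreier_one_def intro: le_trans)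
qed (use assms in auto)

text \<open>A special case of spreading that is enough here: the elements are moved to the right by a
  strictly increasing map of all indices.\<close>

lemma in_schreier_image:
  assumes "in_schreier \<zeta> \<xi> F" "strict_mono f"
  shows "in_schreier \<zeta> \<xi> (f ` F)"
  using assms(1)
proof induction
  case (zero_singleton n)
  then show ?case
    using strict_mono_imp_increasing[OF assms(2), of n] by (auto intro: in_schreier.zero_singleton)
next
  case (succ \<eta> Fs)
  have "in_schreier \<zeta> (ord_succ \<eta>) (\<Union>(set (map ((`) f) Fs)))"
    using succ successive_image[OF succ.hyps(3) assms(2)] schreier_one_image[OF succ.hyps(4) assms(2)]
    by (intro in_schreier.succ) auto
  then show ?case
    by (simp add: image_Union)
next
  case (limit \<xi> n F)
  then show ?case
    using strict_mono_imp_increasing[OF assms(2)]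
    by (intro in_schreier.limit[of \<xi> n]) (auto intro: le_trans)
qed (auto intro: in_schreier.intros schreier_one_image[OF _ assms(2)])

lemma in_schreier_finite: "in_schreier \<zeta> \<xi> F \<Longrightarrow> finite F \<and> F \<subseteq> {1..}"
  by (induction rule: in_schreier.induct) (auto simp: schreier_one_def)

lemma ord_zero_le: "ord_zero \<le> \<xi>"
  unfolding ord_zero_def by (rule Least_le) simp

lemma ord_one_le_iff: "ord_one \<le> \<xi> \<longleftrightarrow> \<xi> \<noteq> ord_zero"
proof
  show "ord_one \<le> \<xi> \<Longrightarrow> \<xi> \<noteq> ord_zero"
    using less_ord_succ[of ord_zero] by (auto simp: ord_one_def)
  show "\<xi> \<noteq> ord_zero \<Longrightarrow> ord_one \<le> \<xi>"
    using ord_zero_le[of \<xi>] unfolding ord_one_def ord_succ_def by (intro Least_le) auto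
qed

lemma in_schreier_large:
  assumes \<zeta>: "fundamental_sequences \<zeta>" and \<xi>: "ord_one \<le> \<xi>" and "infinite M"
  obtains F where "F \<subseteq> M" "card F = m" "in_schreier \<zeta> \<xi> F"
proof -
  have "\<exists>F\<subseteq>M. card F = m \<and> in_schreier \<zeta> \<xi> F" if "infinite M" for M
    using \<xi> that
  proof (induction \<xi> arbitrary: M rule: less_induct)
    case (less \<xi>)
    have "\<xi> \<noteq> ord_zero"
      using less.prems(1) by (simp add: ord_one_le_iff)
    then consider "\<xi> = ord_one" | \<eta> where "ord_one \<le> \<eta>" "\<xi> = ord_succ \<eta>" | "ord_limit \<xi>"
      by (metis ord_limit_def ord_one_le_iff ord_one_def)
    then show ?case
    proof cases
      case 1
      have "infinite (M - {..<Suc m})"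
        using less.prems(2) by simp
      then obtain F where F: "F \<subseteq> M - {..<Suc m}" "card F = m" "finite F"
        by (meson infinite_arbitrarily_large)
      then have "F \<in> schreier_one"
        by (cases "F = {}") (auto simp: schreier_one_def intro!: Min.boundedI)
      then show ?thesis
        using F 1 by (blast intro: in_schreier.one)
    next
      case (2 \<eta>)
      then obtain F where F: "F \<subseteq> M" "card F = m" "in_schreier \<zeta> \<eta> F"
        using less.IH[of \<eta> M] less_ord_succ less.prems(2) by blast
      have "in_schreier \<zeta> \<xi> F"
      proof (cases "F = {}")
        case False
        then have "successive [F]" "Min F \<in> {1..}"
          using in_schreier_finite[OF F(3)] by (auto simp: successive_def)
        then have "in_schreier \<zeta> (ord_succ \<eta>) (\<Union>(set [F]))"
          using 2 F by (intro in_schreier.succ) (auto simp: schreier_one_def)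
        then show ?thesis
          using 2 by simp
      qed (use 2 in_schreier.succ_empty in auto)
      then show ?thesis
        using F by blast
    next
      case 3
      have "\<zeta> \<xi> 1 < \<zeta> \<xi> 2"
        using \<zeta> 3 by (auto simp: fundamental_sequences_def strict_mono_on_def)
      then have "ord_one \<le> \<zeta> \<xi> 2"
        using ord_zero_le[of "\<zeta> \<xi> 1"] by (auto simp: ord_one_le_iff)
      moreover have "\<zeta> \<xi> 2 < \<xi>"
        using fundamental_sequence_less[OF \<zeta> 3] by simp
      moreover have "infinite (M - {..<2})"
        using less.prems(2) by simp
      ultimately obtain F where F: "F \<subseteq> M - {..<2}" "card F = m" "in_schreier \<zeta> (\<zeta> \<xi> 2) F"
        using less.IH by metis
      then have "in_schreier \<zeta> \<xi> F"
        using 3 by (intro in_schreier.limit[of \<xi> 2]) auto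
      then show ?thesis
        using F by blast
    qed
  qed
  then show ?thesis
    using that assms(3) by blast
qed

text \<open>By the diagonal lemma only members that contain an index below \<open>m\<close> matter. In the successor
  case such a set is a union of at most \<open>m\<close> members of the preceding family; in the limit case
  it lies in one of the first \<open>m\<close> families of the fundamental sequence.\<close>

lemma small_family_schreier:
  assumes \<zeta>: "fundamental_sequences \<zeta>"
  shows "small_family (schreier \<zeta> \<xi>)"
proof (induction \<xi> rule: less_induct)
  case (less \<xi>)
  show ?case
  proof (rule small_family_diagonal)
    fix m
    define SU where "SU = (if \<exists>\<eta>. \<xi> = ord_succ \<eta>
      then {\<Union>\<H> |\<H>. \<H> \<subseteq> schreier \<zeta> (THE \<eta>. \<xi> = ord_succ \<eta>) \<and> finite \<H> \<and> card \<H> \<le> m} else {})"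
    define LI where "LI = (if ord_limit \<xi> then \<Union>n\<in>{1..m}. schreier \<zeta> (\<zeta> \<xi> n) else {})"
    have "small_family SU"
    proof (cases "\<exists>\<eta>. \<xi> = ord_succ \<eta>")
      case True
      then obtain \<eta> where \<eta>: "\<xi> = ord_succ \<eta>" by blast
      then have "(THE \<eta>. \<xi> = ord_succ \<eta>) = \<eta>"
        using ord_succ_inject by blast
      then show ?thesis
        using small_family_unions[OF less[of \<eta>]] less_ord_succ True by (simp add: SU_def \<eta>)
    qed (use small_family_mono[OF small_family_bounded] in \<open>auto simp: SU_def\<close>)
    moreover have "small_family LI"
      using small_family_UN_finite[of "{1..m}"] less fundamental_sequence_less[OF \<zeta>]
        small_family_mono[OF small_family_bounded, of "{}"]
      by (auto simp: LI_def)
    ultimately have "small_family ({G. finite G \<and> card G \<le> m} \<union> (SU \<union> LI))"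
      by (intro small_family_Un small_family_card_le)
    moreover have "G \<in> {G. finite G \<and> card G \<le> m} \<union> (SU \<union> LI)"
      if "in_schreier \<zeta> \<xi> G" and hitm: "G \<inter> {..<m} \<noteq> {}" for G
      using that(1)
    proof cases
      case zero_empty
      then show ?thesis by auto
    next
      case (zero_singleton n)
      then show ?thesis using hitm by auto
    next
      case one
      then have "Min G < m" "finite G" "card G \<le> Min G"
        using hitm by (auto simp: schreier_one_def intro: Min_le le_less_trans)
      then show ?thesis by auto
    next
      case succ_empty
      then show ?thesis using hitm by auto
    next
      case (succ \<eta> Fs)
      have the: "(THE \<eta>. \<xi> = ord_succ \<eta>) = \<eta>"
        using succ ord_succ_inject by blast
      obtain n F where n: "n < m" "n \<in> F" "F \<in> set Fs"
        using hitm succ by auto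
      then have "finite F"
        using succ by (auto simp: successive_def)
      have "card (set Fs) = card (Min ` set Fs)"
        using succ by (simp add: card_image successive_inj_on_Min)
      also have "\<dots> \<le> Min (Min ` set Fs)"
        using succ by (auto simp: schreier_one_def)
      also have "\<dots> \<le> Min F"
        using n by (intro Min_le) auto
      also have "\<dots> \<le> n"
        using n \<open>finite F\<close> by (intro Min_le) auto
      finally have "card (set Fs) \<le> m"
        using n by simp
      then have "G \<in> SU"
        using succ the by (auto simp: SU_def schreier_def)
      then show ?thesis by blast
    next
      case (limit n)
      then have "n \<le> m"
        using hitm by fastforce
      then have "G \<in> LI"
        using limit by (auto simp: LI_def schreier_def)
      then show ?thesis by blast
    qed
    ultimately show "small_family {G \<in> schreier \<zeta> \<xi>. G \<inter> {..<m} \<noteq> {}}"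
      by (elim small_family_mono) (auto simp: schreier_def)
  qed
qed


section \<open>The Tsirelson norms on finitely supported sequences\<close>

lemma powr_convex_nonneg:
  fixes x y t q :: real
  assumes "1 \<le> q" "0 \<le> x" "0 \<le> y" "0 \<le> t" "t \<le> 1"
  shows "((1 - t) * x + t * y) powr q \<le> (1 - t) * x powr q + t * y powr q"
proof -
  have le: "s powr q \<le> s" if "0 \<le> s" "s \<le> 1" for s :: real
    using that powr_mono'[of 1 q s] assms(1) by (cases "s = 0") auto
  show ?thesis
  proof (cases "x = 0 \<or> y = 0")
    case True
    then show ?thesis
    proof
      assume "x = 0"
      then show ?thesis
        using assms le[of t] by (simp add: powr_mult mult_right_mono)
    next
      assume "y = 0"
      then show ?thesis
        using assms le[of "1 - t"] by (simp add: powr_mult mult_right_mono)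
    qed
  next
    case False
    then show ?thesis
      using convex_onD[OF powr_convex[OF assms(1)], of t x y] assms by simp
  qed
qed

text \<open>Minkowski's inequality in the form needed for a supremum: the bounds \<open>c \<alpha>\<^sup>q\<close> and \<open>c \<beta>\<^sup>q\<close> hold
  for each admissible family separately, with the same \<open>\<alpha>\<close> and \<open>\<beta>\<close>.\<close>

lemma sum_powr_add_le:
  fixes A B :: "'i \<Rightarrow> real"
  assumes "1 \<le> q" "0 < \<alpha>" "0 < \<beta>"
    and nn: "\<And>i. i \<in> I \<Longrightarrow> 0 \<le> A i" "\<And>i. i \<in> I \<Longrightarrow> 0 \<le> B i"
    and A: "(\<Sum>i\<in>I. A i powr q) \<le> c * \<alpha> powr q" and B: "(\<Sum>i\<in>I. B i powr q) \<le> c * \<beta> powr q"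
  shows "(\<Sum>i\<in>I. (A i + B i) powr q) \<le> c * (\<alpha> + \<beta>) powr q"
proof -
  define t where "t = \<beta> / (\<alpha> + \<beta>)"
  have t: "0 \<le> t" "t \<le> 1" "1 - t = \<alpha> / (\<alpha> + \<beta>)"
    using assms(2,3) by (auto simp: t_def field_simps)
  have "(A i + B i) powr q \<le> (\<alpha> + \<beta>) powr q * ((1 - t) * (A i powr q / \<alpha> powr q) + t * (B i powr q / \<beta> powr q))"
    if "i \<in> I" for i
  proof -
    have "(1 - t) * (A i / \<alpha>) + t * (B i / \<beta>) = (A i + B i) / (\<alpha> + \<beta>)"
    proof -
      have "(1 - t) * (A i / \<alpha>) = A i / (\<alpha> + \<beta>)" "t * (B i / \<beta>) = B i / (\<alpha> + \<beta>)"
        using assms(2,3) by (simp_all add: t(3), simp add: t_def)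
      then show ?thesis
        by (simp add: add_divide_distrib)
    qed
    then have "(A i + B i) powr q / (\<alpha> + \<beta>) powr q \<le> (1 - t) * (A i / \<alpha>) powr q + t * (B i / \<beta>) powr q"
      using powr_convex_nonneg[OF assms(1), of "A i / \<alpha>" "B i / \<beta>" t] nn[OF that] assms(2,3) t
      by (simp add: powr_divide)
    then show ?thesis
      using assms(2,3) nn[OF that] by (simp add: powr_divide field_simps)
  qed
  then have "(\<Sum>i\<in>I. (A i + B i) powr q)
      \<le> (\<Sum>i\<in>I. (\<alpha> + \<beta>) powr q * ((1 - t) * (A i powr q / \<alpha> powr q) + t * (B i powr q / \<beta> powr q)))"
    by (rule sum_mono)
  also have "\<dots> = (\<alpha> + \<beta>) powr q * ((1 - t) * ((\<Sum>i\<in>I. A i powr q) / \<alpha> powr q) + t * ((\<Sum>i\<in>I. B i powr q) / \<beta> powr q))"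
    by (simp add: sum_distrib_left sum.distrib sum_divide_distrib algebra_simps)
  also have "\<dots> \<le> (\<alpha> + \<beta>) powr q * ((1 - t) * c + t * c)"
    using A B assms(2,3) t
    by (intro mult_left_mono add_mono) (auto simp: divide_le_eq)
  finally show ?thesis
    by (simp add: algebra_simps)
qed

lemma restrict_to_apply: "restrict_to E x n = (if n \<in> E then x n else 0)"
  by (simp add: restrict_to_def)

lemma supp_restrict_to: "supp (restrict_to E x) = E \<inter> supp x"
  by (auto simp: supp_def restrict_to_def)

lemma restrict_to_commute: "restrict_to E (restrict_to F x) = restrict_to F (restrict_to E x)"
  by (auto simp: restrict_to_def)

lemma c00_restrict: "x \<in> c00 \<Longrightarrow> restrict_to E x \<in> c00"
  by (simp add: c00_def supp_restrict_to) (simp add: restrict_to_def)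

lemma c00_zero: "(\<lambda>n. 0) \<in> c00"
  by (simp add: c00_def supp_def)

lemma c00_add:
  fixes x y :: "nat \<Rightarrow> 'k::real_normed_field"
  assumes "x \<in> c00" "y \<in> c00"
  shows "(\<lambda>n. x n + y n) \<in> c00"
proof -
  have "supp (\<lambda>n. x n + y n) \<subseteq> supp x \<union> supp y"
    by (auto simp: supp_def)
  then show ?thesis
    using assms finite_subset by (fastforce simp: c00_def)
qed

lemma c00_scale:
  fixes x :: "nat \<Rightarrow> 'k::real_normed_field"
  assumes "x \<in> c00"
  shows "(\<lambda>n. a * x n) \<in> c00"
proof -
  have "supp (\<lambda>n. a * x n) \<subseteq> supp x"
    by (auto simp: supp_def)
  then show ?thesis
    using assms finite_subset by (fastforce simp: c00_def)
qed

lemma c00_sum: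
  fixes x :: "'i \<Rightarrow> nat \<Rightarrow> 'k::real_normed_field"
  assumes "\<And>i. i \<in> I \<Longrightarrow> x i \<in> c00"
  shows "(\<lambda>n. \<Sum>i\<in>I. x i n) \<in> c00"
  using assms by (induction I rule: infinite_finite_induct) (auto intro: c00_zero c00_add)

lemma norm_le_sup_norm:
  fixes x :: "nat \<Rightarrow> 'k::real_normed_field"
  assumes "finite (supp x)"
  shows "norm (x n) \<le> sup_norm x"
proof -
  have "range (\<lambda>n. norm (x n)) \<subseteq> insert 0 ((\<lambda>n. norm (x n)) ` supp x)"
    by (auto simp: supp_def)
  then have "bdd_above (range (\<lambda>n. norm (x n)))"
    using assms by (meson bdd_above_finite finite_imageI finite_insert finite_subset)
  then show ?thesis
    unfolding sup_norm_def by (rule cSUP_upper[rotated]) simp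
qed

lemma sup_norm_le: "(\<And>n. norm (x n) \<le> c) \<Longrightarrow> sup_norm x \<le> c"
  unfolding sup_norm_def by (rule cSUP_least) auto

lemma c00_finite: "x \<in> c00 \<Longrightarrow> finite (supp x)"
  by (simp add: c00_def)

lemma le_powr_inverse_iff:
  fixes a b :: real
  assumes "0 < q" "0 \<le> a" "0 \<le> b"
  shows "a \<le> b powr (1 / q) \<longleftrightarrow> a powr q \<le> b"
proof
  assume "a \<le> b powr (1 / q)"
  then have "a powr q \<le> (b powr (1 / q)) powr q"
    using assms by (intro powr_mono2) auto
  then show "a powr q \<le> b"
    using assms by (simp add: powr_powr)
next
  assume "a powr q \<le> b"
  then have "(a powr q) powr (1 / q) \<le> b powr (1 / q)"
    using assms by (intro powr_mono2) auto
  then show "a \<le> b powr (1 / q)"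
    using assms by (simp add: powr_powr)
qed

lemma powr_inverse_le_iff:
  fixes a b :: real
  assumes "0 < q" "0 \<le> a" "0 \<le> b"
  shows "b powr (1 / q) \<le> a \<longleftrightarrow> b \<le> a powr q"
proof
  assume "b powr (1 / q) \<le> a"
  then have "(b powr (1 / q)) powr q \<le> a powr q"
    using assms by (intro powr_mono2) auto
  then show "b \<le> a powr q"
    using assms by (simp add: powr_powr)
next
  assume "b \<le> a powr q"
  then have "b powr (1 / q) \<le> (a powr q) powr (1 / q)"
    using assms by (intro powr_mono2) auto
  then show "b powr (1 / q) \<le> a"
    using assms by (simp add: powr_powr)
qed

definition power_sum :: "real \<Rightarrow> (nat \<Rightarrow> 'k::real_normed_field) \<Rightarrow> real" where
  "power_sum q x = (\<Sum>n\<in>supp x. norm (x n) powr q)"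

lemma sum_power_sum_restrict:
  fixes x :: "nat \<Rightarrow> 'k::real_normed_field"
  assumes "successive Es" "finite (supp x)"
  shows "(\<Sum>E\<in>set Es. power_sum q (restrict_to E x)) \<le> power_sum q x"
proof -
  have "(\<Sum>E\<in>set Es. power_sum q (restrict_to E x)) = (\<Sum>E\<in>set Es. \<Sum>n\<in>E \<inter> supp x. norm (x n) powr q)"
    by (intro sum.cong refl) (auto simp: power_sum_def supp_restrict_to restrict_to_apply intro: sum.cong)
  also have "\<dots> = (\<Sum>n\<in>(\<Union>E\<in>set Es. E \<inter> supp x). norm (x n) powr q)"
    using assms successive_disjoint[OF assms(1)] by (intro sum.UNION_disjoint[symmetric]) blast+
  also have "\<dots> \<le> power_sum q x"
    unfolding power_sum_def using assms(2) by (intro sum_mono2) auto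
  finally show ?thesis .
qed

locale tsirelson =
  fixes q :: real and \<S> :: "nat set set"
  assumes q: "1 \<le> q" and admissible_nonempty: "admissible \<S> \<noteq> {}"
begin

abbreviation iter where "iter \<equiv> tsirelson_iter q \<S>"

lemma admissible_sum_list: "Es \<in> admissible \<S> \<Longrightarrow> (\<Sum>E\<leftarrow>Es. f E) = (\<Sum>E\<in>set Es. f E)"
  by (simp add: admissible_def sum_list_distinct_conv_sum_set successive_distinct)

text \<open>Domination by the \<open>\<ell>\<^sub>q\<close> norm makes the suprema in the recursion finite, and later makes the
  increasing sequence of norms converge.\<close>

lemma iter_le_power_sum:
  fixes x :: "nat \<Rightarrow> 'k::real_normed_field"
  assumes "x \<in> c00"
  shows "0 \<le> iter n x \<and> iter n x powr q \<le> power_sum q x"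
  using assms
proof (induction n arbitrary: x)
  have sup: "0 \<le> sup_norm x" "sup_norm x \<le> power_sum q x powr (1 / q)" if "x \<in> c00" for x :: "nat \<Rightarrow> 'k"
  proof -
    show "0 \<le> sup_norm x"
      using norm_le_sup_norm[OF c00_finite[OF that], of 0] norm_ge_zero order_trans by blast
    show "sup_norm x \<le> power_sum q x powr (1 / q)"
    proof (rule sup_norm_le)
      fix n
      have "norm (x n) powr q \<le> power_sum q x"
      proof (cases "x n = 0")
        case False
        then show ?thesis
          unfolding power_sum_def using c00_finite[OF that] by (intro member_le_sum) (auto simp: supp_def)
      qed (simp add: power_sum_def sum_nonneg)
      then show "norm (x n) \<le> power_sum q x powr (1 / q)"
        using q by (simp add: le_powr_inverse_iff power_sum_def sum_nonneg)
    qed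
  qed
  have nn: "0 \<le> power_sum q x" for x :: "nat \<Rightarrow> 'k"
    by (simp add: power_sum_def sum_nonneg)
  {
    case 0
    then show ?case
      using sup[of x] q nn by (simp add: le_powr_inverse_iff)
  next
    case (Suc n)
    have "(\<Sum>E\<leftarrow>Es. iter n (restrict_to E x) powr q) powr (1 / q) \<le> power_sum q x powr (1 / q)"
      if "Es \<in> admissible \<S>" for Es
    proof (rule powr_mono2)
      have "(\<Sum>E\<in>set Es. iter n (restrict_to E x) powr q) \<le> (\<Sum>E\<in>set Es. power_sum q (restrict_to E x))"
        using Suc by (intro sum_mono) (auto simp: c00_restrict)
      also have "\<dots> \<le> power_sum q x"
        using that Suc.prems by (intro sum_power_sum_restrict) (auto simp: admissible_def c00_finite)
      finally show "(\<Sum>E\<leftarrow>Es. iter n (restrict_to E x) powr q) \<le> power_sum q x"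
        using that by (simp add: admissible_sum_list)
    qed (use that q in \<open>auto simp: admissible_sum_list sum_nonneg\<close>)
    then have S: "(SUP Es\<in>admissible \<S>. (\<Sum>E\<leftarrow>Es. iter n (restrict_to E x) powr q) powr (1 / q))
        \<le> power_sum q x powr (1 / q)" (is "?S \<le> _")
      using admissible_nonempty by (intro cSUP_least) auto
    have "2 powr (- 1 / q) \<le> (1 :: real)"
      using q powr_mono[of "- 1 / q" 0 2] by simp
    have "2 powr (- 1 / q) * ?S \<le> 2 powr (- 1 / q) * power_sum q x powr (1 / q)"
      using S by (intro mult_left_mono) auto
    also have "\<dots> \<le> 1 * power_sum q x powr (1 / q)"
      using \<open>2 powr (- 1 / q) \<le> 1\<close> by (intro mult_right_mono) auto
    finally have "iter (Suc n) x \<le> power_sum q x powr (1 / q)"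
      using sup[OF Suc.prems] by simp
    moreover have "0 \<le> iter (Suc n) x"
      using sup[OF Suc.prems] by simp
    ultimately show ?case
      using q nn by (simp add: le_powr_inverse_iff del: tsirelson_iter.simps)
  }
qed

lemma iter_nonneg: "x \<in> c00 \<Longrightarrow> 0 \<le> iter n x"
  using iter_le_power_sum by blast

lemma sup_norm_le_iter: "sup_norm x \<le> iter n x"
  by (cases n) auto

lemma norm_le_iter: "x \<in> c00 \<Longrightarrow> norm (x k) \<le> iter n x"
  using norm_le_sup_norm[OF c00_finite] sup_norm_le_iter order_trans by blast

text \<open>Together with \<open>iter_Suc_le\<close> this characterises the supremum in the recursion, so that the
  inductions below never need to refer to it.\<close>

lemma iter_admissible:
  fixes x :: "nat \<Rightarrow> 'k::real_normed_field"
  assumes "x \<in> c00" "Es \<in> admissible \<S>"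
  shows "(\<Sum>E\<in>set Es. iter n (restrict_to E x) powr q) \<le> 2 * iter (Suc n) x powr q"
proof -
  define g where "g Es = (\<Sum>E\<leftarrow>Es. iter n (restrict_to E x) powr q)" for Es
  have "g Es powr (1 / q) \<le> power_sum q x powr (1 / q)" if "Es \<in> admissible \<S>" for Es
  proof (rule powr_mono2)
    have "g Es \<le> (\<Sum>E\<in>set Es. power_sum q (restrict_to E x))"
      unfolding g_def admissible_sum_list[OF that]
      using assms(1) by (intro sum_mono) (simp add: iter_le_power_sum c00_restrict)
    also have "\<dots> \<le> power_sum q x"
      using that assms(1) by (intro sum_power_sum_restrict) (auto simp: admissible_def c00_finite)
    finally show "g Es \<le> power_sum q x" .
  qed (use that q in \<open>auto simp: g_def admissible_sum_list sum_nonneg\<close>)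
  then have "bdd_above ((\<lambda>Es. g Es powr (1 / q)) ` admissible \<S>)"
    by (auto simp: bdd_above_def)
  then have "g Es powr (1 / q) \<le> (SUP Es\<in>admissible \<S>. g Es powr (1 / q))"
    using assms(2) by (rule cSUP_upper[rotated])
  then have "2 powr (- 1 / q) * g Es powr (1 / q) \<le> iter (Suc n) x"
    unfolding tsirelson_iter.simps g_def by (intro max.coboundedI2 mult_left_mono) auto
  moreover have "2 powr (- 1 / q) * g Es powr (1 / q) = (g Es / 2) powr (1 / q)"
    using assms(2) by (simp add: powr_divide powr_minus_divide g_def admissible_sum_list sum_nonneg)
  moreover have "0 \<le> g Es / 2"
    using assms(2) by (simp add: g_def admissible_sum_list sum_nonneg)
  ultimately have "g Es / 2 \<le> iter (Suc n) x powr q"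
    using q iter_nonneg[OF assms(1), of "Suc n"] powr_inverse_le_iff by (metis less_le_trans zero_less_one)
  then show ?thesis
    using assms(2) by (simp add: g_def admissible_sum_list del: tsirelson_iter.simps)
qed

lemma iter_Suc_le:
  fixes x :: "nat \<Rightarrow> 'k::real_normed_field"
  assumes "0 \<le> c" "\<And>k. norm (x k) \<le> c"
    and "\<And>Es. Es \<in> admissible \<S> \<Longrightarrow> (\<Sum>E\<in>set Es. iter n (restrict_to E x) powr q) \<le> 2 * c powr q"
  shows "iter (Suc n) x \<le> c"
proof -
  have "(\<Sum>E\<leftarrow>Es. iter n (restrict_to E x) powr q) powr (1 / q) \<le> 2 powr (1 / q) * c"
    if "Es \<in> admissible \<S>" for Es
  proof -
    have "(\<Sum>E\<leftarrow>Es. iter n (restrict_to E x) powr q) powr (1 / q) \<le> (2 * c powr q) powr (1 / q)"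
      using assms(3)[OF that] that q by (intro powr_mono2) (auto simp: admissible_sum_list sum_nonneg)
    then show ?thesis
      using assms(1) q by (simp add: powr_mult powr_powr)
  qed
  then have "(SUP Es\<in>admissible \<S>. (\<Sum>E\<leftarrow>Es. iter n (restrict_to E x) powr q) powr (1 / q)) \<le> 2 powr (1 / q) * c"
    using admissible_nonempty by (intro cSUP_least) auto
  then have "2 powr (- 1 / q) * (SUP Es\<in>admissible \<S>. (\<Sum>E\<leftarrow>Es. iter n (restrict_to E x) powr q) powr (1 / q))
      \<le> 2 powr (- 1 / q) * (2 powr (1 / q) * c)"
    by (intro mult_left_mono) auto
  also have "\<dots> = c"
    by (simp add: powr_minus_divide)
  finally show ?thesis
    using sup_norm_le[OF assms(2)] by simp
qed

lemma iter_mono: "x \<in> c00 \<Longrightarrow> iter n x \<le> iter (Suc n) x"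
proof (induction n arbitrary: x)
  case 0
  then show ?case by simp
next
  case (Suc n)
  show ?case
  proof (rule iter_Suc_le)
    fix Es assume Es: "Es \<in> admissible \<S>"
    have "(\<Sum>E\<in>set Es. iter n (restrict_to E x) powr q) \<le> (\<Sum>E\<in>set Es. iter (Suc n) (restrict_to E x) powr q)"
      using Suc q by (intro sum_mono powr_mono2) (auto simp: c00_restrict iter_nonneg simp del: tsirelson_iter.simps)
    also have "\<dots> \<le> 2 * iter (Suc (Suc n)) x powr q"
      by (rule iter_admissible[OF Suc.prems Es])
    finally show "(\<Sum>E\<in>set Es. iter n (restrict_to E x) powr q) \<le> 2 * iter (Suc (Suc n)) x powr q" .
  qed (use Suc.prems in \<open>auto simp: iter_nonneg norm_le_iter simp del: tsirelson_iter.simps\<close>)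
qed

lemma iter_restrict: "x \<in> c00 \<Longrightarrow> iter n (restrict_to F x) \<le> iter n x"
proof (induction n arbitrary: x)
  case 0
  then show ?case
    by (auto intro!: sup_norm_le norm_le_sup_norm simp: restrict_to_apply c00_finite
        order_trans[OF norm_ge_zero norm_le_sup_norm])
next
  case (Suc n)
  show ?case
  proof (rule iter_Suc_le)
    fix Es assume Es: "Es \<in> admissible \<S>"
    have "(\<Sum>E\<in>set Es. iter n (restrict_to E (restrict_to F x)) powr q) \<le> (\<Sum>E\<in>set Es. iter n (restrict_to E x) powr q)"
      using Suc q
      by (intro sum_mono powr_mono2) (auto simp: c00_restrict iter_nonneg restrict_to_commute[of _ F])
    also have "\<dots> \<le> 2 * iter (Suc n) x powr q"
      by (rule iter_admissible[OF Suc.prems Es])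
    finally show "(\<Sum>E\<in>set Es. iter n (restrict_to E (restrict_to F x)) powr q) \<le> 2 * iter (Suc n) x powr q" .
  qed (use Suc.prems in \<open>auto simp: iter_nonneg norm_le_iter restrict_to_apply simp del: tsirelson_iter.simps\<close>)
qed

lemma iter_scale: "x \<in> c00 \<Longrightarrow> iter n (\<lambda>k. a * x k) \<le> norm a * iter n x"
proof (induction n arbitrary: x)
  case 0
  then show ?case
    by (auto intro!: sup_norm_le mult_left_mono norm_le_sup_norm simp: norm_mult c00_finite)
next
  case (Suc n)
  show ?case
  proof (rule iter_Suc_le)
    fix Es assume Es: "Es \<in> admissible \<S>"
    have eq: "restrict_to E (\<lambda>k. a * x k) = (\<lambda>k. a * restrict_to E x k)" for E
      by (auto simp: restrict_to_def)
    have "(\<Sum>E\<in>set Es. iter n (restrict_to E (\<lambda>k. a * x k)) powr q)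
        \<le> (\<Sum>E\<in>set Es. (norm a * iter n (restrict_to E x)) powr q)"
      unfolding eq using Suc q
      by (intro sum_mono powr_mono2) (auto simp: c00_restrict c00_scale iter_nonneg)
    also have "\<dots> = norm a powr q * (\<Sum>E\<in>set Es. iter n (restrict_to E x) powr q)"
      using Suc.prems by (simp add: powr_mult iter_nonneg c00_restrict sum_distrib_left)
    also have "\<dots> \<le> norm a powr q * (2 * iter (Suc n) x powr q)"
      by (intro mult_left_mono iter_admissible[OF Suc.prems Es]) auto
    also have "\<dots> = 2 * (norm a * iter (Suc n) x) powr q"
      using iter_nonneg[OF Suc.prems, of "Suc n"] by (simp add: powr_mult del: tsirelson_iter.simps)
    finally show "(\<Sum>E\<in>set Es. iter n (restrict_to E (\<lambda>k. a * x k)) powr q) \<le> \<dots>" .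
  qed (use Suc.prems in \<open>auto simp: iter_nonneg norm_le_iter norm_mult mult_left_mono simp del: tsirelson_iter.simps\<close>)
qed

lemma iter_add:
  fixes x y :: "nat \<Rightarrow> 'k::real_normed_field"
  assumes "x \<in> c00" "y \<in> c00"
  shows "iter n (\<lambda>k. x k + y k) \<le> iter n x + iter n y"
  using assms
proof (induction n arbitrary: x y)
  case 0
  have "norm (x k + y k) \<le> sup_norm x + sup_norm y" for k
    using norm_triangle_ineq[of "x k" "y k"] norm_le_sup_norm[OF c00_finite, of x k]
      norm_le_sup_norm[OF c00_finite, of y k] 0 by simp
  then show ?case
    by (simp add: sup_norm_le)
next
  case (Suc n)
  let ?\<alpha> = "iter (Suc n) x" and ?\<beta> = "iter (Suc n) y"
  have zero: "z = (\<lambda>_. 0)" if "iter (Suc n) z = 0" "z \<in> c00" for z :: "nat \<Rightarrow> 'k"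
    using norm_le_iter[OF that(2), of _ "Suc n"] that(1) by auto
  show ?case
  proof (cases "?\<alpha> = 0 \<or> ?\<beta> = 0")
    case True
    then show ?thesis
    proof
      assume "?\<alpha> = 0"
      then show ?thesis
        using zero[of x] Suc.prems by (simp del: tsirelson_iter.simps)
    next
      assume "?\<beta> = 0"
      then show ?thesis
        using zero[of y] Suc.prems by (simp del: tsirelson_iter.simps)
    qed
  next
    case False
    have pos: "0 < ?\<alpha>" "0 < ?\<beta>"
      using False iter_nonneg[OF Suc.prems(1), of "Suc n"] iter_nonneg[OF Suc.prems(2), of "Suc n"]
      by linarith+
    show ?thesis
    proof (rule iter_Suc_le)
      fix Es assume Es: "Es \<in> admissible \<S>"
      have eq: "restrict_to E (\<lambda>k. x k + y k) = (\<lambda>k. restrict_to E x k + restrict_to E y k)" for E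
        by (auto simp: restrict_to_def)
      have "(\<Sum>E\<in>set Es. iter n (restrict_to E (\<lambda>k. x k + y k)) powr q)
          \<le> (\<Sum>E\<in>set Es. (iter n (restrict_to E x) + iter n (restrict_to E y)) powr q)"
        unfolding eq using Suc q
        by (intro sum_mono powr_mono2) (auto simp: c00_restrict c00_add iter_nonneg)
      also have "\<dots> \<le> 2 * (?\<alpha> + ?\<beta>) powr q"
        using Suc.prems
        by (intro sum_powr_add_le[OF q pos] iter_admissible Es) (auto simp: iter_nonneg c00_restrict)
      finally show "(\<Sum>E\<in>set Es. iter n (restrict_to E (\<lambda>k. x k + y k)) powr q) \<le> 2 * (?\<alpha> + ?\<beta>) powr q" .
    next
      fix k
      show "norm (x k + y k) \<le> ?\<alpha> + ?\<beta>"
        using norm_triangle_ineq[of "x k" "y k"] norm_le_iter[OF Suc.prems(1), of k "Suc n"]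
          norm_le_iter[OF Suc.prems(2), of k "Suc n"] by linarith
    qed (use pos in linarith)
  qed
qed

text \<open>The norm is \<open>q\<close>-convex; for disjoint supports this is an upper \<open>\<ell>\<^sub>q\<close> estimate with constant
  one.\<close>

lemma iter_add_disjoint:
  fixes x y :: "nat \<Rightarrow> 'k::real_normed_field"
  assumes "x \<in> c00" "y \<in> c00" "supp x \<inter> supp y = {}"
  shows "iter n (\<lambda>k. x k + y k) powr q \<le> iter n x powr q + iter n y powr q"
  using assms
proof (induction n arbitrary: x y)
  have nrm: "norm (x k + y k) powr q \<le> iter n x powr q + iter n y powr q"
    if "x \<in> c00" "y \<in> c00" "supp x \<inter> supp y = {}" for x y :: "nat \<Rightarrow> 'k" and k n
  proof -
    have "norm (x k) powr q \<le> iter n x powr q" "norm (y k) powr q \<le> iter n y powr q"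
      using that q by (auto intro!: powr_mono2 norm_le_iter)
    moreover have "x k = 0 \<or> y k = 0"
      using that(3) by (auto simp: supp_def)
    ultimately show ?thesis
      by (auto simp: add_increasing add_increasing2)
  qed
  {
    case 0
    have "sup_norm (\<lambda>k. x k + y k) \<le> (iter 0 x powr q + iter 0 y powr q) powr (1 / q)"
      using nrm[OF 0, of _ 0] q by (intro sup_norm_le) (simp add: le_powr_inverse_iff)
    then show ?case
      using q sup_norm_le_iter norm_le_sup_norm[OF c00_finite[OF c00_add[OF 0(1,2)]], of 0]
      by (subst (asm) le_powr_inverse_iff) (auto intro: order_trans[OF norm_ge_zero])
  next
    case (Suc n)
    let ?c = "(iter (Suc n) x powr q + iter (Suc n) y powr q) powr (1 / q)"
    have cq: "?c powr q = iter (Suc n) x powr q + iter (Suc n) y powr q"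
      using q by (simp add: powr_powr del: tsirelson_iter.simps)
    have "iter (Suc n) (\<lambda>k. x k + y k) \<le> ?c"
    proof (rule iter_Suc_le)
      fix Es assume Es: "Es \<in> admissible \<S>"
      have eq: "restrict_to E (\<lambda>k. x k + y k) = (\<lambda>k. restrict_to E x k + restrict_to E y k)" for E
        by (auto simp: restrict_to_def)
      have "(\<Sum>E\<in>set Es. iter n (restrict_to E (\<lambda>k. x k + y k)) powr q)
          \<le> (\<Sum>E\<in>set Es. iter n (restrict_to E x) powr q + iter n (restrict_to E y) powr q)"
        unfolding eq using Suc.prems
        by (intro sum_mono Suc.IH) (auto simp: c00_restrict supp_restrict_to)
      also have "\<dots> \<le> 2 * iter (Suc n) x powr q + 2 * iter (Suc n) y powr q"
        unfolding sum.distrib using Suc.prems Es by (intro add_mono iter_admissible) auto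
      finally show "(\<Sum>E\<in>set Es. iter n (restrict_to E (\<lambda>k. x k + y k)) powr q) \<le> 2 * ?c powr q"
        unfolding cq by (simp only: distrib_left)
    next
      fix k
      show "norm (x k + y k) \<le> ?c"
        using nrm[OF Suc.prems, of k "Suc n"] q by (simp add: le_powr_inverse_iff del: tsirelson_iter.simps)
    qed simp
    then show ?case
      using q iter_nonneg[OF c00_add[OF Suc.prems(1,2)], of "Suc n"]
      by (simp add: le_powr_inverse_iff del: tsirelson_iter.simps)
  }
qed

end


section \<open>Blocks with small combinations\<close>

definition block_combination ::
    "real \<Rightarrow> (nat \<Rightarrow> real) \<Rightarrow> nat set \<Rightarrow> (nat \<Rightarrow> nat \<Rightarrow> 'k) \<Rightarrow> nat \<Rightarrow> 'k::real_normed_field" where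
  "block_combination q a I x = (\<lambda>n. \<Sum>i\<in>I. of_real (a i powr (1 / q)) * x i n)"

lemma block_combination_c00:
  assumes "\<And>i. x i \<in> c00"
  shows "block_combination q a I x \<in> c00"
  unfolding block_combination_def using assms by (intro c00_sum c00_scale)

text \<open>Bounded functionals on the dense subspace \<open>c\<^sub>0\<^sub>0\<close>, before they are extended to the completion.\<close>

definition bounded_functional ::
    "((nat \<Rightarrow> 'k) \<Rightarrow> real) \<Rightarrow> ((nat \<Rightarrow> 'k::real_normed_field) \<Rightarrow> 'k) \<Rightarrow> bool" where
  "bounded_functional \<nu> f \<longleftrightarrow>
     (\<forall>x\<in>c00. \<forall>y\<in>c00. f (\<lambda>n. x n + y n) = f x + f y) \<and>
     (\<forall>a. \<forall>x\<in>c00. f (\<lambda>n. a * x n) = a * f x) \<and>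
     (\<exists>B. \<forall>x\<in>c00. norm (f x) \<le> B * \<nu> x)"

lemma bounded_functional_add:
  "bounded_functional \<nu> f \<Longrightarrow> x \<in> c00 \<Longrightarrow> y \<in> c00 \<Longrightarrow> f (\<lambda>n. x n + y n) = f x + f y"
  and bounded_functional_scale:
  "bounded_functional \<nu> f \<Longrightarrow> x \<in> c00 \<Longrightarrow> f (\<lambda>n. a * x n) = a * f x"
  by (auto simp: bounded_functional_def)

lemma bounded_functional_zero: "bounded_functional \<nu> f \<Longrightarrow> f (\<lambda>n. 0) = 0"
  using bounded_functional_scale[of \<nu> f "\<lambda>n. 0" 0] by (simp add: c00_zero)

lemma bounded_functional_sum:
  assumes "bounded_functional \<nu> f" "\<And>i. i \<in> I \<Longrightarrow> x i \<in> c00"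
  shows "f (\<lambda>n. \<Sum>i\<in>I. c i * x i n) = (\<Sum>i\<in>I. c i * f (x i))"
  using assms(2)
proof (induction I rule: infinite_finite_induct)
  case (insert j I)
  have "f (\<lambda>n. c j * x j n + (\<Sum>i\<in>I. c i * x i n)) = f (\<lambda>n. c j * x j n) + f (\<lambda>n. \<Sum>i\<in>I. c i * x i n)"
    using insert.prems by (intro bounded_functional_add[OF assms(1)] c00_sum c00_scale) auto
  then show ?case
    using insert bounded_functional_scale[OF assms(1)] by simp
qed (use bounded_functional_zero[OF assms(1)] in auto)

context tsirelson
begin

abbreviation T where "T \<equiv> tsirelson_norm q \<S>"

lemma iter_tendsto:
  fixes x :: "nat \<Rightarrow> 'k::real_normed_field"
  assumes "x \<in> c00"
  shows "(\<lambda>n. iter n x) \<longlonglongrightarrow> T x"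
proof -
  have inc: "incseq (\<lambda>n. iter n x)"
    using iter_mono[OF assms] by (rule incseq_SucI)
  moreover have "iter n x \<le> power_sum q x powr (1 / q)" for n
    using iter_le_power_sum[OF assms, of n] q by (simp add: le_powr_inverse_iff power_sum_def sum_nonneg)
  ultimately have "convergent (\<lambda>n. iter n x)"
    by (metis convergentI incseq_convergent)
  then show ?thesis
    unfolding tsirelson_norm_def by (simp add: convergent_LIMSEQ_iff)
qed

lemma iter_le_T: "x \<in> c00 \<Longrightarrow> iter n x \<le> T x"
  using incseq_SucI[of "\<lambda>n. iter n x"] iter_mono iter_tendsto incseq_le by metis

lemma iter_powr_tendsto:
  assumes "x \<in> c00"
  shows "(\<lambda>n. iter n x powr q) \<longlonglongrightarrow> T x powr q"
  using q iter_nonneg[OF assms]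
  by (intro tendsto_powr2 iter_tendsto[OF assms] tendsto_const) auto

lemma T_nonneg: "x \<in> c00 \<Longrightarrow> 0 \<le> T x"
  using iter_le_T[of x 0] iter_nonneg[of x 0] by simp

lemma norm_le_T: "x \<in> c00 \<Longrightarrow> norm (x k) \<le> T x"
  using iter_le_T[of x 0] norm_le_iter[of x k 0] by simp

lemma T_admissible:
  fixes x :: "nat \<Rightarrow> 'k::real_normed_field"
  assumes "x \<in> c00" "Es \<in> admissible \<S>"
  shows "(\<Sum>E\<in>set Es. T (restrict_to E x) powr q) \<le> 2 * T x powr q"
proof (rule LIMSEQ_le_const2)
  show "(\<lambda>n. \<Sum>E\<in>set Es. iter n (restrict_to E x) powr q) \<longlonglongrightarrow> (\<Sum>E\<in>set Es. T (restrict_to E x) powr q)"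
    using assms by (intro tendsto_sum iter_powr_tendsto c00_restrict)
  have "(\<Sum>E\<in>set Es. iter n (restrict_to E x) powr q) \<le> 2 * T x powr q" for n
  proof -
    have "iter (Suc n) x powr q \<le> T x powr q"
      using q by (intro powr_mono2 iter_nonneg iter_le_T assms) auto
    then show ?thesis
      using iter_admissible[OF assms, of n] by linarith
  qed
  then show "\<exists>N. \<forall>n\<ge>N. (\<Sum>E\<in>set Es. iter n (restrict_to E x) powr q) \<le> 2 * T x powr q"
    by blast
qed

text \<open>The converse of \<open>T_admissible\<close>; the two together say that the norm solves its implicit
  equation.\<close>

lemma T_le:
  fixes x :: "nat \<Rightarrow> 'k::real_normed_field"
  assumes "x \<in> c00" "0 \<le> c" "\<And>k. norm (x k) \<le> c"
    and adm: "\<And>Es. Es \<in> admissible \<S> \<Longrightarrow> (\<Sum>E\<in>set Es. T (restrict_to E x) powr q) \<le> 2 * c powr q"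
  shows "T x \<le> c"
proof (rule LIMSEQ_le_const2[OF iter_tendsto[OF assms(1)]])
  have "iter (Suc n) x \<le> c" for n
  proof (rule iter_Suc_le[OF assms(2,3)])
    fix Es assume Es: "Es \<in> admissible \<S>"
    have "(\<Sum>E\<in>set Es. iter n (restrict_to E x) powr q) \<le> (\<Sum>E\<in>set Es. T (restrict_to E x) powr q)"
      using q assms(1) by (intro sum_mono powr_mono2 iter_le_T iter_nonneg c00_restrict) auto
    then show "(\<Sum>E\<in>set Es. iter n (restrict_to E x) powr q) \<le> 2 * c powr q"
      using adm[OF Es] by linarith
  qed
  then show "\<exists>N. \<forall>n\<ge>N. iter n x \<le> c"
    by (metis Suc_le_D)
qed

lemma T_restrict: "x \<in> c00 \<Longrightarrow> T (restrict_to F x) \<le> T x"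
  by (rule LIMSEQ_le[OF iter_tendsto iter_tendsto]) (auto intro: c00_restrict iter_restrict)

lemma T_add: "x \<in> c00 \<Longrightarrow> y \<in> c00 \<Longrightarrow> T (\<lambda>k. x k + y k) \<le> T x + T y"
  by (rule LIMSEQ_le[OF iter_tendsto tendsto_add[OF iter_tendsto iter_tendsto]])
    (auto intro: c00_add iter_add)

lemma T_scale_le: "x \<in> c00 \<Longrightarrow> T (\<lambda>k. a * x k) \<le> norm a * T x"
  by (rule LIMSEQ_le[OF iter_tendsto tendsto_mult[OF tendsto_const iter_tendsto]])
    (auto intro: c00_scale iter_scale)

lemma T_scale:
  fixes x :: "nat \<Rightarrow> 'k::real_normed_field"
  assumes "x \<in> c00"
  shows "T (\<lambda>k. a * x k) = norm a * T x"
proof (cases "a = 0")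
  case True
  then show ?thesis
    using T_scale_le[OF assms, of 0] T_nonneg[OF c00_zero, where ?'a = 'k] by simp
next
  case False
  have "T x = T (\<lambda>k. inverse a * (a * x k))"
    using False by (simp add: mult.assoc[symmetric])
  also have "\<dots> \<le> norm (inverse a) * T (\<lambda>k. a * x k)"
    using assms by (intro T_scale_le c00_scale)
  finally have "norm a * T x \<le> norm a * (norm (inverse a) * T (\<lambda>k. a * x k))"
    by (rule mult_left_mono) simp
  moreover have "norm a * norm (inverse a) = 1"
    using False by (simp add: norm_inverse)
  ultimately have "norm a * T x \<le> T (\<lambda>k. a * x k)"
    by (simp add: mult.assoc[symmetric])
  then show ?thesis
    using T_scale_le[OF assms, of a] by simp
qed

lemma T_zero: "T (\<lambda>k. 0 :: 'k::real_normed_field) = 0"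
  using T_scale[OF c00_zero, of "0 :: 'k"] by simp

lemma T_add_disjoint:
  assumes "x \<in> c00" "y \<in> c00" "supp x \<inter> supp y = {}"
  shows "T (\<lambda>k. x k + y k) powr q \<le> T x powr q + T y powr q"
  using assms
  by (intro LIMSEQ_le[OF iter_powr_tendsto tendsto_add[OF iter_powr_tendsto iter_powr_tendsto]])
    (auto intro: c00_add iter_add_disjoint)

lemma T_sum_disjoint:
  fixes x :: "'i \<Rightarrow> nat \<Rightarrow> 'k::real_normed_field"
  assumes "finite I" "\<And>i. i \<in> I \<Longrightarrow> x i \<in> c00"
    and "\<And>i j. i \<in> I \<Longrightarrow> j \<in> I \<Longrightarrow> i \<noteq> j \<Longrightarrow> supp (x i) \<inter> supp (x j) = {}"
  shows "T (\<lambda>k. \<Sum>i\<in>I. x i k) powr q \<le> (\<Sum>i\<in>I. T (x i) powr q)"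
  using assms
proof (induction I)
  case empty
  then show ?case by (simp add: T_zero)
next
  case (insert j I)
  have "supp (\<lambda>k. \<Sum>i\<in>I. x i k) \<subseteq> (\<Union>i\<in>I. supp (x i))"
    by (auto simp: supp_def dest: sum.not_neutral_contains_not_neutral)
  moreover have "supp (x j) \<inter> supp (x i) = {}" if "i \<in> I" for i
    using insert.prems(2)[of j i] insert.hyps(2) that by auto
  ultimately have "supp (x j) \<inter> supp (\<lambda>k. \<Sum>i\<in>I. x i k) = {}"
    by blast
  then have "T (\<lambda>k. x j k + (\<Sum>i\<in>I. x i k)) powr q \<le> T (x j) powr q + T (\<lambda>k. \<Sum>i\<in>I. x i k) powr q"
    using insert.prems by (intro T_add_disjoint c00_sum) auto
  then show ?case
    using insert by fastforce
qed

text \<open>If no member of the family starts inside the block, then at most one member meets it: a second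
  one would have to start there. This replaces the factor two of the general bound by one.\<close>

lemma admissible_sum_block_le:
  fixes x :: "nat \<Rightarrow> 'k::real_normed_field"
  assumes "x \<in> c00" "supp x \<subseteq> {p i..<p (Suc i)}" "T x powr q \<le> c" "Es \<in> admissible \<S>"
  shows "(\<Sum>E\<in>set Es. T (restrict_to E x) powr q) \<le> c + c * hit p (Min ` set Es) i"
proof (cases "Min ` set Es \<inter> {p i..<p (Suc i)} = {}")
  case False
  then show ?thesis
    using T_admissible[OF assms(1,4)] assms(3) by (simp add: hit_def)
next
  case True
  have succ: "successive Es"
    using assms(4) by (simp add: admissible_def)
  have zero: "T (restrict_to E x) powr q = 0" if "E \<inter> supp x = {}" for E
  proof -
    have "restrict_to E x = (\<lambda>n. 0)"
      using that by (auto simp: restrict_to_def supp_def fun_eq_iff disjoint_iff)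
    then show ?thesis
      by (simp add: T_zero)
  qed
  have le: "T (restrict_to E x) powr q \<le> c" for E
    using assms(1,3) q powr_mono2[of q "T (restrict_to E x)" "T x"]
    by (auto simp: T_restrict T_nonneg c00_restrict)
  have nofollow: False
    if "E \<in> set Es" "F \<in> set Es" "m \<in> E \<inter> supp x" "n \<in> F \<inter> supp x" "Max E < Min F" for E F m n
  proof -
    have "m \<le> Max E" "Min F \<le> n"
      using that succ by (auto simp: successive_def)
    then have "Min F \<in> {p i..<p (Suc i)}"
      using that assms(2) by force
    then show False
      using True that by blast
  qed
  then have uniq: "E = F" if "E \<in> set Es" "F \<in> set Es" "E \<inter> supp x \<noteq> {}" "F \<inter> supp x \<noteq> {}" for E F
    using successive_cases[OF succ that(1,2)] that by blast
  have "(\<Sum>E\<in>set Es. T (restrict_to E x) powr q) \<le> c"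
  proof (cases "\<exists>F\<in>set Es. F \<inter> supp x \<noteq> {}")
    case True
    then obtain F where F: "F \<in> set Es" "F \<inter> supp x \<noteq> {}" by blast
    have "T (restrict_to E x) powr q = 0" if "E \<in> set Es - {F}" for E
      using that F uniq zero by blast
    then have "(\<Sum>E\<in>set Es. T (restrict_to E x) powr q) = (\<Sum>E\<in>{F}. T (restrict_to E x) powr q)"
      using F(1) by (intro sum.mono_neutral_right ballI) blast+
    then show ?thesis
      using le by simp
  next
    case False
    then have "(\<Sum>E\<in>set Es. T (restrict_to E x) powr q) = 0"
      using zero by (intro sum.neutral) blast
    then show ?thesis
      using le[of "{}"] by (simp add: order_trans[OF powr_ge_zero])
  qed
  then show ?thesis
    using True by (simp add: hit_def)
qed

text \<open>By disjointness, \<open>\<parallel>E y\<parallel>\<^sup>q\<close> is at most the weighted mean of the \<open>\<parallel>E x\<^sub>i\<parallel>\<^sup>q\<close>. Weights for which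
  each admissible set of minima hits mass at most \<open>1/4\<close> bound an admissible sum by \<open>5/4 c\<close>, and
  half of this is less than \<open>3/4 c\<close>. Singletons are added to the family in order to control the
  supremum norm in the same way.\<close>

lemma block_combination_contract:
  fixes x :: "nat \<Rightarrow> nat \<Rightarrow> 'k::real_normed_field"
  assumes small: "small_family \<S>" and p: "strict_mono p" and "0 < c"
    and x: "\<And>i. x i \<in> c00" "\<And>i. supp (x i) \<subseteq> {p i..<p (Suc i)}" "\<And>i. T (x i) powr q \<le> c"
  shows "\<exists>L. \<exists>a\<in>convex_weights K L. T (block_combination q a {K..<L} x) powr q \<le> 3 / 4 * c"
proof -
  obtain L a where a: "a \<in> convex_weights K L"
    and mass: "\<And>G. G \<in> \<S> \<union> {{n} |n. True} \<Longrightarrow> (\<Sum>i\<in>{K..<L}. a i * hit p G i) \<le> 1 / 4"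
    using small_family_tail[OF small_family_Un[OF small small_family_singletons] p, of "1 / 4" K] by auto
  define y where "y = block_combination q a {K..<L} x"
  have y: "y \<in> c00"
    unfolding y_def by (rule block_combination_c00[OF x(1)])
  have upper: "T (restrict_to E y) powr q \<le> (\<Sum>i\<in>{K..<L}. a i * T (restrict_to E (x i)) powr q)" for E
  proof -
    define v where "v i = (\<lambda>n. of_real (a i powr (1 / q)) * restrict_to E (x i) n)" for i
    have "restrict_to E y = (\<lambda>n. \<Sum>i\<in>{K..<L}. v i n)"
      by (auto simp: y_def block_combination_def restrict_to_def v_def)
    moreover have "supp (v i) \<subseteq> {p i..<p (Suc i)}" for i
      using x(2)[of i] by (auto simp: v_def supp_def restrict_to_def)
    then have "supp (v i) \<inter> supp (v j) = {}" if "i \<noteq> j" for i j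
      using block_index_unique[OF p] that by blast
    moreover have "v i \<in> c00" for i
      unfolding v_def using x(1) by (intro c00_scale c00_restrict)
    ultimately have "T (restrict_to E y) powr q \<le> (\<Sum>i\<in>{K..<L}. T (v i) powr q)"
      by (simp add: T_sum_disjoint)
    moreover have "T (v i) powr q = a i * T (restrict_to E (x i)) powr q" for i
      unfolding v_def using x(1) q convex_weights_nonneg[OF a]
      by (simp add: T_scale c00_restrict powr_mult T_nonneg powr_powr)
    ultimately show ?thesis
      by simp
  qed
  have "T y \<le> (3 / 4 * c) powr (1 / q)"
  proof (rule T_le[OF y])
    fix n
    have "T (restrict_to {n} (x i)) powr q \<le> c * hit p {n} i" for i
    proof (cases "n \<in> {p i..<p (Suc i)}")
      case True
      then show ?thesis
        using x q powr_mono2[of q "T (restrict_to {n} (x i))" "T (x i)"]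
        by (auto simp: hit_def T_restrict T_nonneg c00_restrict intro: order_trans)
    next
      case False
      then have "x i n = 0"
        using x(2)[of i] by (auto simp: supp_def)
      then have "restrict_to {n} (x i) = (\<lambda>n. 0)"
        by (auto simp: restrict_to_def)
      then show ?thesis
        using \<open>0 < c\<close> by (simp add: T_zero hit_bounds)
    qed
    then have "(\<Sum>i\<in>{K..<L}. a i * T (restrict_to {n} (x i)) powr q) \<le> (\<Sum>i\<in>{K..<L}. a i * (c * hit p {n} i))"
      using convex_weights_nonneg[OF a] by (intro sum_mono mult_left_mono) auto
    also have "\<dots> = c * (\<Sum>i\<in>{K..<L}. a i * hit p {n} i)"
      by (simp add: sum_distrib_left mult.left_commute)
    also have "\<dots> \<le> c * (1 / 4)"
      using mass[of "{n}"] \<open>0 < c\<close> by (intro mult_left_mono) auto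
    finally have "T (restrict_to {n} y) powr q \<le> 3 / 4 * c"
      using upper[of "{n}"] \<open>0 < c\<close> by linarith
    then have "T (restrict_to {n} y) \<le> (3 / 4 * c) powr (1 / q)"
      using q \<open>0 < c\<close> y by (subst le_powr_inverse_iff) (auto intro: T_nonneg c00_restrict)
    moreover have "norm (y n) \<le> T (restrict_to {n} y)"
      using norm_le_T[OF c00_restrict[OF y], of "{n}" n] by (simp add: restrict_to_apply)
    ultimately show "norm (y n) \<le> (3 / 4 * c) powr (1 / q)"
      by simp
  next
    fix Es assume Es: "Es \<in> admissible \<S>"
    have "(\<Sum>E\<in>set Es. T (restrict_to E y) powr q)
        \<le> (\<Sum>E\<in>set Es. \<Sum>i\<in>{K..<L}. a i * T (restrict_to E (x i)) powr q)"
      by (rule sum_mono[OF upper])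
    also have "\<dots> = (\<Sum>i\<in>{K..<L}. a i * (\<Sum>E\<in>set Es. T (restrict_to E (x i)) powr q))"
      by (subst sum.swap) (simp add: sum_distrib_left)
    also have "\<dots> \<le> (\<Sum>i\<in>{K..<L}. a i * (c + c * hit p (Min ` set Es) i))"
      using convex_weights_nonneg[OF a] x Es
      by (intro sum_mono mult_left_mono admissible_sum_block_le) auto
    also have "\<dots> = c * (sum a {K..<L} + (\<Sum>i\<in>{K..<L}. a i * hit p (Min ` set Es) i))"
      by (simp add: sum_distrib_left sum.distrib algebra_simps)
    also have "\<dots> \<le> c * (1 + 1 / 4)"
      using mass[of "Min ` set Es"] Es a \<open>0 < c\<close>
      by (intro mult_left_mono add_mono) (auto simp: admissible_def convex_weights_def)
    also have "\<dots> \<le> 2 * ((3 / 4 * c) powr (1 / q)) powr q"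
      using q \<open>0 < c\<close> by (simp add: powr_powr)
    finally show "(\<Sum>E\<in>set Es. T (restrict_to E y) powr q) \<le> 2 * ((3 / 4 * c) powr (1 / q)) powr q" .
  qed simp
  then have "T y powr q \<le> 3 / 4 * c"
    using q \<open>0 < c\<close> T_nonneg[OF y] by (simp add: le_powr_inverse_iff)
  then show ?thesis
    using a unfolding y_def by blast
qed

text \<open>The combinations produced by the contraction step are again successive blocks, so the step can
  be repeated.\<close>

lemma block_combination_power:
  fixes x :: "nat \<Rightarrow> nat \<Rightarrow> 'k::real_normed_field"
  assumes small: "small_family \<S>" and "strict_mono p" and "0 < c"
    and "\<And>i. x i \<in> c00" "\<And>i. supp (x i) \<subseteq> {p i..<p (Suc i)}" "\<And>i. T (x i) powr q \<le> c"
  shows "\<exists>L. \<exists>a\<in>convex_weights 0 L. T (block_combination q a {..<L} x) powr q \<le> (3 / 4) ^ m * c"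
  using assms(2-)
proof (induction m arbitrary: p c x)
  case 0
  define a :: "nat \<Rightarrow> real" where "a i = of_bool (i = 0)" for i
  have "a \<in> convex_weights 0 1"
    by (simp add: a_def convex_weights_def)
  moreover have "block_combination q a {..<1} x = x 0"
    using q by (simp add: block_combination_def a_def)
  ultimately show ?case
    using 0(5)[of 0] by (intro exI bexI[of _ a]) auto
next
  case (Suc m)
  obtain K d where K: "strict_mono K" "K 0 = (0::nat)"
    and d: "\<And>j. d j \<in> convex_weights (K j) (K (Suc j))"
    and le: "\<And>j. T (block_combination q (d j) {K j..<K (Suc j)} x) powr q \<le> 3 / 4 * c"
    by (rule convex_weights_sequence[OF block_combination_contract[OF small Suc.prems]])
      (rule that; assumption)
  define x' where "x' j = block_combination q (d j) {K j..<K (Suc j)} x" for j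
  have "strict_mono (\<lambda>j. p (K j))"
    using Suc.prems(1) K(1) by (simp add: strict_mono_def)
  moreover have "supp (x' j) \<subseteq> {p (K j)..<p (K (Suc j))}" for j
  proof
    fix n assume "n \<in> supp (x' j)"
    then have "(\<Sum>i\<in>{K j..<K (Suc j)}. of_real (d j i powr (1 / q)) * x i n) \<noteq> 0"
      by (simp add: supp_def x'_def block_combination_def)
    then obtain i where i: "i \<in> {K j..<K (Suc j)}" "x i n \<noteq> 0"
      by (metis (no_types, lifting) mult_zero_right sum.neutral)
    then have "n \<in> {p i..<p (Suc i)}"
      using Suc.prems(4)[of i] by (auto simp: supp_def)
    moreover have "p (K j) \<le> p i" "p (Suc i) \<le> p (K (Suc j))"
      using i Suc.prems(1) by (auto simp: strict_mono_less_eq)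
    ultimately show "n \<in> {p (K j)..<p (K (Suc j))}"
      by auto
  qed
  moreover have "x' j \<in> c00" "T (x' j) powr q \<le> 3 / 4 * c" for j
    using Suc.prems(3) le by (simp_all add: x'_def block_combination_c00)
  moreover have "0 < 3 / 4 * c"
    using Suc.prems(2) by simp
  ultimately obtain M e where e: "e \<in> convex_weights 0 M"
    and Te: "T (block_combination q e {..<M} x') powr q \<le> (3 / 4) ^ m * (3 / 4 * c)"
    using Suc.IH[of "\<lambda>j. p (K j)" "3 / 4 * c" x'] by blast
  obtain a where a: "a \<in> convex_weights 0 (K M)"
    and blk: "\<And>j i. j < M \<Longrightarrow> i \<in> {K j..<K (Suc j)} \<Longrightarrow> a i = e j * d j i"
    by (rule convex_weights_compose[OF K d e]) (rule that; assumption)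
  have "block_combination q a {..<K M} x = block_combination q e {..<M} x'"
  proof
    fix n
    have "(\<Sum>i<K M. of_real (a i powr (1 / q)) * x i n)
        = (\<Sum>j<M. \<Sum>i\<in>{K j..<K (Suc j)}. of_real (a i powr (1 / q)) * x i n)"
      by (rule sum_successive_blocks[OF K])
    also have "\<dots> = (\<Sum>j<M. \<Sum>i\<in>{K j..<K (Suc j)}.
        of_real (e j powr (1 / q)) * (of_real (d j i powr (1 / q)) * x i n))"
      using convex_weights_nonneg[OF e] convex_weights_nonneg[OF d]
      by (intro sum.cong refl) (simp add: blk powr_mult)
    finally show "block_combination q a {..<K M} x n = block_combination q e {..<M} x' n"
      by (simp add: block_combination_def x'_def sum_distrib_left)
  qed
  then show ?case
    using a Te by (intro exI[of _ "K M"] bexI[of _ a]) (simp_all add: mult_ac)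
qed

lemma block_combination_small:
  fixes x :: "nat \<Rightarrow> nat \<Rightarrow> 'k::real_normed_field"
  assumes "small_family \<S>" "strict_mono p" "0 < \<eta>"
    and "\<And>i. x i \<in> c00" "\<And>i. supp (x i) \<subseteq> {p i..<p (Suc i)}" "\<And>i. T (x i) \<le> 1"
  obtains L a where "a \<in> convex_weights 0 L" "T (block_combination q a {..<L} x) \<le> \<eta>"
proof -
  obtain m where m: "(3 / 4) ^ m < \<eta> powr q"
    using real_arch_pow_inv[of "\<eta> powr q" "3 / 4"] assms(3) by auto
  have "T (x i) powr q \<le> 1" for i
    using powr_mono2[of q "T (x i)" 1] assms q by (simp add: T_nonneg)
  then obtain L a where a: "a \<in> convex_weights 0 L"
    and "T (block_combination q a {..<L} x) powr q \<le> (3 / 4) ^ m * 1"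
    using block_combination_power[OF assms(1,2) zero_less_one assms(4,5)] by blast
  then have "T (block_combination q a {..<L} x) powr q \<le> \<eta> powr q"
    using m by simp
  then have "T (block_combination q a {..<L} x) \<le> \<eta>"
    using q assms(3) powr_less_mono2[of q \<eta> "T (block_combination q a {..<L} x)"] by linarith
  then show ?thesis
    using a that by blast
qed

text \<open>The basis is shrinking. Otherwise there are normalised successive blocks on which the
  functional is at least \<open>\<epsilon>\<close>, and since \<open>a\<^sub>i\<^sup>1\<^sup>/\<^sup>q \<ge> a\<^sub>i\<close> it is at least \<open>\<epsilon>\<close> on all their
  combinations, including the small ones.\<close>

lemma bounded_functional_tail:
  fixes f :: "(nat \<Rightarrow> 'k::real_normed_field) \<Rightarrow> 'k"
  assumes small: "small_family \<S>" and f: "bounded_functional T f" and "0 < \<epsilon>"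
  shows "\<exists>N. \<forall>x\<in>c00. supp x \<subseteq> {N..} \<longrightarrow> norm (f x) \<le> \<epsilon> * T x"
proof (rule ccontr)
  assume neg: "\<not> ?thesis"
  obtain B where B: "\<And>x. x \<in> c00 \<Longrightarrow> norm (f x) \<le> B * T x"
    using f unfolding bounded_functional_def by blast
  \<comment> \<open>Rotating by a unimodular scalar makes the values positive, so that they cannot cancel.\<close>
  have "\<exists>z\<in>c00. supp z \<subseteq> {N..} \<and> T z \<le> 1 \<and> (\<exists>t>\<epsilon>. f z = of_real t)" for N
  proof -
    obtain x where x: "x \<in> c00" "supp x \<subseteq> {N..}" "\<epsilon> * T x < norm (f x)"
      using neg by (auto simp: not_le)
    then have "0 < norm (f x)"
      using T_nonneg[OF x(1)] \<open>0 < \<epsilon>\<close> by (smt (verit) mult_nonneg_nonneg)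
    then have "T x \<noteq> 0"
      using B[OF x(1)] by auto
    then have "0 < T x"
      using T_nonneg[OF x(1)] by simp
    define c where "c = of_real (norm (f x) / T x) / f x"
    have "norm c = 1 / T x"
      using \<open>0 < norm (f x)\<close> \<open>0 < T x\<close> by (simp add: c_def norm_divide norm_mult)
    then have "T (\<lambda>n. c * x n) \<le> 1"
      using T_scale[OF x(1), of c] \<open>0 < T x\<close> by simp
    moreover have "f (\<lambda>n. c * x n) = of_real (norm (f x) / T x)"
      unfolding bounded_functional_scale[OF f x(1)] using \<open>0 < norm (f x)\<close> by (simp add: c_def)
    moreover have "\<epsilon> < norm (f x) / T x"
      using x(3) \<open>0 < T x\<close> by (simp add: field_simps)
    moreover have "supp (\<lambda>n. c * x n) \<subseteq> {N..}"
      using x(2) by (auto simp: supp_def)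
    ultimately show ?thesis
      using c00_scale[OF x(1)] by blast
  qed
  then obtain z t where z: "\<And>N. z N \<in> c00" "\<And>N. supp (z N) \<subseteq> {N..}" "\<And>N. T (z N) \<le> 1"
    and t: "\<And>N. \<epsilon> < t N" "\<And>N. f (z N) = of_real (t N)"
    by metis
  define p where "p = rec_nat 0 (\<lambda>_ N. Suc (Max (insert N (supp (z N)))))"
  have pS: "p (Suc i) = Suc (Max (insert (p i) (supp (z (p i)))))" for i
    by (simp add: p_def)
  have fin: "finite (insert (p i) (supp (z (p i))))" for i
    using c00_finite[OF z(1)] by simp
  have p: "strict_mono p"
    unfolding strict_mono_Suc_iff using Max_ge[OF fin insertI1] by (auto simp: pS less_Suc_eq_le)
  have supp: "supp (z (p i)) \<subseteq> {p i..<p (Suc i)}" for i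
    using z(2)[of "p i"] Max_ge[OF fin] by (auto simp: pS less_Suc_eq_le)
  define \<eta> where "\<eta> = \<epsilon> / (2 * (\<bar>B\<bar> + 1))"
  have "0 < \<eta>"
    using \<open>0 < \<epsilon>\<close> by (simp add: \<eta>_def)
  obtain L a where a: "a \<in> convex_weights 0 L"
    and small_comb: "T (block_combination q a {..<L} (\<lambda>i. z (p i))) \<le> \<eta>"
    using block_combination_small[OF small p \<open>0 < \<eta>\<close> z(1) supp z(3)] by blast
  have "f (block_combination q a {..<L} (\<lambda>i. z (p i))) = of_real (\<Sum>i<L. a i powr (1 / q) * t (p i))"
    unfolding block_combination_def using z(1) by (simp add: bounded_functional_sum[OF f] t(2))
  then have "\<bar>\<Sum>i<L. a i powr (1 / q) * t (p i)\<bar> \<le> B * T (block_combination q a {..<L} (\<lambda>i. z (p i)))"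
    using B[OF block_combination_c00[of "\<lambda>i. z (p i)"], OF z(1)] by (metis norm_of_real)
  also have "\<dots> \<le> (\<bar>B\<bar> + 1) * \<eta>"
    using small_comb T_nonneg[OF block_combination_c00[of "\<lambda>i. z (p i)"], OF z(1)]
    by (intro mult_mono) auto
  also have "\<dots> < \<epsilon>"
    using \<open>0 < \<epsilon>\<close> by (simp add: \<eta>_def field_simps add_pos_nonneg)
  finally have "(\<Sum>i<L. a i powr (1 / q) * t (p i)) < \<epsilon>"
    by linarith
  moreover have "a i * \<epsilon> \<le> a i powr (1 / q) * t (p i)" for i
  proof (rule mult_mono)
    show "a i \<le> a i powr (1 / q)"
      using q convex_weights_nonneg[OF a, of i] convex_weights_le_1[OF a, of i] powr_mono'[of "1 / q" 1 "a i"]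
      by (cases "a i = 0") auto
  qed (use t(1)[of "p i"] \<open>0 < \<epsilon>\<close> in auto)
  then have "(\<Sum>i<L. a i * \<epsilon>) \<le> (\<Sum>i<L. a i powr (1 / q) * t (p i))"
    by (rule sum_mono)
  ultimately show False
    using convex_weights_sum[OF a] by (simp add: sum_distrib_right[symmetric])
qed

end


section \<open>The dual of a completion\<close>

text \<open>The completion and its dual are compared with bounded functionals on \<open>c\<^sub>0\<^sub>0\<close> for an arbitrary
  seminorm: density identifies the two.\<close>

locale c00_norm =
  fixes \<nu> :: "(nat \<Rightarrow> 'k::{real_normed_field, banach}) \<Rightarrow> real"
  assumes nu_add: "x \<in> c00 \<Longrightarrow> y \<in> c00 \<Longrightarrow> \<nu> (\<lambda>n. x n + y n) \<le> \<nu> x + \<nu> y"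
    and nu_scale: "x \<in> c00 \<Longrightarrow> \<nu> (\<lambda>n. a * x n) = norm a * \<nu> x"
begin

definition V :: "('k, nat \<Rightarrow> 'k) normed_space" where
  "V = \<lparr>carrier = c00, vadd = (\<lambda>x y n. x n + y n), vzero = (\<lambda>n. 0),
     vscale = (\<lambda>a x n. a * x n), vnorm = \<nu>\<rparr>"

abbreviation C where "C \<equiv> completion V"

abbreviation D where "D \<equiv> dual C"

definition cls :: "(nat \<Rightarrow> nat \<Rightarrow> 'k) \<Rightarrow> (nat \<Rightarrow> nat \<Rightarrow> 'k) set" where
  "cls s = cauchy_rel V `` {s}"

definition emb :: "(nat \<Rightarrow> 'k) \<Rightarrow> (nat \<Rightarrow> nat \<Rightarrow> 'k) set" where
  "emb x = cls (\<lambda>_. x)"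

lemma V_simps [simp]:
  "carrier V = c00" "vadd V x y = (\<lambda>n. x n + y n)" "vzero V = (\<lambda>n. 0)"
  "vscale V a x = (\<lambda>n. a * x n)" "vnorm V = \<nu>"
  by (simp_all add: V_def)

lemma vdiff_V [simp]: "vdiff V x y = (\<lambda>n. x n - y n)"
  by (simp add: vdiff_def)

lemma c00_diff:
  fixes x y :: "nat \<Rightarrow> 'k"
  shows "x \<in> c00 \<Longrightarrow> y \<in> c00 \<Longrightarrow> (\<lambda>n. x n - y n) \<in> c00"
  using c00_add[OF _ c00_scale[of y "- 1"], of x] by simp

lemma nu_zero: "\<nu> (\<lambda>n. 0) = 0"
  using nu_scale[OF c00_zero, of 0] by simp

lemma nu_diff_commute: "x \<in> c00 \<Longrightarrow> y \<in> c00 \<Longrightarrow> \<nu> (\<lambda>n. x n - y n) = \<nu> (\<lambda>n. y n - x n)"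
  using nu_scale[OF c00_diff, of x y "- 1"] by simp

lemma nu_diff_triangle:
  assumes "x \<in> c00" "y \<in> c00" "z \<in> c00"
  shows "\<nu> (\<lambda>n. x n - z n) \<le> \<nu> (\<lambda>n. x n - y n) + \<nu> (\<lambda>n. y n - z n)"
  using nu_add[OF c00_diff[OF assms(1,2)] c00_diff[OF assms(2,3)]] by simp

lemma nu_diff_ge:
  assumes "x \<in> c00" "y \<in> c00"
  shows "\<bar>\<nu> x - \<nu> y\<bar> \<le> \<nu> (\<lambda>n. x n - y n)"
  using nu_add[OF c00_diff[OF assms] assms(2)] nu_add[OF c00_diff[OF assms(2,1)] assms(1)]
    nu_diff_commute[OF assms] by simp

lemma nu_nonneg: "x \<in> c00 \<Longrightarrow> 0 \<le> \<nu> x"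
  using nu_diff_ge[OF _ c00_zero, of x] nu_zero by simp

lemma cauchy_sequencesD:
  assumes "s \<in> cauchy_sequences V"
  shows "s n \<in> c00" and "0 < e \<Longrightarrow> \<exists>N. \<forall>m\<ge>N. \<forall>n\<ge>N. \<nu> (\<lambda>k. s m k - s n k) < e"
  using assms by (simp_all add: cauchy_sequences_def)

lemma cauchy_sequences_const: "x \<in> c00 \<Longrightarrow> (\<lambda>_. x) \<in> cauchy_sequences V"
  by (simp add: cauchy_sequences_def nu_zero)

lemma cauchy_sequences_add:
  assumes "s \<in> cauchy_sequences V" "t \<in> cauchy_sequences V"
  shows "(\<lambda>n k. s n k + t n k) \<in> cauchy_sequences V"
  unfolding cauchy_sequences_def
proof (safe; (unfold vdiff_V V_simps)?)
  note c = cauchy_sequencesD(1)[OF assms(1)] cauchy_sequencesD(1)[OF assms(2)]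
  show "(\<lambda>k. s n k + t n k) \<in> c00" for n
    by (intro c00_add c)
  fix e :: real assume "0 < e"
  obtain M N where M: "\<And>m n. m \<ge> M \<Longrightarrow> n \<ge> M \<Longrightarrow> \<nu> (\<lambda>k. s m k - s n k) < e / 2"
    and N: "\<And>m n. m \<ge> N \<Longrightarrow> n \<ge> N \<Longrightarrow> \<nu> (\<lambda>k. t m k - t n k) < e / 2"
    using cauchy_sequencesD(2)[OF assms(1), of "e / 2"] cauchy_sequencesD(2)[OF assms(2), of "e / 2"]
      \<open>0 < e\<close> by (metis half_gt_zero)
  have "\<nu> (\<lambda>k. (s m k + t m k) - (s n k + t n k)) < e" if "m \<ge> max M N" "n \<ge> max M N" for m n
  proof -
    have "\<nu> (\<lambda>k. (s m k - s n k) + (t m k - t n k)) \<le> \<nu> (\<lambda>k. s m k - s n k) + \<nu> (\<lambda>k. t m k - t n k)"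
      by (intro nu_add c00_diff c)
    also have "\<dots> < e"
      using M[of m n] N[of m n] that by simp
    finally show ?thesis
      by (simp add: algebra_simps)
  qed
  then show "\<exists>N. \<forall>m\<ge>N. \<forall>n\<ge>N. \<nu> (\<lambda>k. (s m k + t m k) - (s n k + t n k)) < e"
    by blast
qed

lemma cauchy_sequences_scale:
  assumes "s \<in> cauchy_sequences V"
  shows "(\<lambda>n k. a * s n k) \<in> cauchy_sequences V"
  unfolding cauchy_sequences_def
proof (safe; (unfold vdiff_V V_simps)?)
  note c = cauchy_sequencesD(1)[OF assms(1)]
  show "(\<lambda>k. a * s n k) \<in> c00" for n
    by (intro c00_scale c)
  fix e :: real assume "0 < e"
  then have "0 < e / (norm a + 1)"
    by (simp add: add_nonneg_pos)
  then obtain M where M: "\<And>m n. m \<ge> M \<Longrightarrow> n \<ge> M \<Longrightarrow> \<nu> (\<lambda>k. s m k - s n k) < e / (norm a + 1)"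
    using cauchy_sequencesD(2)[OF assms(1)] by blast
  have "\<nu> (\<lambda>k. a * s m k - a * s n k) < e" if "m \<ge> M" "n \<ge> M" for m n
  proof -
    have "\<nu> (\<lambda>k. a * s m k - a * s n k) = norm a * \<nu> (\<lambda>k. s m k - s n k)"
      using nu_scale[OF c00_diff[OF c c], of a m n] by (simp add: algebra_simps)
    also have "\<dots> \<le> norm a * (e / (norm a + 1))"
      using M[OF that] by (intro mult_left_mono) auto
    also have "\<dots> < e"
    proof -
      have "0 < norm a + 1"
        by (simp add: add_nonneg_pos)
      then show ?thesis
        using \<open>0 < e\<close> by (simp add: pos_divide_less_eq algebra_simps)
    qed
    finally show ?thesis .
  qed
  then show "\<exists>N. \<forall>m\<ge>N. \<forall>n\<ge>N. \<nu> (\<lambda>k. a * s m k - a * s n k) < e"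
    by blast
qed

lemma cauchy_relI:
  assumes "s \<in> cauchy_sequences V" "t \<in> cauchy_sequences V"
    and "\<And>n. \<nu> (\<lambda>k. s n k - t n k) \<le> g n" "g \<longlonglongrightarrow> 0"
  shows "(s, t) \<in> cauchy_rel V"
proof -
  have "0 \<le> \<nu> (\<lambda>k. s n k - t n k)" for n
    using assms(1,2) by (intro nu_nonneg c00_diff cauchy_sequencesD(1))
  then have "(\<lambda>n. \<nu> (\<lambda>k. s n k - t n k)) \<longlonglongrightarrow> 0"
    by (intro tendsto_sandwich[OF always_eventually always_eventually tendsto_const assms(4)] allI assms(3))
  then show ?thesis
    unfolding cauchy_rel_def using assms(1,2) by simp
qed

lemma cauchy_relD:
  assumes "(s, t) \<in> cauchy_rel V"
  shows "s \<in> cauchy_sequences V" "t \<in> cauchy_sequences V" "(\<lambda>n. \<nu> (\<lambda>k. s n k - t n k)) \<longlonglongrightarrow> 0"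
  using assms unfolding cauchy_rel_def by simp_all

lemma equiv_cauchy_rel: "equiv (cauchy_sequences V) (cauchy_rel V)"
proof (rule equivI)
  show "refl_on (cauchy_sequences V) (cauchy_rel V)"
    by (simp add: refl_on_def cauchy_rel_def nu_zero)
  show "cauchy_rel V \<subseteq> cauchy_sequences V \<times> cauchy_sequences V"
    by (auto dest: cauchy_relD)
  show "sym (cauchy_rel V)"
  proof (rule symI)
    fix s t assume st: "(s, t) \<in> cauchy_rel V"
    note d = cauchy_relD[OF st]
    have "\<nu> (\<lambda>k. t n k - s n k) = \<nu> (\<lambda>k. s n k - t n k)" for n
      using d by (intro nu_diff_commute cauchy_sequencesD(1))
    then show "(t, s) \<in> cauchy_rel V"
      by (rule cauchy_relI[OF d(2,1) eq_refl d(3)])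
  qed
  show "trans (cauchy_rel V)"
  proof (rule transI)
    fix s t u assume st: "(s, t) \<in> cauchy_rel V" and tu: "(t, u) \<in> cauchy_rel V"
    have lim: "(\<lambda>n. \<nu> (\<lambda>k. s n k - t n k) + \<nu> (\<lambda>k. t n k - u n k)) \<longlonglongrightarrow> 0"
      using tendsto_add[OF cauchy_relD(3)[OF st] cauchy_relD(3)[OF tu]] by simp
    have le: "\<nu> (\<lambda>k. s n k - u n k) \<le> \<nu> (\<lambda>k. s n k - t n k) + \<nu> (\<lambda>k. t n k - u n k)" for n
      using cauchy_relD(1,2)[OF st] cauchy_relD(1,2)[OF tu]
      by (intro nu_diff_triangle cauchy_sequencesD(1))
    show "(s, u) \<in> cauchy_rel V"
      by (rule cauchy_relI[OF cauchy_relD(1)[OF st] cauchy_relD(2)[OF tu] le lim])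
  qed
qed

lemma carrier_C: "carrier C = cauchy_sequences V // cauchy_rel V"
  by (simp add: completion_def)

lemma cls_carrier: "s \<in> cauchy_sequences V \<Longrightarrow> cls s \<in> carrier C"
  by (simp add: carrier_C cls_def quotientI)

lemma carrier_cls:
  assumes "A \<in> carrier C"
  obtains s where "s \<in> cauchy_sequences V" "A = cls s"
  using assms that unfolding carrier_C cls_def quotient_def by blast

lemma emb_carrier: "x \<in> c00 \<Longrightarrow> emb x \<in> carrier C"
  by (simp add: emb_def cls_carrier cauchy_sequences_const)

text \<open>The norm of a class is defined through a chosen representative; that representative is
  equivalent to every other one.\<close>

lemma cls_some:
  assumes "s \<in> cauchy_sequences V"
  shows "(s, SOME t. t \<in> cls s) \<in> cauchy_rel V"
proof -
  have "s \<in> cls s"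
    using assms equiv_class_self[OF equiv_cauchy_rel] by (simp add: cls_def)
  then have "(SOME t. t \<in> cls s) \<in> cls s"
    unfolding some_in_eq by blast
  then show ?thesis
    by (simp add: cls_def)
qed

lemma vnorm_cls_tendsto:
  assumes "s \<in> cauchy_sequences V"
  shows "(\<lambda>n. \<nu> (s n)) \<longlonglongrightarrow> vnorm C (cls s)"
proof -
  note c = cauchy_sequencesD(1)[OF assms]
  have "Cauchy (\<lambda>n. \<nu> (s n))"
  proof (rule metric_CauchyI)
    fix e :: real assume "0 < e"
    then obtain N where "\<forall>m\<ge>N. \<forall>n\<ge>N. \<nu> (\<lambda>k. s m k - s n k) < e"
      using cauchy_sequencesD(2)[OF assms] by blast
    moreover have "dist (\<nu> (s m)) (\<nu> (s n)) \<le> \<nu> (\<lambda>k. s m k - s n k)" for m n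
      using nu_diff_ge[OF c c, of m n] by (simp add: dist_real_def)
    ultimately show "\<exists>N. \<forall>m\<ge>N. \<forall>n\<ge>N. dist (\<nu> (s m)) (\<nu> (s n)) < e"
      by (meson le_less_trans)
  qed
  then obtain l where l: "(\<lambda>n. \<nu> (s n)) \<longlonglongrightarrow> l"
    by (meson Cauchy_convergent convergent_def)
  define t where "t = (SOME t. t \<in> cls s)"
  have t: "(s, t) \<in> cauchy_rel V"
    unfolding t_def by (rule cls_some[OF assms])
  have "(\<lambda>n. \<nu> (t n) - \<nu> (s n)) \<longlonglongrightarrow> 0"
  proof (rule Lim_null_comparison[OF _ cauchy_relD(3)[OF t]])
    show "\<forall>\<^sub>F n in sequentially. norm (\<nu> (t n) - \<nu> (s n)) \<le> \<nu> (\<lambda>k. s n k - t n k)"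
      using nu_diff_ge[OF c cauchy_sequencesD(1)[OF cauchy_relD(2)[OF t]]]
      by (intro always_eventually allI) (simp add: abs_minus_commute)
  qed
  from tendsto_add[OF this l] have "(\<lambda>n. \<nu> (t n)) \<longlonglongrightarrow> l"
    by simp
  then have "vnorm C (cls s) = l"
    by (simp add: completion_def t_def[symmetric] limI)
  then show ?thesis
    using l by simp
qed

lemma vnorm_emb: "x \<in> c00 \<Longrightarrow> vnorm C (emb x) = \<nu> x"
  unfolding emb_def
  by (rule LIMSEQ_unique[OF vnorm_cls_tendsto[OF cauchy_sequences_const] tendsto_const])

lemma vnorm_C_nonneg:
  assumes "A \<in> carrier C"
  shows "0 \<le> vnorm C A"
proof -
  obtain s where s: "s \<in> cauchy_sequences V" "A = cls s"
    using assms by (rule carrier_cls)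
  show ?thesis
    unfolding s(2) using nu_nonneg[OF cauchy_sequencesD(1)[OF s(1)]]
    by (intro LIMSEQ_le_const[OF vnorm_cls_tendsto[OF s(1)]]) blast
qed

lemma vadd_cls:
  assumes "s \<in> cauchy_sequences V" "t \<in> cauchy_sequences V"
  shows "vadd C (cls s) (cls t) = cls (\<lambda>n k. s n k + t n k)"
proof -
  have "congruent2 (cauchy_rel V) (cauchy_rel V) (\<lambda>s t. cls (\<lambda>n k. s n k + t n k))"
  proof (rule congruent2I')
    fix s s' t t' assume s: "(s, s') \<in> cauchy_rel V" and t: "(t, t') \<in> cauchy_rel V"
    have lim: "(\<lambda>n. \<nu> (\<lambda>k. s n k - s' n k) + \<nu> (\<lambda>k. t n k - t' n k)) \<longlonglongrightarrow> 0"
      using tendsto_add[OF cauchy_relD(3)[OF s] cauchy_relD(3)[OF t]] by simp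
    have le: "\<nu> (\<lambda>k. (s n k + t n k) - (s' n k + t' n k))
        \<le> \<nu> (\<lambda>k. s n k - s' n k) + \<nu> (\<lambda>k. t n k - t' n k)" for n
      using nu_add[of "\<lambda>k. s n k - s' n k" "\<lambda>k. t n k - t' n k"] cauchy_relD(1,2)[OF s] cauchy_relD(1,2)[OF t]
      by (simp add: c00_diff cauchy_sequencesD(1) add_diff_add)
    have "(\<lambda>n k. s n k + t n k, \<lambda>n k. s' n k + t' n k) \<in> cauchy_rel V"
      by (rule cauchy_relI[OF cauchy_sequences_add[OF cauchy_relD(1)[OF s] cauchy_relD(1)[OF t]]
          cauchy_sequences_add[OF cauchy_relD(2)[OF s] cauchy_relD(2)[OF t]] le lim])
    then show "cls (\<lambda>n k. s n k + t n k) = cls (\<lambda>n k. s' n k + t' n k)"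
      unfolding cls_def by (rule equiv_class_eq[OF equiv_cauchy_rel])
  qed
  from UN_equiv_class2[OF equiv_cauchy_rel equiv_cauchy_rel this assms]
  show ?thesis
    by (simp add: completion_def cls_def)
qed

lemma vscale_cls:
  assumes "s \<in> cauchy_sequences V"
  shows "vscale C a (cls s) = cls (\<lambda>n k. a * s n k)"
proof -
  have "congruent (cauchy_rel V) (\<lambda>s. cls (\<lambda>n k. a * s n k))"
  proof (rule congruentI)
    fix s t assume s: "(s, t) \<in> cauchy_rel V"
    have lim: "(\<lambda>n. norm a * \<nu> (\<lambda>k. s n k - t n k)) \<longlonglongrightarrow> 0"
      using tendsto_mult[OF tendsto_const cauchy_relD(3)[OF s], of "norm a"] by simp
    have eq: "\<nu> (\<lambda>k. a * s n k - a * t n k) = norm a * \<nu> (\<lambda>k. s n k - t n k)" for n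
      using nu_scale[of "\<lambda>k. s n k - t n k" a] cauchy_relD(1,2)[OF s]
      by (simp add: c00_diff cauchy_sequencesD(1) right_diff_distrib)
    have "(\<lambda>n k. a * s n k, \<lambda>n k. a * t n k) \<in> cauchy_rel V"
      by (rule cauchy_relI[OF cauchy_sequences_scale[OF cauchy_relD(1)[OF s]]
          cauchy_sequences_scale[OF cauchy_relD(2)[OF s]] eq_refl[OF eq] lim])
    then show "cls (\<lambda>n k. a * s n k) = cls (\<lambda>n k. a * t n k)"
      unfolding cls_def by (rule equiv_class_eq[OF equiv_cauchy_rel])
  qed
  from UN_equiv_class[OF equiv_cauchy_rel this assms]
  show ?thesis
    by (simp add: completion_def cls_def)
qed

lemma vadd_emb: "x \<in> c00 \<Longrightarrow> y \<in> c00 \<Longrightarrow> vadd C (emb x) (emb y) = emb (\<lambda>n. x n + y n)"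
  by (simp add: emb_def vadd_cls cauchy_sequences_const)

lemma vscale_emb: "x \<in> c00 \<Longrightarrow> vscale C a (emb x) = emb (\<lambda>n. a * x n)"
  by (simp add: emb_def vscale_cls cauchy_sequences_const)

lemma vadd_C_carrier: "A \<in> carrier C \<Longrightarrow> B \<in> carrier C \<Longrightarrow> vadd C A B \<in> carrier C"
  by (elim carrier_cls) (simp add: vadd_cls cls_carrier cauchy_sequences_add)

lemma vscale_C_carrier: "A \<in> carrier C \<Longrightarrow> vscale C a A \<in> carrier C"
  by (elim carrier_cls) (simp add: vscale_cls cls_carrier cauchy_sequences_scale)

lemma carrier_D:
  "f \<in> carrier D \<longleftrightarrow> f \<in> extensional (carrier C) \<and>
     (\<forall>A\<in>carrier C. \<forall>B\<in>carrier C. f (vadd C A B) = f A + f B) \<and>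
     (\<forall>a. \<forall>A\<in>carrier C. f (vscale C a A) = a * f A) \<and>
     (\<exists>b. \<forall>A\<in>carrier C. norm (f A) \<le> b * vnorm C A)"
  by (simp add: dual_def bounded_operators_def scalar_space_def PiE_def)

lemma D_simps:
  "vadd D f g = (\<lambda>A\<in>carrier C. f A + g A)" "vscale D a f = (\<lambda>A\<in>carrier C. a * f A)"
  "vzero D = (\<lambda>A\<in>carrier C. 0)"
  "vnorm D f = (SUP A\<in>{A \<in> carrier C. vnorm C A \<le> 1}. norm (f A))"
  by (simp_all add: dual_def)

lemma D_apply:
  assumes "A \<in> carrier C"
  shows "vadd D f g A = f A + g A" "vscale D a f A = a * f A" "vzero D A = 0"
  using assms by (simp_all add: D_simps)

lemma dual_bound:
  assumes "f \<in> carrier D"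
  obtains b where "0 \<le> b" "\<And>A. A \<in> carrier C \<Longrightarrow> norm (f A) \<le> b * vnorm C A"
proof -
  obtain b where b: "\<And>A. A \<in> carrier C \<Longrightarrow> norm (f A) \<le> b * vnorm C A"
    using assms unfolding carrier_D by blast
  have "norm (f A) \<le> \<bar>b\<bar> * vnorm C A" if "A \<in> carrier C" for A
    using b[OF that] mult_right_mono[OF abs_ge_self vnorm_C_nonneg[OF that], of b] by linarith
  then show ?thesis
    using that[of "\<bar>b\<bar>"] by simp
qed

lemma vzero_D: "vzero D \<in> carrier D"
  unfolding carrier_D D_simps using vadd_C_carrier vscale_C_carrier
  by (auto intro: exI[of _ 0])

lemma vadd_D:
  assumes "f \<in> carrier D" "g \<in> carrier D"
  shows "vadd D f g \<in> carrier D"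
proof -
  obtain b c where bc: "\<And>A. A \<in> carrier C \<Longrightarrow> norm (f A) \<le> b * vnorm C A"
    "\<And>A. A \<in> carrier C \<Longrightarrow> norm (g A) \<le> c * vnorm C A"
    using assms unfolding carrier_D by blast
  have "norm (f A + g A) \<le> (b + c) * vnorm C A" if "A \<in> carrier C" for A
    using bc[OF that] norm_triangle_ineq[of "f A" "g A"] unfolding distrib_right by linarith
  then have "\<exists>b. \<forall>A\<in>carrier C. norm (vadd D f g A) \<le> b * vnorm C A"
    by (intro exI[of _ "b + c"]) (simp add: D_simps)
  moreover have "vadd D f g (vadd C A B) = vadd D f g A + vadd D f g B"
    if "A \<in> carrier C" "B \<in> carrier C" for A B
    using assms that unfolding carrier_D by (simp add: D_simps vadd_C_carrier)
  moreover have "vadd D f g (vscale C a A) = a * vadd D f g A" if "A \<in> carrier C" for a A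
    using assms that unfolding carrier_D by (simp add: D_simps vscale_C_carrier distrib_left)
  ultimately show ?thesis
    unfolding carrier_D by (simp add: D_simps(1))
qed

lemma vscale_D:
  assumes "f \<in> carrier D"
  shows "vscale D a f \<in> carrier D"
proof -
  obtain b where "\<And>A. A \<in> carrier C \<Longrightarrow> norm (f A) \<le> b * vnorm C A"
    using assms unfolding carrier_D by blast
  then have "norm (a * f A) \<le> (norm a * b) * vnorm C A" if "A \<in> carrier C" for A
    using that by (simp add: norm_mult mult.assoc mult_left_mono)
  then have "\<exists>b. \<forall>A\<in>carrier C. norm (vscale D a f A) \<le> b * vnorm C A"
    by (intro exI[of _ "norm a * b"]) (simp add: D_simps)
  moreover have "vscale D a f (vadd C A B) = vscale D a f A + vscale D a f B"
    if "A \<in> carrier C" "B \<in> carrier C" for A B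
    using assms that unfolding carrier_D by (simp add: D_simps vadd_C_carrier distrib_left)
  moreover have "vscale D a f (vscale C b A) = b * vscale D a f A" if "A \<in> carrier C" for b A
    using assms that unfolding carrier_D by (simp add: D_simps vscale_C_carrier mult.left_commute)
  ultimately show ?thesis
    unfolding carrier_D by (simp add: D_simps(2))
qed

lemma linear_combination_D:
  assumes "finite (supp \<alpha>)" "\<And>k. k \<in> supp \<alpha> \<Longrightarrow> y k \<in> carrier D"
  shows "linear_combination D \<alpha> y \<in> carrier D"
    and "A \<in> carrier C \<Longrightarrow> linear_combination D \<alpha> y A = (\<Sum>k\<in>supp \<alpha>. \<alpha> k * y k A)"
proof -
  let ?F = "\<lambda>ks. foldr (\<lambda>k v. vadd D (vscale D (\<alpha> k) (y k)) v) ks (vzero D)"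
  have "?F ks \<in> carrier D \<and> (\<forall>A\<in>carrier C. ?F ks A = (\<Sum>k\<leftarrow>ks. \<alpha> k * y k A))" if "set ks \<subseteq> supp \<alpha>" for ks
    using that
  proof (induction ks)
    case Nil
    show ?case
      by (simp add: vzero_D D_apply)
  next
    case (Cons k ks)
    then have "?F (k # ks) \<in> carrier D"
      using assms(2) by (simp add: vadd_D vscale_D)
    moreover have "?F (k # ks) A = (\<Sum>k\<leftarrow>k # ks. \<alpha> k * y k A)" if "A \<in> carrier C" for A
      using Cons that by (simp add: D_apply)
    ultimately show ?case
      by blast
  qed
  then have *: "linear_combination D \<alpha> y \<in> carrier D \<and>
      (\<forall>A\<in>carrier C. linear_combination D \<alpha> y A = (\<Sum>k\<leftarrow>sorted_list_of_set (supp \<alpha>). \<alpha> k * y k A))"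
    unfolding linear_combination_def using assms(1) by simp
  then show "linear_combination D \<alpha> y \<in> carrier D"
    by blast
  show "linear_combination D \<alpha> y A = (\<Sum>k\<in>supp \<alpha>. \<alpha> k * y k A)" if "A \<in> carrier C"
    using * that assms(1) by (simp add: sum_list_distinct_conv_sum_set)
qed

lemma dual_restrict:
  assumes "f \<in> carrier D"
  shows "bounded_functional \<nu> (\<lambda>x. f (emb x))"
proof -
  obtain b where "\<And>A. A \<in> carrier C \<Longrightarrow> norm (f A) \<le> b * vnorm C A"
    using assms unfolding carrier_D by blast
  from this[OF emb_carrier] have "norm (f (emb x)) \<le> b * \<nu> x" if "x \<in> c00" for x
    using that by (simp add: vnorm_emb)
  moreover have "f (emb (\<lambda>n. x n + y n)) = f (emb x) + f (emb y)" if "x \<in> c00" "y \<in> c00" for x y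
    using assms emb_carrier[OF that(1)] emb_carrier[OF that(2)]
    unfolding carrier_D vadd_emb[OF that, symmetric] by blast
  moreover have "f (emb (\<lambda>n. a * x n)) = a * f (emb x)" if "x \<in> c00" for a x
    using assms emb_carrier[OF that] unfolding carrier_D vscale_emb[OF that, symmetric] by blast
  ultimately show ?thesis
    unfolding bounded_functional_def by blast
qed

text \<open>A functional on the completion is determined by its values on the dense copy of \<open>c\<^sub>0\<^sub>0\<close>.\<close>

lemma dual_tendsto:
  assumes f: "f \<in> carrier D" and s: "s \<in> cauchy_sequences V"
  shows "(\<lambda>n. f (emb (s n))) \<longlonglongrightarrow> f (cls s)"
proof -
  note c = cauchy_sequencesD(1)[OF s]
  obtain b where b: "0 \<le> b" "\<And>A. A \<in> carrier C \<Longrightarrow> norm (f A) \<le> b * vnorm C A"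
    using dual_bound[OF f] by blast
  define r where "r n = (\<lambda>m k. s m k + - 1 * s n k)" for n
  have r: "r n \<in> cauchy_sequences V" for n
    unfolding r_def using c s by (intro cauchy_sequences_add cauchy_sequences_const c00_scale)
  have "f (cls (r n)) = f (cls s) - f (emb (s n))" for n
  proof -
    have "cls (r n) = vadd C (cls s) (vscale C (- 1) (emb (s n)))"
      unfolding vscale_emb[OF c] unfolding emb_def r_def
      by (rule vadd_cls[OF s cauchy_sequences_const[OF c00_scale[OF c]], symmetric])
    moreover have "f (vadd C (cls s) (vscale C (- 1) (emb (s n)))) = f (cls s) + f (vscale C (- 1) (emb (s n)))"
      using f cls_carrier[OF s] vscale_C_carrier[OF emb_carrier[OF c]] unfolding carrier_D by blast
    moreover have "f (vscale C (- 1) (emb (s n))) = - 1 * f (emb (s n))"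
      using f emb_carrier[OF c] unfolding carrier_D by blast
    ultimately show ?thesis
      by simp
  qed
  moreover have "(\<lambda>n. vnorm C (cls (r n))) \<longlonglongrightarrow> 0"
  proof (rule LIMSEQ_I)
    fix e :: real assume "0 < e"
    then obtain N where N: "\<forall>m\<ge>N. \<forall>n\<ge>N. \<nu> (\<lambda>k. s m k - s n k) < e / 2"
      using cauchy_sequencesD(2)[OF s] half_gt_zero by blast
    have le: "vnorm C (cls (r n)) \<le> e / 2" if "n \<ge> N" for n
      using N that
      by (intro LIMSEQ_le_const2[OF vnorm_cls_tendsto[OF r]] exI[of _ N]) (auto simp: r_def less_imp_le)
    then have "norm (vnorm C (cls (r n)) - 0) < e" if "n \<ge> N" for n
      using le[OF that] vnorm_C_nonneg[OF cls_carrier[OF r], of n] \<open>0 < e\<close> by simp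
    then show "\<exists>N. \<forall>n\<ge>N. norm (vnorm C (cls (r n)) - 0) < e"
      by blast
  qed
  then have "(\<lambda>n. b * vnorm C (cls (r n))) \<longlonglongrightarrow> 0"
    using tendsto_mult[OF tendsto_const, of "\<lambda>n. vnorm C (cls (r n))" 0 sequentially b] by simp
  then have "(\<lambda>n. f (cls (r n))) \<longlonglongrightarrow> 0"
    by (rule Lim_null_comparison[OF always_eventually[OF allI[OF b(2)[OF cls_carrier[OF r]]]]])
  ultimately have "(\<lambda>n. f (cls s) - f (emb (s n))) \<longlonglongrightarrow> 0"
    by simp
  from tendsto_diff[OF tendsto_const[of "f (cls s)"] this] show ?thesis
    by simp
qed

lemma dual_norm_le:
  assumes "f \<in> carrier D" "0 \<le> b" "\<And>x. x \<in> c00 \<Longrightarrow> norm (f (emb x)) \<le> b * \<nu> x"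
  shows "vnorm D f \<le> b"
  unfolding D_simps
proof (rule cSUP_least)
  show "{A \<in> carrier C. vnorm C A \<le> 1} \<noteq> {}"
    using emb_carrier[OF c00_zero] vnorm_emb[OF c00_zero] nu_zero by fastforce
  fix A assume A: "A \<in> {A \<in> carrier C. vnorm C A \<le> 1}"
  then obtain s where s: "s \<in> cauchy_sequences V" "A = cls s"
    using carrier_cls by blast
  have "norm (f (cls s)) \<le> b * vnorm C (cls s)"
    using assms(3)[OF cauchy_sequencesD(1)[OF s(1)]]
    by (intro LIMSEQ_le[OF tendsto_norm[OF dual_tendsto[OF assms(1) s(1)]]
          tendsto_mult[OF tendsto_const vnorm_cls_tendsto[OF s(1)]]] exI[of _ 0] allI impI)
  also have "\<dots> \<le> b * 1"
    using A s assms(2) by (intro mult_left_mono) auto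
  finally show "norm (f A) \<le> b"
    using s by simp
qed

lemma dual_norm_bound:
  assumes f: "f \<in> carrier D" and x: "x \<in> c00"
  shows "norm (f (emb x)) \<le> vnorm D f * \<nu> x"
proof -
  obtain b where b: "0 \<le> b" "\<And>A. A \<in> carrier C \<Longrightarrow> norm (f A) \<le> b * vnorm C A"
    using dual_bound[OF f] by blast
  have "norm (f A) \<le> b" if "A \<in> carrier C" "vnorm C A \<le> 1" for A
    using b(2)[OF that(1)] mult_left_mono[OF that(2) b(1)] by simp
  then have bdd: "bdd_above ((\<lambda>A. norm (f A)) ` {A \<in> carrier C. vnorm C A \<le> 1})"
    by (auto simp: bdd_above_def)
  show ?thesis
  proof (cases "\<nu> x = 0")
    case True
    then show ?thesis
      using b(2)[OF emb_carrier[OF x]] vnorm_emb[OF x] by simp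
  next
    case False
    then have pos: "0 < \<nu> x"
      using nu_nonneg[OF x] by simp
    define c :: 'k where "c = of_real (1 / \<nu> x)"
    have c: "norm c = 1 / \<nu> x"
      unfolding c_def norm_of_real using pos by simp
    have "emb (\<lambda>n. c * x n) \<in> {A \<in> carrier C. vnorm C A \<le> 1}"
      using x c pos by (simp add: emb_carrier c00_scale vnorm_emb nu_scale)
    then have "norm (f (emb (\<lambda>n. c * x n))) \<le> vnorm D f"
      unfolding D_simps by (rule cSUP_upper[OF _ bdd])
    moreover have "f (emb (\<lambda>n. c * x n)) = c * f (emb x)"
      by (rule bounded_functional_scale[OF dual_restrict[OF f] x])
    ultimately show ?thesis
      using c pos by (simp add: norm_mult field_simps)
  qed
qed

lemma dual_norm_nonneg: "f \<in> carrier D \<Longrightarrow> x \<in> c00 \<Longrightarrow> \<nu> x = 1 \<Longrightarrow> 0 \<le> vnorm D f"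
  using order_trans[OF norm_ge_zero dual_norm_bound[of f x]] by simp

lemma dual_extend:
  assumes g: "bounded_functional \<nu> g"
  obtains f where "f \<in> carrier D" "\<And>x. x \<in> c00 \<Longrightarrow> f (emb x) = g x"
proof -
  obtain b where b: "\<And>x. x \<in> c00 \<Longrightarrow> norm (g x) \<le> b * \<nu> x"
    using g unfolding bounded_functional_def by blast
  have gdiff: "g (\<lambda>k. x k - y k) = g x - g y" if "x \<in> c00" "y \<in> c00" for x y
    using bounded_functional_add[OF g that(1) c00_scale[OF that(2)], of "- 1"]
      bounded_functional_scale[OF g that(2), of "- 1"] by simp
  define f where "f = (\<lambda>A\<in>carrier C. lim (\<lambda>n. g ((SOME s. s \<in> A) n)))"
  have tend: "(\<lambda>n. g (s n)) \<longlonglongrightarrow> f (cls s)" if s: "s \<in> cauchy_sequences V" for s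
  proof -
    note c = cauchy_sequencesD(1)[OF s]
    have b': "norm (g x) \<le> (\<bar>b\<bar> + 1) * \<nu> x" if "x \<in> c00" for x
    proof -
      have "b \<le> \<bar>b\<bar> + 1"
        by linarith
      from mult_right_mono[OF this nu_nonneg[OF that]] b[OF that] show ?thesis
        by linarith
    qed
    have "Cauchy (\<lambda>n. g (s n))"
    proof (rule metric_CauchyI)
      fix e :: real assume "0 < e"
      then have "0 < e / (\<bar>b\<bar> + 1)"
        by (simp add: add_nonneg_pos)
      then obtain N where N: "\<forall>m\<ge>N. \<forall>n\<ge>N. \<nu> (\<lambda>k. s m k - s n k) < e / (\<bar>b\<bar> + 1)"
        using cauchy_sequencesD(2)[OF s] by blast
      have "dist (g (s m)) (g (s n)) < e" if "m \<ge> N" "n \<ge> N" for m n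
      proof -
        have "dist (g (s m)) (g (s n)) \<le> (\<bar>b\<bar> + 1) * \<nu> (\<lambda>k. s m k - s n k)"
          using b'[OF c00_diff[OF c c], of m n] by (simp add: dist_norm gdiff c)
        also have "\<dots> < (\<bar>b\<bar> + 1) * (e / (\<bar>b\<bar> + 1))"
          using N that by (intro mult_strict_left_mono) auto
        also have "\<dots> = e"
          by (simp add: add_nonneg_eq_0_iff)
        finally show ?thesis .
      qed
      then show "\<exists>N. \<forall>m\<ge>N. \<forall>n\<ge>N. dist (g (s m)) (g (s n)) < e"
        by blast
    qed
    then obtain l where l: "(\<lambda>n. g (s n)) \<longlonglongrightarrow> l"
      by (meson Cauchy_convergent convergent_def)
    define t where "t = (SOME t. t \<in> cls s)"
    have t: "(s, t) \<in> cauchy_rel V"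
      unfolding t_def by (rule cls_some[OF s])
    have lim: "(\<lambda>n. b * \<nu> (\<lambda>k. s n k - t n k)) \<longlonglongrightarrow> 0"
      using tendsto_mult[OF tendsto_const cauchy_relD(3)[OF t], of b] by simp
    note tc = cauchy_sequencesD(1)[OF cauchy_relD(2)[OF t]]
    have "norm (g (s n) - g (t n)) \<le> b * \<nu> (\<lambda>k. s n k - t n k)" for n
      using b[OF c00_diff[OF c tc]] unfolding gdiff[OF c tc] .
    from Lim_null_comparison[OF always_eventually[OF allI[OF this]] lim]
    have "(\<lambda>n. g (s n) - g (t n)) \<longlonglongrightarrow> 0" .
    from tendsto_diff[OF l this] have "(\<lambda>n. g (t n)) \<longlonglongrightarrow> l"
      by simp
    then have "f (cls s) = l"
      using cls_carrier[OF s] by (simp add: f_def t_def[symmetric] limI)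
    then show ?thesis
      using l by simp
  qed
  have "f \<in> carrier D"
    unfolding carrier_D
  proof (intro conjI ballI allI)
    show "f \<in> extensional (carrier C)"
      by (simp add: f_def)
    show "f (vadd C A B) = f A + f B" if AB: "A \<in> carrier C" "B \<in> carrier C" for A B
    proof -
      obtain s t where st: "s \<in> cauchy_sequences V" "A = cls s" "t \<in> cauchy_sequences V" "B = cls t"
        using AB by (metis carrier_cls)
      have "(\<lambda>n. g (s n) + g (t n)) \<longlonglongrightarrow> f (vadd C A B)"
        using tend[OF cauchy_sequences_add[OF st(1,3)]]
        unfolding bounded_functional_add[OF g cauchy_sequencesD(1)[OF st(1)] cauchy_sequencesD(1)[OF st(3)]]
          st(2,4) vadd_cls[OF st(1,3)] .
      then show ?thesis
        using LIMSEQ_unique[OF _ tendsto_add[OF tend[OF st(1)] tend[OF st(3)]]] st by blast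
    qed
    show "f (vscale C a A) = a * f A" if A: "A \<in> carrier C" for a A
    proof -
      obtain s where st: "s \<in> cauchy_sequences V" "A = cls s"
        using A by (metis carrier_cls)
      have "(\<lambda>n. a * g (s n)) \<longlonglongrightarrow> f (vscale C a A)"
        using tend[OF cauchy_sequences_scale[OF st(1)], of a]
        unfolding bounded_functional_scale[OF g cauchy_sequencesD(1)[OF st(1)]] st(2) vscale_cls[OF st(1)] .
      then show ?thesis
        using LIMSEQ_unique[OF _ tendsto_mult[OF tendsto_const tend[OF st(1)]]] st by blast
    qed
    have "norm (f A) \<le> b * vnorm C A" if A: "A \<in> carrier C" for A
    proof -
      obtain s where st: "s \<in> cauchy_sequences V" "A = cls s"
        using A by (metis carrier_cls)
      show ?thesis
        unfolding st(2) using b[OF cauchy_sequencesD(1)[OF st(1)]]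
        by (intro LIMSEQ_le[OF tendsto_norm[OF tend[OF st(1)]]
              tendsto_mult[OF tendsto_const vnorm_cls_tendsto[OF st(1)]]] exI[of _ 0] allI impI)
    qed
    then show "\<exists>b. \<forall>A\<in>carrier C. norm (f A) \<le> b * vnorm C A"
      by blast
  qed
  moreover have "f (emb x) = g x" if "x \<in> c00" for x
    unfolding emb_def
    using LIMSEQ_unique[OF tend[OF cauchy_sequences_const[OF that]] tendsto_const] .
  ultimately show ?thesis
    using that by blast
qed

end


section \<open>Upper estimates in the dual\<close>

locale conjugate_exponents =
  fixes q :: real and p :: ereal
  assumes one_le_q: "1 \<le> q" and one_less_p: "1 < p" and conjugate: "1 / p + 1 / ereal q = 1"
begin

lemma conjugate_cases:
  obtains (infinite) "p = \<infinity>" "q = 1"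
  | (finite) r where "p = ereal r" "1 < r" "1 < q" "1 / r + 1 / q = 1"
proof (cases p)
  case (real r)
  have r: "1 < r"
    using one_less_p real by simp
  then have c: "1 / r + 1 / q = 1"
    using conjugate real one_le_q by (simp add: divide_ereal_def divide_inverse one_ereal_def)
  moreover have "0 < 1 / r"
    using r by simp
  ultimately have "q \<noteq> 1"
    by auto
  then show ?thesis
    using that(2)[of r] real r c one_le_q by simp
next
  case PInf
  then show ?thesis
    using that(1) conjugate one_le_q by (simp add: divide_ereal_def one_ereal_def)
next
  case MInf
  then show ?thesis
    using one_less_p by simp
qed

lemma lp_norm_nonneg: "finite (supp \<alpha>) \<Longrightarrow> 0 \<le> lp_norm p \<alpha>"
  unfolding lp_norm_def using order_trans[OF norm_ge_zero norm_le_sup_norm] by auto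

lemma holder_lp_norm:
  assumes fin: "finite (supp \<alpha>)" and c: "\<And>k. k \<in> supp \<alpha> \<Longrightarrow> 0 \<le> c k"
  shows "(\<Sum>k\<in>supp \<alpha>. norm (\<alpha> k) * c k) \<le> lp_norm p \<alpha> * (\<Sum>k\<in>supp \<alpha>. c k powr q) powr (1 / q)"
proof (cases rule: conjugate_cases)
  case infinite
  have "(\<Sum>k\<in>supp \<alpha>. norm (\<alpha> k) * c k) \<le> (\<Sum>k\<in>supp \<alpha>. sup_norm \<alpha> * c k)"
    using norm_le_sup_norm[OF fin] c by (intro sum_mono mult_right_mono) auto
  moreover have "(\<Sum>k\<in>supp \<alpha>. c k powr q) = (\<Sum>k\<in>supp \<alpha>. c k)"
    using c infinite by (intro sum.cong) auto
  ultimately show ?thesis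
    using infinite c by (simp add: lp_norm_def sum_distrib_left sum_nonneg)
next
  case (finite r)
  define A where "A = (\<Sum>k\<in>supp \<alpha>. norm (\<alpha> k) powr r)"
  define B where "B = (\<Sum>k\<in>supp \<alpha>. c k powr q)"
  have lp: "lp_norm p \<alpha> = A powr (1 / r)"
    using finite by (simp add: lp_norm_def A_def)
  show ?thesis
  proof (cases "supp \<alpha> = {} \<or> B = 0")
    case True
    have "(\<Sum>k\<in>supp \<alpha>. norm (\<alpha> k) * c k) = 0"
    proof (rule sum.neutral, rule ballI)
      fix k assume "k \<in> supp \<alpha>"
      then have "c k powr q = 0"
        using True fin by (auto simp: B_def sum_nonneg_eq_0_iff)
      then show "norm (\<alpha> k) * c k = 0"
        by simp
    qed
    then show ?thesis
      by (simp add: lp)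
  next
    case False
    have "0 \<le> B"
      by (simp add: B_def sum_nonneg)
    then have B: "0 < B"
      using False by simp
    have A: "0 < A"
      unfolding A_def using False fin by (intro sum_pos) (auto simp: supp_def)
    define a b where "a k = norm (\<alpha> k) / A powr (1 / r)" and "b k = c k / B powr (1 / q)" for k
    have "(\<Sum>k\<in>supp \<alpha>. a k * b k) \<le> (\<Sum>k\<in>supp \<alpha>. a k powr r / r + b k powr q / q)"
      using finite c A B by (intro sum_mono Youngs_inequality) (auto simp: a_def b_def)
    also have "\<dots> = (\<Sum>k\<in>supp \<alpha>. norm (\<alpha> k) powr r / A / r + c k powr q / B / q)"
      using finite c A B by (intro sum.cong refl) (simp add: a_def b_def powr_divide powr_powr)
    also have "\<dots> = A / A / r + B / B / q"
      by (simp add: sum.distrib A_def[symmetric] B_def[symmetric] flip: sum_divide_distrib)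
    also have "\<dots> = 1"
      using A B finite by simp
    finally have "(\<Sum>k\<in>supp \<alpha>. norm (\<alpha> k) * c k) / (A powr (1 / r) * B powr (1 / q)) \<le> 1"
      by (simp add: a_def b_def sum_divide_distrib)
    then show ?thesis
      using A B by (simp add: lp B_def[symmetric] divide_le_eq)
  qed
qed

lemma norm_le_lp_norm:
  assumes "finite (supp \<alpha>)"
  shows "norm (\<alpha> k) \<le> lp_norm p \<alpha>"
proof (cases "k \<in> supp \<alpha>")
  case True
  have "(\<Sum>j\<in>supp \<alpha>. norm (\<alpha> j) * of_bool (j = k)) = norm (\<alpha> k)"
    using assms True by simp
  moreover have "(\<Sum>j\<in>supp \<alpha>. of_bool (j = k) powr q) = (\<Sum>j\<in>supp \<alpha>. of_bool (j = k))"
    by (intro sum.cong) auto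
  then have "(\<Sum>j\<in>supp \<alpha>. of_bool (j = k) powr q) = (1 :: real)"
    using assms True by simp
  ultimately show ?thesis
    using holder_lp_norm[OF assms, of "\<lambda>j. of_bool (j = k)"] by simp
next
  case False
  then show ?thesis
    using lp_norm_nonneg[OF assms] by (simp add: supp_def)
qed

text \<open>The norming coefficients for the weights \<open>b\<^sup>1\<^sup>/\<^sup>q\<close>. Since \<open>1 - 1/q = 1/p\<close>, the formula \<open>b\<^sup>1\<^sup>-\<^sup>1\<^sup>/\<^sup>q\<close>
  also covers \<open>p = \<infinity>\<close>.\<close>

lemma lp_norm_powr_le_1:
  fixes \<alpha> :: "nat \<Rightarrow> 'k::real_normed_field"
  assumes "finite I" "\<And>k. k \<in> I \<Longrightarrow> 0 \<le> b k" "\<And>k. k \<notin> I \<Longrightarrow> \<alpha> k = 0"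
    and \<alpha>: "\<And>k. k \<in> I \<Longrightarrow> norm (\<alpha> k) = b k powr (1 - 1 / q)" and "sum b I \<le> 1"
  shows "lp_norm p \<alpha> \<le> 1"
proof -
  have supp: "supp \<alpha> \<subseteq> I"
    using assms(3) by (auto simp: supp_def)
  show ?thesis
  proof (cases rule: conjugate_cases)
    case infinite
    have "norm (\<alpha> k) \<le> 1" for k
      using assms(3)[of k] \<alpha>[of k] infinite by (cases "k \<in> I") auto
    then show ?thesis
      using infinite by (simp add: lp_norm_def sup_norm_le)
  next
    case (finite r)
    have "(1 - 1 / q) * r = 1"
      using finite by (simp add: field_simps)
    then have "norm (\<alpha> k) powr r = b k" if "k \<in> I" for k
      using \<alpha>[OF that] assms(2)[OF that] by (simp add: powr_powr)
    then have "(\<Sum>k\<in>supp \<alpha>. norm (\<alpha> k) powr r) = (\<Sum>k\<in>supp \<alpha>. b k)"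
      using supp by (intro sum.cong) auto
    also have "\<dots> \<le> sum b I"
      using assms(1,2) supp by (intro sum_mono2) auto
    finally have "(\<Sum>k\<in>supp \<alpha>. norm (\<alpha> k) powr r) \<le> 1"
      using assms(5) by simp
    then show ?thesis
      using finite by (simp add: lp_norm_def powr_le1 sum_nonneg)
  qed
qed

lemma lp_norm_unimodular:
  assumes "finite (supp \<alpha>)" "supp \<alpha> \<noteq> {}" "\<And>k. k \<in> supp \<alpha> \<Longrightarrow> norm (\<alpha> k) = 1"
  shows "lp_norm p \<alpha> \<le> card (supp \<alpha>) powr (1 - 1 / q)"
proof (cases rule: conjugate_cases)
  case infinite
  have "norm (\<alpha> k) \<le> 1" for k
    using assms(3)[of k] by (cases "k \<in> supp \<alpha>") (auto simp: supp_def)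
  then show ?thesis
    using infinite assms(1,2) by (simp add: lp_norm_def sup_norm_le card_gt_0_iff)
next
  case (finite r)
  have r: "1 - 1 / q = 1 / r"
    using finite by simp
  show ?thesis
    unfolding r using finite(1) assms by (simp add: lp_norm_def)
qed

end

definition unit_vec :: "nat \<Rightarrow> nat \<Rightarrow> 'k::real_normed_field" where
  "unit_vec k = (\<lambda>n. of_bool (n = k))"

lemma supp_unit_vec: "supp (unit_vec k) = {k}"
  by (auto simp: supp_def unit_vec_def)

lemma unit_vec_c00: "1 \<le> k \<Longrightarrow> unit_vec k \<in> c00"
  by (simp add: c00_def supp_unit_vec) (simp add: unit_vec_def)

lemma (in tsirelson) T_unit_vec:
  assumes "1 \<le> k"
  shows "T (unit_vec k :: nat \<Rightarrow> 'k::real_normed_field) = 1"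
proof -
  let ?e = "unit_vec k :: nat \<Rightarrow> 'k"
  note e = unit_vec_c00[OF assms, where ?'a = 'k]
  have "T ?e powr q \<le> power_sum q ?e"
    using iter_le_power_sum[OF e] by (intro LIMSEQ_le_const2[OF iter_powr_tendsto[OF e]]) blast
  also have "\<dots> = 1 powr q"
    by (simp add: power_sum_def supp_unit_vec) (simp add: unit_vec_def)
  finally have "T ?e \<le> 1"
    using q powr_less_mono2[of q 1 "T ?e"] by linarith
  moreover have "1 \<le> T ?e"
    using norm_le_T[OF e, of k] by (simp add: unit_vec_def)
  ultimately show ?thesis
    by simp
qed

text \<open>The lower \<open>\<ell>\<^sub>q\<close> estimate on admissible blocks, with the constant \<open>2\<^sup>1\<^sup>/\<^sup>q\<close> rounded up to \<open>2\<close>.\<close>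

lemma (in tsirelson) T_sum_blocks:
  fixes w :: "nat \<Rightarrow> 'k::real_normed_field"
  assumes w: "w \<in> c00" and f: "strict_mono f" and F: "finite F" "f ` F \<in> \<S>"
  shows "(\<Sum>k\<in>F. T (restrict_to {f k..<f (Suc k)} w) powr q) powr (1 / q) \<le> 2 * T w"
proof (cases "F = {}")
  case True
  then show ?thesis
    using T_nonneg[OF w] by simp
next
  case False
  define E where "E k = {f k..<f (Suc k)}" for k
  define Es where "Es = map E (sorted_list_of_set F)"
  have fS: "f k < f (Suc k)" for k
    using f by (simp add: strict_mono_Suc_iff)
  have Min: "Min (E k) = f k" for k
    unfolding E_def using fS[of k] by (intro Min_eqI) auto
  have Max: "Max (E k) < f (Suc k)" for k
    unfolding E_def using fS[of k] by (subst Max_less_iff) auto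
  have "Max (E k) < Min (E l)" if "k < l" for k l
  proof -
    have "f (Suc k) \<le> f l"
      using that f by (simp add: strict_mono_less_eq)
    then show ?thesis
      using Max[of k] Min[of l] by simp
  qed
  then have "sorted_wrt (\<lambda>A B. Max A < Min B) Es"
    unfolding Es_def sorted_wrt_map
    by (rule sorted_wrt_mono_rel[rotated, OF strict_sorted_list_of_set])
  moreover have "E k \<noteq> {} \<and> finite (E k)" for k
    using fS[of k] by (auto simp: E_def)
  ultimately have "successive Es"
    by (auto simp: successive_def Es_def)
  moreover have "Min ` set Es = f ` F" and setEs: "set Es = E ` F"
    using F(1) by (simp_all add: Es_def Min image_image)
  moreover have "Es \<noteq> []"
    using F(1) False by (simp add: Es_def)
  ultimately have Es: "Es \<in> admissible \<S>"
    using F(2) by (simp add: admissible_def)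
  have "inj_on E F"
    by (rule inj_onI) (metis Min f strict_mono_eq)
  then have "(\<Sum>k\<in>F. T (restrict_to (E k) w) powr q) = (\<Sum>A\<in>set Es. T (restrict_to A w) powr q)"
    unfolding setEs by (simp add: sum.reindex)
  also have "\<dots> \<le> 2 * T w powr q"
    by (rule T_admissible[OF w Es])
  also have "\<dots> \<le> 2 powr q * T w powr q"
    using q powr_mono[of 1 q 2] by (intro mult_right_mono) auto
  also have "\<dots> = (2 * T w) powr q"
    using T_nonneg[OF w] by (simp add: powr_mult)
  finally show ?thesis
    using q T_nonneg[OF w] by (simp add: powr_inverse_le_iff E_def sum_nonneg)
qed

lemma sum_half_powers_le_1:
  assumes "finite F" "F \<subseteq> {1..}"
  shows "(\<Sum>k\<in>F. (1 / 2 :: real) ^ k) \<le> 1"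
proof -
  define n where "n = Max (insert 1 F)"
  have "F \<subseteq> {1..n}"
    using assms by (auto simp: n_def)
  then have "(\<Sum>k\<in>F. (1 / 2 :: real) ^ k) \<le> (\<Sum>k\<in>{1..n}. (1 / 2) ^ k)"
    by (intro sum_mono2) auto
  also have "(\<Sum>k\<in>{1..n}. (1 / 2 :: real) ^ k) = 1 - (1 / 2) ^ n"
    by (induction n) auto
  finally show ?thesis
    by (rule order_trans) simp
qed

text \<open>What the theorem uses of a Schreier family: it is small, spreading, and contains large subsets
  of every infinite set. The parameter \<open>scalars\<close> only fixes the scalar field.\<close>

locale tsirelson_dual = tsirelson q \<S> + conjugate_exponents q p +
  c00_norm "tsirelson_norm q \<S> :: (nat \<Rightarrow> 'k::{real_normed_field, banach}) \<Rightarrow> real"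
  for q :: real and \<S> :: "nat set set" and p :: ereal
    and scalars :: "'k::{real_normed_field, banach} itself" +
  assumes small: "small_family \<S>"
    and spreading: "strict_mono f \<Longrightarrow> F \<in> \<S> \<Longrightarrow> f ` F \<in> \<S>"
    and large: "infinite M \<Longrightarrow> \<exists>F\<subseteq>M. card F = m \<and> F \<in> \<S>"
begin

lemma dual_null_on_heads:
  assumes y: "\<And>n. 1 \<le> n \<Longrightarrow> y n \<in> carrier D"
    and null: "\<And>k. 1 \<le> k \<Longrightarrow> (\<lambda>n. y n (emb (unit_vec k))) \<longlonglongrightarrow> 0" and "0 < \<epsilon>"
  shows "\<exists>N\<ge>n0. \<forall>w\<in>c00. supp w \<subseteq> {..<M} \<longrightarrow> norm (y N (emb w)) \<le> \<epsilon> * T w"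
proof -
  have "(\<lambda>n. \<Sum>k\<in>{1..<M}. norm (y n (emb (unit_vec k)))) \<longlonglongrightarrow> (\<Sum>k\<in>{1..<M}. 0)"
    using null by (intro tendsto_sum tendsto_norm_zero) auto
  then have "\<forall>\<^sub>F n in sequentially. (\<Sum>k\<in>{1..<M}. norm (y n (emb (unit_vec k)))) < \<epsilon>"
    using \<open>0 < \<epsilon>\<close> by (intro order_tendstoD(2)[of _ 0]) auto
  then obtain N0 where N0: "\<And>n. n \<ge> N0 \<Longrightarrow> (\<Sum>k\<in>{1..<M}. norm (y n (emb (unit_vec k)))) < \<epsilon>"
    by (auto simp: eventually_sequentially)
  define N where "N = Max {n0, N0, 1}"
  have N: "n0 \<le> N" "N0 \<le> N" "1 \<le> N"
    by (auto simp: N_def)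
  have "norm (y N (emb w)) \<le> \<epsilon> * T w" if w: "w \<in> c00" "supp w \<subseteq> {..<M}" for w
  proof -
    have "w n = (\<Sum>k\<in>{1..<M}. w k * unit_vec k n)" for n
    proof (cases "n \<in> {1..<M}")
      case False
      then have "w n = 0"
        using w by (cases "n = 0") (auto simp: supp_def c00_def)
      moreover have "(\<Sum>k\<in>{1..<M}. w k * unit_vec k n) = 0"
        using False by (intro sum.neutral) (auto simp: unit_vec_def)
      ultimately show ?thesis
        by simp
    qed (simp add: unit_vec_def of_bool_def if_distrib cong: if_cong)
    then have "w = (\<lambda>n. \<Sum>k\<in>{1..<M}. w k * unit_vec k n)"
      by (rule ext)
    then have "y N (emb w) = y N (emb (\<lambda>n. \<Sum>k\<in>{1..<M}. w k * unit_vec k n))"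
      by (rule arg_cong)
    also have "\<dots> = (\<Sum>k\<in>{1..<M}. w k * y N (emb (unit_vec k)))"
      by (rule bounded_functional_sum[OF dual_restrict[OF y[OF N(3)]]]) (simp add: unit_vec_c00)
    finally have "norm (y N (emb w)) \<le> (\<Sum>k\<in>{1..<M}. norm (w k) * norm (y N (emb (unit_vec k))))"
      by (simp add: sum_norm_le norm_mult)
    also have "\<dots> \<le> (\<Sum>k\<in>{1..<M}. T w * norm (y N (emb (unit_vec k))))"
      using norm_le_T[OF w(1)] by (intro sum_mono mult_right_mono) auto
    also have "\<dots> = T w * (\<Sum>k\<in>{1..<M}. norm (y N (emb (unit_vec k))))"
      by (simp add: sum_distrib_left)
    also have "\<dots> \<le> T w * \<epsilon>"
      using N0[OF N(2)] T_nonneg[OF w(1)] by (intro mult_left_mono) auto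
    finally show ?thesis
      by (simp add: mult.commute)
  qed
  then show ?thesis
    using N(1) by blast
qed

text \<open>Sliding hump: a step first chooses a functional that is small on the indices used so far,
  which is possible by convergence at the unit vectors, and then cuts off its tail, which is
  possible because the basis is shrinking.\<close>

lemma almost_block_subsequence:
  assumes y: "\<And>n. 1 \<le> n \<Longrightarrow> y n \<in> carrier D" "\<And>n. 1 \<le> n \<Longrightarrow> vnorm D (y n) \<le> B"
    and null: "\<And>k. 1 \<le> k \<Longrightarrow> (\<lambda>n. y n (emb (unit_vec k))) \<longlonglongrightarrow> 0"
  obtains r f where "strict_mono r" "\<And>k. 1 \<le> r k" "strict_mono f"
    "\<And>k w. 1 \<le> k \<Longrightarrow> w \<in> c00 \<Longrightarrow>
      norm (y (r k) (emb w)) \<le> (1 / 2) ^ k * T w + B * T (restrict_to {f k..<f (Suc k)} w)"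
proof -
  define P where "P nM \<longleftrightarrow> 1 \<le> fst nM \<and> 1 \<le> snd nM" for nM :: "nat \<times> nat"
  define Q where "Q k nM nM' \<longleftrightarrow> fst nM < fst nM' \<and> snd nM < snd nM' \<and>
    (\<forall>w\<in>c00. supp w \<subseteq> {..<snd nM} \<longrightarrow> norm (y (fst nM') (emb w)) \<le> (1 / 2) ^ (k + 2) * T w) \<and>
    (\<forall>w\<in>c00. supp w \<subseteq> {snd nM'..} \<longrightarrow> norm (y (fst nM') (emb w)) \<le> (1 / 2) ^ (k + 2) * T w)"
    for k :: nat and nM nM' :: "nat \<times> nat"
  have "\<exists>st. \<forall>k. P (st k) \<and> Q k (st k) (st (Suc k))"
  proof (rule dependent_nat_choice)
    show "\<exists>nM. P nM"
      by (intro exI[of _ "(1, 1)"]) (simp add: P_def)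
    fix nM k assume "P nM"
    have \<epsilon>: "(0 :: real) < (1 / 2) ^ (k + 2)"
      by simp
    obtain n where n: "Suc (fst nM) \<le> n"
      "\<forall>w\<in>c00. supp w \<subseteq> {..<snd nM} \<longrightarrow> norm (y n (emb w)) \<le> (1 / 2) ^ (k + 2) * T w"
      using dual_null_on_heads[OF y(1) null \<epsilon>] by blast
    then have "1 \<le> n"
      by simp
    obtain N where N: "\<forall>w\<in>c00. supp w \<subseteq> {N..} \<longrightarrow> norm (y n (emb w)) \<le> (1 / 2) ^ (k + 2) * T w"
      using bounded_functional_tail[OF small dual_restrict[OF y(1)[OF \<open>1 \<le> n\<close>]] \<epsilon>] by blast
    define M where "M = max N (Suc (snd nM))"
    have "{M..} \<subseteq> {N..}" "snd nM < M"
      by (auto simp: M_def)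
    moreover from this have "\<forall>w\<in>c00. supp w \<subseteq> {M..} \<longrightarrow> norm (y n (emb w)) \<le> (1 / 2) ^ (k + 2) * T w"
      using N by (meson subset_trans)
    ultimately have "P (n, M) \<and> Q k nM (n, M)"
      using n \<open>P nM\<close> unfolding P_def Q_def by auto
    then show "\<exists>nM'. P nM' \<and> Q k nM nM'"
      by blast
  qed
  then obtain st where st: "\<And>k. P (st k)" "\<And>k. Q k (st k) (st (Suc k))"
    by blast
  define r where "r k = fst (st k)" for k
  \<comment> \<open>Only \<open>k \<ge> 1\<close> carries a block; the value at \<open>0\<close> makes \<open>f\<close> strictly increasing on all of \<open>nat\<close>,
    as the spreading property requires.\<close>
  define f where "f k = (case k of 0 \<Rightarrow> 0 | Suc j \<Rightarrow> snd (st j))" for k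
  have r1: "1 \<le> r k" for k
    using st(1)[of k] by (simp add: r_def P_def)
  have r: "strict_mono r"
    using st(2) by (simp add: strict_mono_Suc_iff r_def Q_def)
  have f: "strict_mono f"
    unfolding strict_mono_Suc_iff
  proof
    fix k show "f k < f (Suc k)"
      using st(1)[of 0] st(2) by (cases k) (simp_all add: f_def P_def Q_def)
  qed
  have "norm (y (r k) (emb w)) \<le> (1 / 2) ^ k * T w + B * T (restrict_to {f k..<f (Suc k)} w)"
    if "1 \<le> k" and w: "w \<in> c00" for k w
  proof -
    obtain j where k: "k = Suc j"
      using \<open>1 \<le> k\<close> by (cases k) auto
    let ?g = "\<lambda>w. y (r k) (emb w)"
    note g = dual_restrict[OF y(1)[OF r1[of k]]]
    define u v z where "u = restrict_to {..<f k} w" and "v = restrict_to {f k..<f (Suc k)} w"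
      and "z = restrict_to {f (Suc k)..} w"
    have c: "u \<in> c00" "v \<in> c00" "z \<in> c00"
      using w by (simp_all add: u_def v_def z_def c00_restrict)
    have "w = (\<lambda>n. u n + (v n + z n))"
    proof
      fix n
      have "f k < f (Suc k)"
        using f by (simp add: strict_mono_Suc_iff)
      then show "w n = u n + (v n + z n)"
        by (simp add: u_def v_def z_def restrict_to_apply)
    qed
    then have "?g w = ?g (\<lambda>n. u n + (v n + z n))"
      by (rule arg_cong)
    also have "\<dots> = ?g u + (?g v + ?g z)"
      using c by (simp add: bounded_functional_add[OF g] c00_add)
    finally have "norm (?g w) \<le> norm (?g u) + (norm (?g v) + norm (?g z))"
      using norm_triangle_ineq[of "?g u" "?g v + ?g z"] norm_triangle_ineq[of "?g v" "?g z"] by simp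
    moreover have "norm (?g u) \<le> (1 / 2) ^ (j + 2) * T w"
    proof -
      have "supp u \<subseteq> {..<snd (st j)}"
        by (auto simp: u_def supp_restrict_to f_def k)
      then have "norm (?g u) \<le> (1 / 2) ^ (j + 2) * T u"
        using st(2)[of j] c(1) unfolding Q_def r_def k by blast
      also have "\<dots> \<le> (1 / 2) ^ (j + 2) * T w"
        unfolding u_def by (intro mult_left_mono T_restrict w) simp
      finally show ?thesis .
    qed
    moreover have "norm (?g z) \<le> (1 / 2) ^ (j + 2) * T w"
    proof -
      have "supp z \<subseteq> {snd (st (Suc j))..}"
        by (auto simp: z_def supp_restrict_to f_def k)
      then have "norm (?g z) \<le> (1 / 2) ^ (j + 2) * T z"
        using st(2)[of j] c(3) unfolding Q_def r_def k by blast
      also have "\<dots> \<le> (1 / 2) ^ (j + 2) * T w"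
        unfolding z_def by (intro mult_left_mono T_restrict w) simp
      finally show ?thesis .
    qed
    moreover have "norm (?g v) \<le> B * T v"
      using dual_norm_bound[OF y(1)[OF r1] c(2), of k] mult_right_mono[OF y(2)[OF r1] T_nonneg[OF c(2)], of k]
      by linarith
    moreover have "(1 / 2) ^ (j + 2) * T w + (1 / 2) ^ (j + 2) * T w = (1 / 2) ^ k * T w"
      by (simp add: k)
    ultimately show ?thesis
      unfolding v_def by linarith
  qed
  then show ?thesis
    using that r r1 f by blast
qed

text \<open>The errors are summable and every coefficient is at most the \<open>\<ell>\<^sub>p\<close> norm. For the blocks,
  Hoelder's inequality leaves the \<open>\<ell>\<^sub>q\<close> sum of the norms of the pieces of \<open>w\<close>, which the
  spreading property makes admissible.\<close>

lemma almost_block_upper_estimate: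
  assumes y: "\<And>k. 1 \<le> k \<Longrightarrow> y k \<in> carrier D" and "0 \<le> B" and f: "strict_mono f"
    and blk: "\<And>k w. 1 \<le> k \<Longrightarrow> w \<in> c00 \<Longrightarrow>
      norm (y k (emb w)) \<le> (1 / 2) ^ k * T w + B * T (restrict_to {f k..<f (Suc k)} w)"
    and \<alpha>: "\<alpha> \<in> coeffs_in \<S>"
  shows "vnorm D (linear_combination D \<alpha> y) \<le> (2 * B + 1) * lp_norm p \<alpha>"
proof -
  have fin: "finite (supp \<alpha>)" and F: "supp \<alpha> \<in> \<S>" and F1: "supp \<alpha> \<subseteq> {1..}"
    using \<alpha> by (auto simp: coeffs_in_def c00_def supp_def Suc_le_eq intro!: gr0I)
  then have yF: "\<And>k. k \<in> supp \<alpha> \<Longrightarrow> y k \<in> carrier D"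
    using y by auto
  note lp = lp_norm_nonneg[OF fin]
  show ?thesis
  proof (rule dual_norm_le[OF linear_combination_D(1)[OF fin yF]])
    show "0 \<le> (2 * B + 1) * lp_norm p \<alpha>"
      using lp \<open>0 \<le> B\<close> by simp
    fix w :: "nat \<Rightarrow> 'k" assume w: "w \<in> c00"
    let ?t = "\<lambda>k. T (restrict_to {f k..<f (Suc k)} w)"
    have "norm (linear_combination D \<alpha> y (emb w)) = norm (\<Sum>k\<in>supp \<alpha>. \<alpha> k * y k (emb w))"
      using linear_combination_D(2)[OF fin yF emb_carrier[OF w]] by simp
    also have "\<dots> \<le> (\<Sum>k\<in>supp \<alpha>. norm (\<alpha> k) * ((1 / 2) ^ k * T w + B * ?t k))"
      using F1 by (intro sum_norm_le) (auto simp: norm_mult intro!: mult_left_mono blk w)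
    also have "\<dots> = (\<Sum>k\<in>supp \<alpha>. norm (\<alpha> k) * ((1 / 2) ^ k * T w)) + B * (\<Sum>k\<in>supp \<alpha>. norm (\<alpha> k) * ?t k)"
      by (simp add: distrib_left sum.distrib sum_distrib_left mult.left_commute)
    also have "\<dots> \<le> lp_norm p \<alpha> * T w + B * (lp_norm p \<alpha> * (2 * T w))"
    proof (intro add_mono mult_left_mono \<open>0 \<le> B\<close>)
      have "(\<Sum>k\<in>supp \<alpha>. norm (\<alpha> k) * ((1 / 2) ^ k * T w))
          \<le> (\<Sum>k\<in>supp \<alpha>. lp_norm p \<alpha> * ((1 / 2) ^ k * T w))"
        using T_nonneg[OF w] norm_le_lp_norm[OF fin] by (intro sum_mono mult_right_mono) auto
      also have "\<dots> = lp_norm p \<alpha> * ((\<Sum>k\<in>supp \<alpha>. (1 / 2) ^ k) * T w)"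
        by (simp add: sum_distrib_left sum_distrib_right)
      also have "\<dots> \<le> lp_norm p \<alpha> * (1 * T w)"
        by (intro mult_left_mono mult_right_mono sum_half_powers_le_1 fin F1 lp T_nonneg w)
      finally show "(\<Sum>k\<in>supp \<alpha>. norm (\<alpha> k) * ((1 / 2) ^ k * T w)) \<le> lp_norm p \<alpha> * T w"
        by simp
      have "(\<Sum>k\<in>supp \<alpha>. norm (\<alpha> k) * ?t k) \<le> lp_norm p \<alpha> * (\<Sum>k\<in>supp \<alpha>. ?t k powr q) powr (1 / q)"
        by (rule holder_lp_norm[OF fin T_nonneg[OF c00_restrict[OF w]]])
      also have "\<dots> \<le> lp_norm p \<alpha> * (2 * T w)"
        by (intro mult_left_mono lp T_sum_blocks w f fin spreading F)
      finally show "(\<Sum>k\<in>supp \<alpha>. norm (\<alpha> k) * ?t k) \<le> lp_norm p \<alpha> * (2 * T w)" .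
    qed
    finally show "norm (linear_combination D \<alpha> y (emb w)) \<le> (2 * B + 1) * lp_norm p \<alpha> * T w"
      by (simp add: algebra_simps)
  qed
qed

end


section \<open>The two halves of the theorem\<close>

context tsirelson_dual
begin

lemma carrier_dual_D:
  "\<phi> \<in> carrier (dual D) \<longleftrightarrow> \<phi> \<in> extensional (carrier D) \<and>
     (\<forall>f\<in>carrier D. \<forall>g\<in>carrier D. \<phi> (vadd D f g) = \<phi> f + \<phi> g) \<and>
     (\<forall>a. \<forall>f\<in>carrier D. \<phi> (vscale D a f) = a * \<phi> f) \<and>
     (\<exists>b. \<forall>f\<in>carrier D. norm (\<phi> f) \<le> b * vnorm D f)"
  by (simp add: dual_def[of D] bounded_operators_def scalar_space_def PiE_def)

lemma operators_D:
  "S \<in> operators D \<longleftrightarrow> S \<in> carrier D \<rightarrow>\<^sub>E carrier D \<and>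
     (\<forall>f\<in>carrier D. \<forall>g\<in>carrier D. S (vadd D f g) = vadd D (S f) (S g)) \<and>
     (\<forall>a. \<forall>f\<in>carrier D. S (vscale D a f) = vscale D a (S f)) \<and>
     (\<exists>b. \<forall>f\<in>carrier D. vnorm D (S f) \<le> b * vnorm D f)"
  unfolding bounded_operators_def by blast

lemma vnorm_D_nonneg: "f \<in> carrier D \<Longrightarrow> 0 \<le> vnorm D f"
  using dual_norm_nonneg[of f "unit_vec 1"] by (simp add: unit_vec_c00 T_unit_vec)

text \<open>Evaluating \<open>S\<close> at a unit vector is a functional on the dual, so weak nullity of \<open>(x\<^sub>n)\<close> passes
  to the values of \<open>S x\<^sub>n\<close> at unit vectors, which is all that the sliding hump requires.\<close>

lemma WD_eq_operators: "WD_infinity p \<S> D = operators D"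
proof
  show "WD_infinity p \<S> D \<subseteq> operators D"
    by (auto simp: WD_infinity_def WD_def)
  show "operators D \<subseteq> WD_infinity p \<S> D"
  proof
    fix S assume S: "S \<in> operators D"
    obtain b where b: "\<And>f. f \<in> carrier D \<Longrightarrow> vnorm D (S f) \<le> b * vnorm D f"
      using S unfolding operators_D by blast
    have SD: "S f \<in> carrier D" if "f \<in> carrier D" for f
      using S that unfolding operators_D by blast
    define B where "B = \<bar>b\<bar>"
    have B: "0 \<le> B" "\<And>f. f \<in> carrier D \<Longrightarrow> vnorm D (S f) \<le> B * vnorm D f"
    proof -
      show "0 \<le> B"
        by (simp add: B_def)
      show "vnorm D (S f) \<le> B * vnorm D f" if "f \<in> carrier D" for f
        using b[OF that] mult_right_mono[OF abs_ge_self vnorm_D_nonneg[OF that], of b]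
        unfolding B_def by linarith
    qed
    have "S \<in> WD p (2 * B + 1) \<S> D"
      unfolding WD_def
    proof (intro CollectI conjI S allI impI, elim conjE)
      fix \<epsilon> :: real and x
      assume "0 < \<epsilon>" and x: "\<forall>n\<ge>1. x n \<in> carrier D \<and> vnorm D (x n) = 1" and wn: "weakly_null D x"
      have y: "S (x n) \<in> carrier D" "vnorm D (S (x n)) \<le> B" if "1 \<le> n" for n
        using x SD B(2)[of "x n"] that by auto
      have null: "(\<lambda>n. S (x n) (emb (unit_vec k))) \<longlonglongrightarrow> 0" if "1 \<le> k" for k
      proof -
        let ?A = "emb (unit_vec k)"
        have A: "?A \<in> carrier C"
          using that by (simp add: emb_carrier unit_vec_c00)
        define \<phi> where "\<phi> = (\<lambda>f\<in>carrier D. S f ?A)"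
        have "\<phi> (vadd D f g) = \<phi> f + \<phi> g" if "f \<in> carrier D" "g \<in> carrier D" for f g
        proof -
          have "S (vadd D f g) = vadd D (S f) (S g)"
            using S that unfolding operators_D by blast
          then show ?thesis
            using that vadd_D[OF that] D_apply(1)[OF A] by (simp add: \<phi>_def)
        qed
        moreover have "\<phi> (vscale D a f) = a * \<phi> f" if "f \<in> carrier D" for a f
        proof -
          have "S (vscale D a f) = vscale D a (S f)"
            using S that unfolding operators_D by blast
          then show ?thesis
            using that vscale_D[OF that] D_apply(2)[OF A] by (simp add: \<phi>_def)
        qed
        moreover have "norm (\<phi> f) \<le> B * vnorm D f" if "f \<in> carrier D" for f
        proof -
          have "norm (S f ?A) \<le> vnorm D (S f)"
            using dual_norm_bound[OF SD[OF that] unit_vec_c00[OF \<open>1 \<le> k\<close>]] T_unit_vec[OF \<open>1 \<le> k\<close>, where ?'k = 'k]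
            by simp
          then show ?thesis
            using B(2)[OF that] that by (simp add: \<phi>_def)
        qed
        moreover have "\<phi> \<in> extensional (carrier D)"
          by (simp add: \<phi>_def)
        ultimately have "\<phi> \<in> carrier (dual D)"
          unfolding carrier_dual_D by blast
        then have "(\<lambda>n. \<phi> (x n)) \<longlonglongrightarrow> 0"
          using wn by (simp add: weakly_null_def)
        moreover have "\<forall>\<^sub>F n in sequentially. \<phi> (x n) = S (x n) ?A"
          using x by (intro eventually_sequentiallyI[of 1]) (simp add: \<phi>_def)
        ultimately show ?thesis
          by (rule Lim_transform_eventually)
      qed
      obtain r f where r: "strict_mono r" "\<And>k. 1 \<le> r k" and f: "strict_mono f"
        and blk: "\<And>k w. 1 \<le> k \<Longrightarrow> w \<in> c00 \<Longrightarrow>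
          norm (S (x (r k)) (emb w)) \<le> (1 / 2) ^ k * T w + B * T (restrict_to {f k..<f (Suc k)} w)"
        using almost_block_subsequence[of "\<lambda>n. S (x n)" B, OF y null] by blast
      have "vnorm D (linear_combination D \<alpha> (\<lambda>k. S (x (r k)))) \<le> (2 * B + 1 + \<epsilon>) * lp_norm p \<alpha>"
        if \<alpha>: "\<alpha> \<in> coeffs_in \<S>" for \<alpha>
      proof -
        have "vnorm D (linear_combination D \<alpha> (\<lambda>k. S (x (r k)))) \<le> (2 * B + 1) * lp_norm p \<alpha>"
          by (rule almost_block_upper_estimate[OF y(1)[OF r(2)] B(1) f blk \<alpha>])
        also have "\<dots> \<le> (2 * B + 1 + \<epsilon>) * lp_norm p \<alpha>"
          using \<alpha> \<open>0 < \<epsilon>\<close> by (intro mult_right_mono lp_norm_nonneg) (auto simp: coeffs_in_def c00_def)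
        finally show ?thesis .
      qed
      then show "\<exists>r. strict_mono r \<and> (\<forall>\<alpha>\<in>coeffs_in \<S>.
          vnorm D (linear_combination D \<alpha> (\<lambda>k. S (x (r k)))) \<le> (2 * B + 1 + \<epsilon>) * lp_norm p \<alpha>)"
        using r(1) by blast
    qed
    then show "S \<in> WD_infinity p \<S> D"
      using B(1) unfolding WD_infinity_def by (intro UN_I[of "2 * B + 1"]) auto
  qed
qed

lemma functional_linear_combination:
  assumes \<phi>: "\<phi> \<in> carrier (dual D)" and fin: "finite (supp \<alpha>)"
    and y: "\<And>k. k \<in> supp \<alpha> \<Longrightarrow> y k \<in> carrier D"
  shows "\<phi> (linear_combination D \<alpha> y) = (\<Sum>k\<in>supp \<alpha>. \<alpha> k * \<phi> (y k))"
proof -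
  let ?F = "\<lambda>ks. foldr (\<lambda>k v. vadd D (vscale D (\<alpha> k) (y k)) v) ks (vzero D)"
  have add: "\<phi> (vadd D f g) = \<phi> f + \<phi> g" if "f \<in> carrier D" "g \<in> carrier D" for f g
    using \<phi> that unfolding carrier_dual_D by blast
  have scale: "\<phi> (vscale D a f) = a * \<phi> f" if "f \<in> carrier D" for a f
    using \<phi> that unfolding carrier_dual_D by blast
  have "vscale D 0 (vzero D) = vzero D"
    by (simp add: D_simps restrict_def fun_eq_iff)
  then have zero: "\<phi> (vzero D) = 0"
    using scale[OF vzero_D, of 0] by simp
  have "?F ks \<in> carrier D \<and> \<phi> (?F ks) = (\<Sum>k\<leftarrow>ks. \<alpha> k * \<phi> (y k))" if "set ks \<subseteq> supp \<alpha>" for ks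
    using that
  proof (induction ks)
    case Nil
    show ?case
      by (simp add: vzero_D zero)
  next
    case (Cons k ks)
    then show ?case
      by (simp add: add scale vadd_D vscale_D y)
  qed
  then have "\<phi> (linear_combination D \<alpha> y) = (\<Sum>k\<leftarrow>sorted_list_of_set (supp \<alpha>). \<alpha> k * \<phi> (y k))"
    unfolding linear_combination_def using fin by simp
  then show ?thesis
    using fin by (simp add: sum_list_distinct_conv_sum_set)
qed

lemma coordinate_functionals:
  obtains es where "\<And>n. 1 \<le> n \<Longrightarrow> es n \<in> carrier D" "\<And>n. 1 \<le> n \<Longrightarrow> vnorm D (es n) = 1"
    "\<And>n x. 1 \<le> n \<Longrightarrow> x \<in> c00 \<Longrightarrow> es n (emb x) = x n"
proof -
  have "\<exists>f. f \<in> carrier D \<and> (\<forall>x\<in>c00. f (emb x) = x n)" for n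
  proof -
    have "bounded_functional T (\<lambda>x :: nat \<Rightarrow> 'k. x n)"
      using norm_le_T by (auto simp: bounded_functional_def intro!: exI[of _ 1])
    then show ?thesis
      using dual_extend by metis
  qed
  then obtain es where es: "\<And>n. es n \<in> carrier D" "\<And>n x. x \<in> c00 \<Longrightarrow> es n (emb x) = x n"
    by metis
  have "vnorm D (es n) = 1" if n: "1 \<le> n" for n
  proof (rule antisym)
    show "vnorm D (es n) \<le> 1"
      using norm_le_T by (intro dual_norm_le es) (auto simp: es)
    have "norm (es n (emb (unit_vec n))) \<le> vnorm D (es n) * T (unit_vec n :: nat \<Rightarrow> 'k)"
      by (rule dual_norm_bound[OF es(1) unit_vec_c00[OF n]])
    then show "1 \<le> vnorm D (es n)"
      using n by (simp add: es unit_vec_c00 T_unit_vec) (simp add: unit_vec_def)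
  qed
  then show ?thesis
    using that es by blast
qed

text \<open>If \<open>\<bar>\<phi>(e\<^sub>n\<^sup>*)\<bar> \<ge> \<delta>\<close> for infinitely many \<open>n\<close>, choose \<open>m\<close> of them that form a set in the family.
  Signs chosen to add up the values give \<open>m \<delta> \<le> 2 \<parallel>\<phi>\<parallel> m\<^sup>1\<^sup>-\<^sup>1\<^sup>/\<^sup>q\<close>, which bounds \<open>m\<^sup>1\<^sup>/\<^sup>q\<close>.\<close>

lemma coordinate_functionals_weakly_null:
  assumes es: "\<And>n. 1 \<le> n \<Longrightarrow> es n \<in> carrier D" "\<And>n x. 1 \<le> n \<Longrightarrow> x \<in> c00 \<Longrightarrow> es n (emb x) = x n"
  shows "weakly_null D es"
  unfolding weakly_null_def
proof (rule ballI, rule ccontr)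
  fix \<phi> assume \<phi>: "\<phi> \<in> carrier (dual D)" and "\<not> (\<lambda>n. \<phi> (es n)) \<longlonglongrightarrow> 0"
  then obtain \<delta> where \<delta>: "0 < \<delta>" "\<And>N. \<exists>n\<ge>N. \<delta> \<le> norm (\<phi> (es n))"
    by (auto simp: lim_sequentially not_less)
  define M where "M = {n. 1 \<le> n \<and> \<delta> \<le> norm (\<phi> (es n))}"
  have "infinite M"
    unfolding infinite_nat_iff_unbounded_le
  proof
    fix N
    obtain n where "n \<ge> max 1 N" "\<delta> \<le> norm (\<phi> (es n))"
      using \<delta>(2) by blast
    then show "\<exists>n\<ge>N. n \<in> M"
      by (auto simp: M_def)
  qed
  obtain b where b: "\<And>f. f \<in> carrier D \<Longrightarrow> norm (\<phi> f) \<le> b * vnorm D f"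
    using \<phi> unfolding carrier_dual_D by blast
  define m where "m = nat \<lceil>(2 * \<bar>b\<bar> / \<delta>) powr q\<rceil> + 1"
  have m: "(2 * \<bar>b\<bar> / \<delta>) powr q < m" "0 < m"
    unfolding m_def by (auto, linarith)
  obtain F where F: "F \<subseteq> M" "card F = m" "F \<in> \<S>"
    using large[OF \<open>infinite M\<close>] by blast
  have finF: "finite F" "F \<noteq> {}"
    using F(2) m(2) card_ge_0_finite by auto
  define \<alpha> where "\<alpha> k = (if k \<in> F then of_real (norm (\<phi> (es k))) / \<phi> (es k) else 0)" for k
  have ne: "\<phi> (es k) \<noteq> 0" "1 \<le> k" if "k \<in> F" for k
    using that F(1) \<delta>(1) by (auto simp: M_def)
  have supp: "supp \<alpha> = F"
    using ne by (auto simp: supp_def \<alpha>_def)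
  have lp: "lp_norm p \<alpha> \<le> m powr (1 - 1 / q)"
    using lp_norm_unimodular[of \<alpha>] finF ne F(2) unfolding supp by (simp add: \<alpha>_def norm_divide)
  let ?h = "linear_combination D \<alpha> es"
  have esF: "es k \<in> carrier D" if "k \<in> supp \<alpha>" for k
    using that ne es(1) unfolding supp by blast
  have fin: "finite (supp \<alpha>)"
    using finF supp by simp
  have h: "?h \<in> carrier D"
    by (rule linear_combination_D(1)[OF fin esF])
  have "vnorm D ?h \<le> 2 * m powr (1 - 1 / q)"
  proof (rule dual_norm_le[OF h])
    fix w :: "nat \<Rightarrow> 'k" assume w: "w \<in> c00"
    have "norm (?h (emb w)) = norm (\<Sum>k\<in>F. \<alpha> k * w k)"
      using linear_combination_D(2)[OF fin esF emb_carrier[OF w]] ne(2) w es(2)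
      unfolding supp by simp
    also have "\<dots> \<le> (\<Sum>k\<in>F. norm (\<alpha> k) * norm (w k))"
      by (intro sum_norm_le) (simp add: norm_mult)
    also have "\<dots> \<le> lp_norm p \<alpha> * (\<Sum>k\<in>F. norm (w k) powr q) powr (1 / q)"
      using holder_lp_norm[of \<alpha> "\<lambda>k. norm (w k)"] finF(1) unfolding supp by simp
    also have "\<dots> \<le> lp_norm p \<alpha> * (\<Sum>k\<in>F. T (restrict_to {k..<Suc k} w) powr q) powr (1 / q)"
    proof (intro mult_left_mono powr_mono2 sum_mono)
      fix k
      show "norm (w k) \<le> T (restrict_to {k..<Suc k} w)"
        using norm_le_T[OF c00_restrict[OF w], of "{k..<Suc k}" k] by (simp add: restrict_to_apply)
    qed (use q lp_norm_nonneg finF supp in \<open>auto simp: sum_nonneg\<close>)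
    also have "\<dots> \<le> lp_norm p \<alpha> * (2 * T w)"
      using T_sum_blocks[OF w, of "\<lambda>k. k" F] finF F(3) lp_norm_nonneg supp
      by (intro mult_left_mono) (auto simp: strict_mono_def)
    also have "\<dots> \<le> m powr (1 - 1 / q) * (2 * T w)"
      using lp T_nonneg[OF w] by (intro mult_right_mono) auto
    finally show "norm (?h (emb w)) \<le> 2 * m powr (1 - 1 / q) * T w"
      by (simp add: mult_ac)
  qed simp
  then have "norm (\<phi> ?h) \<le> \<bar>b\<bar> * (2 * m powr (1 - 1 / q))"
    using b[OF h] mult_mono[OF abs_ge_self[of b], of "vnorm D ?h" "2 * m powr (1 - 1 / q)"] vnorm_D_nonneg[OF h]
    by simp
  moreover have "norm (\<phi> ?h) = (\<Sum>k\<in>F. norm (\<phi> (es k)))"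
  proof -
    have "\<phi> ?h = (\<Sum>k\<in>F. \<alpha> k * \<phi> (es k))"
      using functional_linear_combination[OF \<phi> fin esF] unfolding supp .
    also have "\<dots> = (\<Sum>k\<in>F. of_real (norm (\<phi> (es k))))"
      using ne(1) by (intro sum.cong refl) (simp add: \<alpha>_def)
    also have "\<dots> = of_real (\<Sum>k\<in>F. norm (\<phi> (es k)))"
      by (rule of_real_sum[symmetric])
    finally have eq: "\<phi> ?h = of_real (\<Sum>k\<in>F. norm (\<phi> (es k)))" .
    show ?thesis
      unfolding eq norm_of_real by (intro abs_of_nonneg sum_nonneg norm_ge_zero)
  qed
  moreover have "(\<Sum>k\<in>F. \<delta>) \<le> (\<Sum>k\<in>F. norm (\<phi> (es k)))"
    using F(1) by (intro sum_mono) (auto simp: M_def)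
  ultimately have "m * \<delta> \<le> \<bar>b\<bar> * (2 * m powr (1 - 1 / q))"
    using F(2) by simp
  also have "\<dots> = m powr (1 - 1 / q) * (2 * \<bar>b\<bar>)"
    by (simp add: mult_ac)
  finally have "m * \<delta> \<le> m powr (1 - 1 / q) * (2 * \<bar>b\<bar>)" .
  moreover have "m powr (1 - 1 / q) * m powr (1 / q) = m"
    using m(2) by (simp add: powr_add[symmetric])
  ultimately have "m powr (1 - 1 / q) * (m powr (1 / q) * \<delta>) \<le> m powr (1 - 1 / q) * (2 * \<bar>b\<bar>)"
    unfolding mult.assoc[symmetric] by simp
  then have "m powr (1 / q) * \<delta> \<le> 2 * \<bar>b\<bar>"
    using m(2) by simp
  then have "m powr (1 / q) \<le> 2 * \<bar>b\<bar> / \<delta>"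
    using \<delta>(1) by (simp add: field_simps)
  then have "m \<le> (2 * \<bar>b\<bar> / \<delta>) powr q"
    using q \<delta>(1) by (simp add: powr_inverse_le_iff)
  then show False
    using m(1) by simp
qed

lemma identity_operator: "(\<lambda>f\<in>carrier D. f) \<in> operators D"
  unfolding operators_D
proof (intro conjI ballI allI)
  show "\<exists>b. \<forall>f\<in>carrier D. vnorm D ((\<lambda>f\<in>carrier D. f) f) \<le> b * vnorm D f"
    by (intro exI[of _ 1]) simp
qed (simp_all add: vadd_D vscale_D)

text \<open>The identity fails. An upper estimate on all finite supports for \<open>(e\<^sub>r\<^sub>(\<^sub>k\<^sub>)\<^sup>*)\<close> would, by pairing
  the coefficients \<open>a\<^sub>i\<^sup>1\<^sup>-\<^sup>1\<^sup>/\<^sup>q\<close> with \<open>u = \<Sum> a\<^sub>i\<^sup>1\<^sup>/\<^sup>q e\<^sub>r\<^sub>(\<^sub>i\<^sub>)\<close>, bound the norm of \<open>u\<close> from below.\<close>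

lemma WD_omega1_neq_operators: "WD_infinity p schreier_omega1 D \<noteq> operators D"
proof
  assume "WD_infinity p schreier_omega1 D = operators D"
  then have "(\<lambda>f\<in>carrier D. f) \<in> WD_infinity p schreier_omega1 D"
    using identity_operator by simp
  then obtain c where c: "0 \<le> c" "(\<lambda>f\<in>carrier D. f) \<in> WD p c schreier_omega1 D"
    by (auto simp: WD_infinity_def)
  obtain es where es: "\<And>n. 1 \<le> n \<Longrightarrow> es n \<in> carrier D" "\<And>n. 1 \<le> n \<Longrightarrow> vnorm D (es n) = 1"
    "\<And>n x. 1 \<le> n \<Longrightarrow> x \<in> c00 \<Longrightarrow> es n (emb x) = x n"
    using coordinate_functionals by blast
  have "weakly_null D es"
    using coordinate_functionals_weakly_null es by blast
  then have "\<exists>r. strict_mono r \<and> (\<forall>\<alpha>\<in>coeffs_in schreier_omega1.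
      vnorm D (linear_combination D \<alpha> (\<lambda>k. (\<lambda>f\<in>carrier D. f) (es (r k)))) \<le> (c + 1) * lp_norm p \<alpha>)"
    using c(2) es(1,2) zero_less_one unfolding WD_def by blast
  then obtain r where r: "strict_mono r" and WD: "\<And>\<alpha>. \<alpha> \<in> coeffs_in schreier_omega1 \<Longrightarrow>
      vnorm D (linear_combination D \<alpha> (\<lambda>k. (\<lambda>f\<in>carrier D. f) (es (r k)))) \<le> (c + 1) * lp_norm p \<alpha>"
    by blast
  have r1: "1 \<le> r (Suc k)" for k
    using strict_mono_imp_increasing[OF r, of "Suc k"] by simp
  have r': "strict_mono (\<lambda>i. r (Suc i))"
    using r by (simp add: strict_mono_def)
  define x where "x i = (unit_vec (r (Suc i)) :: nat \<Rightarrow> 'k)" for i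
  have x: "x i \<in> c00" "supp (x i) \<subseteq> {r (Suc i)..<r (Suc (Suc i))}" "T (x i) \<le> 1" for i
    using r1 r by (simp_all add: x_def unit_vec_c00 supp_unit_vec T_unit_vec strict_mono_less)
  have "0 < 1 / (2 * (c + 1))"
    using c(1) by simp
  then obtain L a where a: "a \<in> convex_weights 0 L"
    and le: "T (block_combination q a {..<L} x) \<le> 1 / (2 * (c + 1))"
    using block_combination_small[OF small r' _ x] by blast
  define u where "u = block_combination q a {..<L} x"
  have u: "u \<in> c00"
    unfolding u_def by (rule block_combination_c00[OF x(1)])
  have u_r: "u (r (Suc i)) = of_real (a i powr (1 / q))" if "i < L" for i
  proof -
    have "x j (r (Suc i)) = of_bool (j = i)" for j
      using r by (auto simp: x_def unit_vec_def strict_mono_eq)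
    then have "u (r (Suc i)) = (\<Sum>j<L. of_real (a j powr (1 / q)) * of_bool (j = i))"
      by (simp only: u_def block_combination_def)
    also have "\<dots> = (\<Sum>j<L. if j = i then of_real (a j powr (1 / q)) else 0)"
      by (intro sum.cong) auto
    also have "\<dots> = of_real (a i powr (1 / q))"
      using that by simp
    finally show ?thesis .
  qed
  \<comment> \<open>Blocks are numbered from \<open>0\<close>, coefficients of a subsequence from \<open>1\<close>.\<close>
  define b where "b k = (case k of 0 \<Rightarrow> 0 | Suc i \<Rightarrow> a i)" for k
  define \<alpha> where "\<alpha> k = (of_real (b k powr (1 - 1 / q)) :: 'k)" for k
  have b: "0 \<le> b k" for k
    using convex_weights_nonneg[OF a] by (auto simp: b_def split: nat.split)
  have b_out: "b k = 0" if "k \<notin> {1..L}" for k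
    using that a by (cases k) (auto simp: b_def convex_weights_def)
  have sum_shift: "(\<Sum>k\<in>{1..L}. g k) = (\<Sum>i<L. g (Suc i))" for g :: "nat \<Rightarrow> 'b::comm_monoid_add"
    using sum.atLeast_Suc_atMost_Suc_shift[of g 0 "L - 1"]
    by (simp add: sum.shift_bounds_cl_Suc_ivl sum.atLeast1_atMost_eq)
  have supp\<alpha>: "supp \<alpha> \<subseteq> {1..L}"
    by (rule subsetI, rule ccontr) (simp add: supp_def \<alpha>_def b_out)
  then have \<alpha>: "\<alpha> \<in> coeffs_in schreier_omega1"
    using finite_subset[OF supp\<alpha>]
    by (auto simp: coeffs_in_def schreier_omega1_def c00_def supp_def)
  have "lp_norm p \<alpha> \<le> 1"
  proof (rule lp_norm_powr_le_1)
    have "sum b {1..L} = sum a {..<L}"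
      unfolding sum_shift by (simp add: b_def)
    then show "sum b {1..L} \<le> 1"
      using convex_weights_sum[OF a] by simp
  qed (use b b_out in \<open>auto simp: \<alpha>_def\<close>)
  let ?y = "\<lambda>k. (\<lambda>f\<in>carrier D. f) (es (r k))"
  let ?h = "linear_combination D \<alpha> ?y"
  have y: "?y k \<in> carrier D" "?y k (emb u) = u (r k)" if "k \<in> supp \<alpha>" for k
  proof -
    have "1 \<le> r k"
      using that supp\<alpha> r1[of "k - 1"] by auto
    then show "?y k \<in> carrier D" "?y k (emb u) = u (r k)"
      using es u by simp_all
  qed
  have fin: "finite (supp \<alpha>)"
    using finite_subset[OF supp\<alpha>] by simp
  have "?h (emb u) = (\<Sum>k\<in>supp \<alpha>. \<alpha> k * u (r k))"
    using linear_combination_D(2)[OF fin y(1) emb_carrier[OF u]] y(2) by simp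
  also have "\<dots> = (\<Sum>k\<in>{1..L}. \<alpha> k * u (r k))"
    using supp\<alpha> by (intro sum.mono_neutral_left) (auto simp: supp_def)
  also have "\<dots> = (\<Sum>i<L. of_real (a i))"
    unfolding sum_shift
  proof (intro sum.cong refl)
    fix i assume "i \<in> {..<L}"
    then have "\<alpha> (Suc i) * u (r (Suc i)) = of_real (a i powr (1 - 1 / q) * a i powr (1 / q))"
      by (simp add: u_r \<alpha>_def b_def)
    also have "\<dots> = of_real (a i)"
      using convex_weights_nonneg[OF a, of i] by (simp add: powr_add[symmetric])
    finally show "\<alpha> (Suc i) * u (r (Suc i)) = of_real (a i)" .
  qed
  also have "\<dots> = 1"
    using convex_weights_sum[OF a] by (metis of_real_1 of_real_sum)
  finally have "?h (emb u) = 1" .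
  moreover have "?h \<in> carrier D"
    by (rule linear_combination_D(1)[OF fin y(1)])
  ultimately have "1 \<le> vnorm D ?h * T u"
    using dual_norm_bound[OF _ u, of ?h] by simp
  also have "\<dots> \<le> ((c + 1) * 1) * (1 / (2 * (c + 1)))"
  proof (intro mult_mono)
    have "(c + 1) * lp_norm p \<alpha> \<le> (c + 1) * 1"
      using \<open>lp_norm p \<alpha> \<le> 1\<close> c(1) by (intro mult_left_mono) auto
    then show "vnorm D ?h \<le> (c + 1) * 1"
      using WD[OF \<alpha>] by linarith
    show "T u \<le> 1 / (2 * (c + 1))"
      using le by (simp add: u_def)
  qed (use c(1) T_nonneg[OF u] in auto)
  also have "\<dots> = 1 / 2"
    using c(1) by simp
  finally show False
    by simp
qed

end

lemma admissible_schreier_nonempty: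
  assumes "fundamental_sequences \<zeta>" "ord_one \<le> \<xi>"
  shows "admissible (schreier \<zeta> \<xi>) \<noteq> {}"
proof -
  obtain F where "card F = 1" "in_schreier \<zeta> \<xi> F"
    using in_schreier_large[OF assms infinite_UNIV_nat] by metis
  moreover from this obtain n where "F = {n}"
    by (metis card_1_singletonE)
  ultimately have "[{n}] \<in> admissible (schreier \<zeta> \<xi>)"
    by (simp add: admissible_def successive_def schreier_def)
  then show ?thesis
    by blast
qed

theorem mainTheorem4:
  fixes q :: real and p :: ereal
    and \<zeta> :: "countable_ordinal \<Rightarrow> nat \<Rightarrow> countable_ordinal"
    and \<xi> :: countable_ordinal
    and X :: "('k::{real_normed_field, euclidean_space}, (nat \<Rightarrow> nat \<Rightarrow> 'k) set \<Rightarrow> 'k) normed_space"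
  assumes "1 \<le> q"
    and "1 < p" and "1 / p + 1 / ereal q = 1"
    and "fundamental_sequences \<zeta>"
    and "ord_one \<le> \<xi>"
    and "X = dual (tsirelson_space q (schreier \<zeta> \<xi>))"
  shows "WD_infinity p (schreier \<zeta> \<xi>) X = operators X \<and>
    WD_infinity p schreier_omega1 X \<noteq> operators X"
proof -
  interpret tsirelson q "schreier \<zeta> \<xi>"
    using assms(1,4,5) admissible_schreier_nonempty by unfold_locales
  interpret tsirelson_dual q "schreier \<zeta> \<xi>" p "TYPE('k)"
  proof unfold_locales
    show "small_family (schreier \<zeta> \<xi>)"
      using small_family_schreier[OF assms(4)] .
    show "f ` F \<in> schreier \<zeta> \<xi>" if "strict_mono f" "F \<in> schreier \<zeta> \<xi>" for f F
      using that in_schreier_image by (simp add: schreier_def)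
    show "\<exists>F\<subseteq>M. card F = m \<and> F \<in> schreier \<zeta> \<xi>" if "infinite M" for M m
      using in_schreier_large[OF assms(4,5) that] by (metis mem_Collect_eq schreier_def)
  qed (use assms T_add T_scale in auto)
  have "X = D"
    by (simp add: assms(6) tsirelson_space_def V_def)
  then show ?thesis
    using WD_eq_operators WD_omega1_neq_operators by simp
qed


end
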